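(* Let $K\in\{K_0,K_1\}$ and let $\pi$ be an irreducible smooth representation of $G$. Suppose that $\pi^{I_{1,K}}\subseteq I^+(\sigma,\pi)\cap I^-(\sigma,\pi)$ holds for every weight $\sigma$ of $K$ contained in $\pi$. Then the $I_K$-subrepresentation $I^+(\sigma,\pi)\cap I^-(\sigma,\pi)$ of $\pi$ does not depend on the choice of $\sigma$: for any two weights $\sigma,\sigma'$ of $K$ contained in $\pi$ one has $I^+(\sigma,\pi)\cap I^-(\sigma,\pi)=I^+(\sigma',\pi)\cap I^-(\sigma',\pi)$.
   Context: Group. $F$ is a non-archimedean local field of odd residue characteristic $p$, $E/F$ the unramified quadratic extension with ring of integers $\mathfrak o_E$, maximal ideal $\mathfrak p_E$, and $x\mapsto\bar x$ the non-trivial Galois conjugation; $k_F,k_E$ are the residue fields; $\varpi_E\in F$ is a uniformizer of $E$. Let $\beta=\begin{pmatrix}0&0&1\\0&1&0\\1&0&0\end{pmatrix}$ and $G=\{g\in GL_3(E): g^{T}\beta\bar g=\beta\}$ (the unramified $U(2,1)(E/F)$). Put $\alpha=\mathrm{diag}(\varpi_E^{-1},1,\varpi_E)\in G$. Let $K_0=G\cap GL_3(\mathfrak o_E)$ and $K_1=G\cap\begin{pmatrix}\mathfrak o_E&\mathfrak o_E&\mathfrak p_E^{-1}\\\mathfrak p_E&\mathfrak o_E&\mathfrak o_E\\\mathfrak p_E&\mathfrak p_E&\mathfrak o_E\end{pmatrix}$; up to conjugacy these are the maximal compact open subgroups of $G$. For $K\in\{K_0,K_1\}$ let $K^1$ be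 its maximal normal pro-$p$ subgroup and $\Gamma_K=K/K^1$ (which is $U(2,1)(k_E/k_F)$ for $K_0$ and $(U(1,1)\times U(1))(k_E/k_F)$ for $K_1$). The Iwahori subgroup $I_K$ is the inverse image in $K$ of the upper triangular subgroup of $\Gamma_K$, and the pro-$p$ Iwahori subgroup $I_{1,K}$ is the inverse image of its unipotent radical. Representations. All representations are smooth over $\overline{\mathbf F}_p$. A weight of $K$ is an irreducible smooth representation of $K$; it factors through $\Gamma_K$. $\mathrm{ind}_K^G\sigma$ is the compact induction: locally constant compactly supported $f:G\to\sigma$ with $f(kg)=\sigma(k)f(g)$ for $k\in K$, $G$ acting by right translation. For $n\ge 0$, $R_n^+(\sigma)$ (resp. $R_n^-(\sigma)$) is the space of functions in $\mathrm{ind}_K^G\sigma$ supported in $K\alpha^nI_K$ (resp. $K\alpha^{-(n+1)}I_K$). Put $I^+(\sigma)=\bigoplus_{n\ge0}R_n^+(\sigma)$, $I^-(\sigma)=\bigoplus_{n\ge0}R_n^-(\sigma)$, so that $\mathrm{ind}_K^G\sigma=I^+(\sigma)\oplus I^-(\sigma)$ as $I_K$-representations. For each weight $\sigma$ contained in $\pi$, an embedding of $\sigma$ in $\pi|_K$ is fixed, $\iota:\mathrm{ind}_K^G\sigma\to\pi$ is the $G$-map induced by it via Frobenius reciprocity, and $I^{\pm}(\sigma,\pi)=\iota(I^{\pm}(\sigma))$. *)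

theory Defs
  imports
    "HOL-Analysis.Analysis"
    "HOL-Algebra.Coset"
    "HOL-Algebra.Algebraic_Closure_Type"
    "Berlekamp_Zassenhaus.Finite_Field"
begin

(* the same infix as vec_nth *)
no_notation fps_nth (infixl \<open>$\<close> 75)

section \<open>Local fields\<close>

text \<open>
  The field \<open>E\<close> is the whole type \<open>'e\<close>; its absolute value is \<open>\<bar>x\<bar> = dist x 0\<close>, so that all
  topological notions on \<open>E\<close> and on \<open>3 \<times> 3\<close> matrices over \<open>E\<close> are those of the library.
  Subfields are subsets of \<open>'e\<close> with the restricted absolute value.
\<close>

definition subfield_of :: "'e::field set \<Rightarrow> bool" where
  "subfield_of S \<longleftrightarrow> 0 \<in> S \<and> 1 \<in> S \<and>
     (\<forall>x\<in>S. \<forall>y\<in>S. x + y \<in> S \<and> x * y \<in> S) \<and> (\<forall>x\<in>S. - x \<in> S \<and> inverse x \<in> S)"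

definition is_uniformizer :: "'e::{field,metric_space} set \<Rightarrow> 'e \<Rightarrow> bool" where
  "is_uniformizer S w \<longleftrightarrow> w \<in> S \<and> 0 < dist w 0 \<and> dist w 0 < 1 \<and>
     (\<forall>x\<in>S. dist x 0 < 1 \<longrightarrow> (\<exists>y\<in>S. dist y 0 \<le> 1 \<and> x = w * y))"

definition nonarch_abs :: "'e::{field,metric_space} itself \<Rightarrow> bool" where
  "nonarch_abs T \<longleftrightarrow> (\<forall>x y::'e. dist x y = dist (x - y) 0) \<and>
     (\<forall>x y::'e. dist (x * y) 0 = dist x 0 * dist y 0) \<and>
     (\<forall>x y::'e. dist (x + y) 0 \<le> max (dist x 0) (dist y 0))"

text \<open>Complete, discretely valued (non-trivially), with finite residue field.\<close>

definition nonarch_local_field :: "'e::{field,metric_space} set \<Rightarrow> bool" where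
  "nonarch_local_field S \<longleftrightarrow> subfield_of S \<and> nonarch_abs TYPE('e) \<and> complete S \<and>
     (\<exists>w. is_uniformizer S w) \<and>
     finite ((\<lambda>x. {y\<in>S. dist y x < 1}) ` {x\<in>S. dist x 0 \<le> 1})"

definition int_ring :: "'e::{field,metric_space} set" where
  "int_ring = {x. dist x 0 \<le> 1}"

definition max_ideal :: "'e::{field,metric_space} set" where
  "max_ideal = {x. dist x 0 < 1}"

definition inv_max_ideal :: "'e::{field,metric_space} set" where
  "inv_max_ideal = {x. \<forall>y\<in>max_ideal. x * y \<in> int_ring}"

text \<open>
  \<open>E/F\<close> is unramified of degree two: the value groups agree (the residue fields are finite, so
  the residue extension is automatically separable). The map \<open>cj\<close> is the non-trivial
  \<open>F\<close>-automorphism of \<open>E\<close>.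
\<close>

definition unramified_quadratic :: "'e::{field,metric_space} set \<Rightarrow> bool" where
  "unramified_quadratic F \<longleftrightarrow>
     nonarch_local_field F \<and> nonarch_local_field (UNIV :: 'e set) \<and>
     (\<exists>t. t \<notin> F \<and> (\<forall>x. \<exists>a\<in>F. \<exists>b\<in>F. x = a + b * t)) \<and>
     (\<lambda>x. dist x 0) ` F = range (\<lambda>x::'e. dist x 0)"

definition nontrivial_galois :: "'e::field set \<Rightarrow> ('e \<Rightarrow> 'e) \<Rightarrow> bool" where
  "nontrivial_galois F cj \<longleftrightarrow> bij cj \<and>
     (\<forall>x y. cj (x + y) = cj x + cj y) \<and> (\<forall>x y. cj (x * y) = cj x * cj y) \<and>
     (\<forall>x\<in>F. cj x = x) \<and> cj \<noteq> id"


section \<open>The group and its maximal compact subgroups\<close>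

type_synonym 'e mat3 = "'e^3^3"

definition beta :: "'e::field mat3" where
  "beta = vector [vector [0, 0, 1], vector [0, 1, 0], vector [1, 0, 0]]"

definition unitary_group :: "('e::field \<Rightarrow> 'e) \<Rightarrow> 'e mat3 monoid" where
  "unitary_group cj =
     \<lparr>carrier = {g. invertible g \<and> transpose g ** beta ** (\<chi> i j. cj (g $ i $ j)) = beta},
      monoid.mult = (**), one = mat 1\<rparr>"

definition alpha :: "'e::field \<Rightarrow> 'e mat3" where
  "alpha w = vector [vector [inverse w, 0, 0], vector [0, 1, 0], vector [0, 0, w]]"

definition GL3_int :: "'e::{field,metric_space} mat3 set" where
  "GL3_int = {g. (\<forall>i j. g $ i $ j \<in> int_ring) \<and>
     (\<exists>h. (\<forall>i j. h $ i $ j \<in> int_ring) \<and> g ** h = mat 1 \<and> h ** g = mat 1)}"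

definition K1_lattice :: "'e::{field,metric_space} mat3 set" where
  "K1_lattice = {g.
     g$1$1 \<in> int_ring  \<and> g$1$2 \<in> int_ring  \<and> g$1$3 \<in> inv_max_ideal \<and>
     g$2$1 \<in> max_ideal \<and> g$2$2 \<in> int_ring  \<and> g$2$3 \<in> int_ring \<and>
     g$3$1 \<in> max_ideal \<and> g$3$2 \<in> max_ideal \<and> g$3$3 \<in> int_ring}"

datatype max_compact = K_zero | K_one

fun Kset :: "('e::{field,metric_space} \<Rightarrow> 'e) \<Rightarrow> max_compact \<Rightarrow> 'e mat3 set" where
  "Kset cj K_zero = carrier (unitary_group cj) \<inter> GL3_int"
| "Kset cj K_one = carrier (unitary_group cj) \<inter> K1_lattice"

abbreviation Kgroup :: "('e::{field,metric_space} \<Rightarrow> 'e) \<Rightarrow> max_compact \<Rightarrow> 'e mat3 monoid" where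
  "Kgroup cj \<kappa> \<equiv> (unitary_group cj)\<lparr>carrier := Kset cj \<kappa>\<rparr>"

text \<open>
  Pro-\<open>p\<close>: compact (total disconnectedness is automatic for sets of matrices over \<open>E\<close>) and all
  open normal subgroups have \<open>p\<close>-power index.
\<close>

definition pro_p :: "nat \<Rightarrow> 'e::{field,metric_space} mat3 monoid \<Rightarrow> bool" where
  "pro_p p N \<longleftrightarrow> compact (carrier N) \<and>
     (\<forall>U. U \<lhd> N \<and> openin (top_of_set (carrier N)) U \<longrightarrow> (\<exists>n. card (rcosets\<^bsub>N\<^esub> U) = p ^ n))"

definition maximal_normal_pro_p ::
  "nat \<Rightarrow> 'e::{field,metric_space} mat3 monoid \<Rightarrow> 'e mat3 set \<Rightarrow> bool" where
  "maximal_normal_pro_p p H N \<longleftrightarrow> N \<lhd> H \<and> pro_p p (H\<lparr>carrier := N\<rparr>) \<and>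
     (\<forall>M. M \<lhd> H \<and> pro_p p (H\<lparr>carrier := M\<rparr>) \<and> N \<subseteq> M \<longrightarrow> M = N)"


section \<open>Iwahori subgroups\<close>

text \<open>
  The identification of \<open>\<Gamma>\<^sub>K\<close> with a group of matrices over \<open>k\<^sub>E\<close>. For \<open>K\<^sub>0\<close> it is entrywise
  reduction. For \<open>K\<^sub>1\<close> it sends \<open>g\<close> to the pair consisting of the reduction of
  \<open>((g\<^sub>1\<^sub>1, w g\<^sub>1\<^sub>3), (w\<^sup>-\<^sup>1 g\<^sub>3\<^sub>1, g\<^sub>3\<^sub>3))\<close> in \<open>U(1,1)\<close> and of \<open>g\<^sub>2\<^sub>2\<close> in \<open>U(1)\<close>, where \<open>w\<close> is the
  uniformizer. The two predicates say that the image of \<open>g\<close> is upper triangular, respectively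
  lies in the unipotent radical of the upper triangular subgroup.
\<close>

fun red_upper :: "'e::{field,metric_space} \<Rightarrow> max_compact \<Rightarrow> 'e mat3 \<Rightarrow> bool" where
  "red_upper w K_zero g \<longleftrightarrow> g$2$1 \<in> max_ideal \<and> g$3$1 \<in> max_ideal \<and> g$3$2 \<in> max_ideal"
| "red_upper w K_one g \<longleftrightarrow> inverse w * g$3$1 \<in> max_ideal"

definition red_unipotent :: "'e::{field,metric_space} \<Rightarrow> max_compact \<Rightarrow> 'e mat3 \<Rightarrow> bool" where
  "red_unipotent w \<kappa> g \<longleftrightarrow> red_upper w \<kappa> g \<and> (\<forall>i. g $ i $ i - 1 \<in> max_ideal)"

text \<open>
  \<open>Kp\<close> stands for \<open>K\<^sup>1\<close>; subsets of \<open>\<Gamma>\<^sub>K = K/K\<^sup>1\<close> are sets of cosets.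
\<close>

definition Gamma_upper ::
  "('e::{field,metric_space} \<Rightarrow> 'e) \<Rightarrow> 'e \<Rightarrow> max_compact \<Rightarrow> 'e mat3 set \<Rightarrow> 'e mat3 set set" where
  "Gamma_upper cj w \<kappa> Kp =
     {C \<in> carrier (Kgroup cj \<kappa> Mod Kp). \<exists>h\<in>C. red_upper w \<kappa> h}"

definition Gamma_unipotent ::
  "('e::{field,metric_space} \<Rightarrow> 'e) \<Rightarrow> 'e \<Rightarrow> max_compact \<Rightarrow> 'e mat3 set \<Rightarrow> 'e mat3 set set" where
  "Gamma_unipotent cj w \<kappa> Kp =
     {C \<in> carrier (Kgroup cj \<kappa> Mod Kp). \<exists>h\<in>C. red_unipotent w \<kappa> h}"

definition Iwahori ::
  "('e::{field,metric_space} \<Rightarrow> 'e) \<Rightarrow> 'e \<Rightarrow> max_compact \<Rightarrow> 'e mat3 set \<Rightarrow> 'e mat3 set" where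
  "Iwahori cj w \<kappa> Kp =
     {g \<in> Kset cj \<kappa>. Kp #>\<^bsub>Kgroup cj \<kappa>\<^esub> g \<in> Gamma_upper cj w \<kappa> Kp}"

definition pro_p_Iwahori ::
  "('e::{field,metric_space} \<Rightarrow> 'e) \<Rightarrow> 'e \<Rightarrow> max_compact \<Rightarrow> 'e mat3 set \<Rightarrow> 'e mat3 set" where
  "pro_p_Iwahori cj w \<kappa> Kp =
     {g \<in> Kset cj \<kappa>. Kp #>\<^bsub>Kgroup cj \<kappa>\<^esub> g \<in> Gamma_unipotent cj w \<kappa> Kp}"


section \<open>Smooth representations\<close>

text \<open>
  An algebraic closure of the prime field with \<open>CARD('p)\<close> elements.
\<close>

type_synonym 'p Fpbar = "'p mod_ring alg_closure"

text \<open>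
  A representation of \<open>H\<close> is given by a subspace \<open>V\<close> of the vector space on \<open>'v\<close> and by
  operators \<open>\<rho> g\<close>, whose values matter only for \<open>g \<in> H\<close> and on \<open>V\<close>.
\<close>

definition linear_map_on ::
  "('k \<Rightarrow> 'v \<Rightarrow> 'v) \<Rightarrow> 'v set \<Rightarrow> ('v::ab_group_add \<Rightarrow> 'v) \<Rightarrow> bool" where
  "linear_map_on scl V f \<longleftrightarrow>
     (\<forall>x\<in>V. \<forall>y\<in>V. f (x + y) = f x + f y) \<and> (\<forall>c. \<forall>x\<in>V. f (scl c x) = scl c (f x))"

definition smooth_rep ::
  "('k::field \<Rightarrow> 'v \<Rightarrow> 'v) \<Rightarrow> 'e::{field,metric_space} mat3 monoid \<Rightarrow> 'v::ab_group_add set \<Rightarrow>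
    ('e mat3 \<Rightarrow> 'v \<Rightarrow> 'v) \<Rightarrow> bool" where
  "smooth_rep scl H V \<rho> \<longleftrightarrow>
     vector_space scl \<and> module.subspace scl V \<and>
     (\<forall>g\<in>carrier H. \<rho> g ` V \<subseteq> V \<and> linear_map_on scl V (\<rho> g)) \<and>
     (\<forall>x\<in>V. \<rho> \<one>\<^bsub>H\<^esub> x = x) \<and>
     (\<forall>g\<in>carrier H. \<forall>h\<in>carrier H. \<forall>x\<in>V. \<rho> (g \<otimes>\<^bsub>H\<^esub> h) x = \<rho> g (\<rho> h x)) \<and>
     (\<forall>x\<in>V. openin (top_of_set (carrier H)) {g\<in>carrier H. \<rho> g x = x})"

definition irreducible_smooth_rep ::
  "('k::field \<Rightarrow> 'v \<Rightarrow> 'v) \<Rightarrow> 'e::{field,metric_space} mat3 monoid \<Rightarrow> 'v::ab_group_add set \<Rightarrow>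
    ('e mat3 \<Rightarrow> 'v \<Rightarrow> 'v) \<Rightarrow> bool" where
  "irreducible_smooth_rep scl H V \<rho> \<longleftrightarrow> smooth_rep scl H V \<rho> \<and> V \<noteq> {0} \<and>
     (\<forall>U. module.subspace scl U \<and> U \<subseteq> V \<and> (\<forall>g\<in>carrier H. \<rho> g ` U \<subseteq> U) \<longrightarrow> U = {0} \<or> U = V)"

definition invariants :: "('g \<Rightarrow> 'v \<Rightarrow> 'v) \<Rightarrow> 'g set \<Rightarrow> 'v set" where
  "invariants \<rho> S = {x. \<forall>g\<in>S. \<rho> g x = x}"

definition rep_embedding ::
  "('k::field \<Rightarrow> 'v \<Rightarrow> 'v) \<Rightarrow> 'e::{field,metric_space} mat3 monoid \<Rightarrow> 'v::ab_group_add set \<Rightarrow>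
    ('e mat3 \<Rightarrow> 'v \<Rightarrow> 'v) \<Rightarrow> ('e mat3 \<Rightarrow> 'v \<Rightarrow> 'v) \<Rightarrow> ('v \<Rightarrow> 'v) \<Rightarrow> bool" where
  "rep_embedding scl H W \<sigma> \<pi> j \<longleftrightarrow> linear_map_on scl W j \<and> inj_on j W \<and>
     (\<forall>g\<in>carrier H. \<forall>x\<in>W. j (\<sigma> g x) = \<pi> g (j x))"

text \<open>
  Weights of \<open>K\<close> contained in \<open>\<pi>\<close>, where \<open>\<pi>\<close> acts on the whole type \<open>'v\<close>. Up to isomorphism,
  every such weight has its underlying space \<open>W\<close> inside \<open>'v\<close>, so it is no restriction to consider
  only those; the action \<open>\<sigma>\<close> on \<open>W\<close> is arbitrary and is not required to be a restriction of \<open>\<pi>\<close>.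
\<close>

definition weight_contained ::
  "('k::field \<Rightarrow> 'v \<Rightarrow> 'v) \<Rightarrow> 'e::{field,metric_space} mat3 monoid \<Rightarrow>
    ('e mat3 \<Rightarrow> 'v \<Rightarrow> 'v) \<Rightarrow> 'v::ab_group_add set \<Rightarrow> ('e mat3 \<Rightarrow> 'v \<Rightarrow> 'v) \<Rightarrow> bool" where
  "weight_contained scl H \<pi> W \<sigma> \<longleftrightarrow>
     irreducible_smooth_rep scl H W \<sigma> \<and> (\<exists>j. rep_embedding scl H W \<sigma> \<pi> j)"


section \<open>Compact induction\<close>

text \<open>Functions on \<open>G\<close> are extended by zero to all matrices.\<close>

definition compact_ind ::
  "'e::{field,metric_space} mat3 monoid \<Rightarrow> 'e mat3 set \<Rightarrow> 'v::ab_group_add set \<Rightarrow>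
    ('e mat3 \<Rightarrow> 'v \<Rightarrow> 'v) \<Rightarrow> ('e mat3 \<Rightarrow> 'v) set" where
  "compact_ind G K W \<sigma> = {f.
     (\<forall>g. g \<notin> carrier G \<longrightarrow> f g = 0) \<and> (\<forall>g\<in>carrier G. f g \<in> W) \<and>
     (\<forall>k\<in>K. \<forall>g\<in>carrier G. f (k \<otimes>\<^bsub>G\<^esub> g) = \<sigma> k (f g)) \<and>
     (\<forall>g\<in>carrier G. \<exists>U. openin (top_of_set (carrier G)) U \<and> g \<in> U \<and> (\<forall>h\<in>U. f h = f g)) \<and>
     (\<exists>C. compact C \<and> C \<subseteq> carrier G \<and> (\<forall>g. f g \<noteq> 0 \<longrightarrow> g \<in> C))}"

text \<open>
  Frobenius reciprocity identifies a \<open>G\<close>-map \<open>\<phi> : ind \<sigma> \<rightarrow> \<pi>\<close> with the \<open>K\<close>-map sending \<open>x\<close> to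
  \<open>\<phi> [1, x]\<close>, where \<open>[1, x]\<close> is supported on \<open>K\<close> and has value \<open>\<sigma> k x\<close> at \<open>k\<close>. Thus the following
  predicate says that \<open>\<phi>\<close> is the \<open>G\<close>-map induced by \<open>j\<close>; it determines \<open>\<phi>\<close> on \<open>ind \<sigma>\<close>.
\<close>

definition frobenius_induced ::
  "('k \<Rightarrow> 'v \<Rightarrow> 'v) \<Rightarrow> 'e::{field,metric_space} mat3 monoid \<Rightarrow> 'e mat3 set \<Rightarrow>
    'v::ab_group_add set \<Rightarrow> ('e mat3 \<Rightarrow> 'v \<Rightarrow> 'v) \<Rightarrow> ('e mat3 \<Rightarrow> 'v \<Rightarrow> 'v) \<Rightarrow> ('v \<Rightarrow> 'v) \<Rightarrow>
    (('e mat3 \<Rightarrow> 'v) \<Rightarrow> 'v) \<Rightarrow> bool" where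
  "frobenius_induced scl G K W \<sigma> \<pi> j \<phi> \<longleftrightarrow>
     (\<forall>f\<in>compact_ind G K W \<sigma>. \<forall>f'\<in>compact_ind G K W \<sigma>. \<phi> (\<lambda>g. f g + f' g) = \<phi> f + \<phi> f') \<and>
     (\<forall>c. \<forall>f\<in>compact_ind G K W \<sigma>. \<phi> (\<lambda>g. scl c (f g)) = scl c (\<phi> f)) \<and>
     (\<forall>h\<in>carrier G. \<forall>f\<in>compact_ind G K W \<sigma>. 
        \<phi> (\<lambda>g. if g \<in> carrier G then f (g \<otimes>\<^bsub>G\<^esub> h) else 0) = \<pi> h (\<phi> f)) \<and>
     (\<forall>x\<in>W. \<phi> (\<lambda>g. if g \<in> K then \<sigma> g x else 0) = j x)"

definition supported_ind ::
  "'e::{field,metric_space} mat3 monoid \<Rightarrow> 'e mat3 set \<Rightarrow> 'e mat3 set \<Rightarrow> 'e mat3 \<Rightarrow> int \<Rightarrow>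
    'v::ab_group_add set \<Rightarrow> ('e mat3 \<Rightarrow> 'v \<Rightarrow> 'v) \<Rightarrow> ('e mat3 \<Rightarrow> 'v) set" where
  "supported_ind G K I a m W \<sigma> =
     {f \<in> compact_ind G K W \<sigma>. \<forall>g. f g \<noteq> 0 \<longrightarrow> g \<in> (K #>\<^bsub>G\<^esub> (a [^]\<^bsub>G\<^esub> m)) <#>\<^bsub>G\<^esub> I}"

abbreviation R_plus where
  "R_plus G K I a n \<equiv> supported_ind G K I a (int n)"

abbreviation R_minus where
  "R_minus G K I a n \<equiv> supported_ind G K I a (- (int n + 1))"

text \<open>The (internal) direct sums of the \<open>R_plus\<close> and of the \<open>R_minus\<close> are the sets of finite sums.\<close>

definition I_plus ::
  "'e::{field,metric_space} mat3 monoid \<Rightarrow> 'e mat3 set \<Rightarrow> 'e mat3 set \<Rightarrow> 'e mat3 \<Rightarrow>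
    'v::ab_group_add set \<Rightarrow> ('e mat3 \<Rightarrow> 'v \<Rightarrow> 'v) \<Rightarrow> ('e mat3 \<Rightarrow> 'v) set" where
  "I_plus G K I a W \<sigma> =
     {\<lambda>g. \<Sum>n<N. r n g | N r. \<forall>n<N. r n \<in> R_plus G K I a n W \<sigma>}"

definition I_minus ::
  "'e::{field,metric_space} mat3 monoid \<Rightarrow> 'e mat3 set \<Rightarrow> 'e mat3 set \<Rightarrow> 'e mat3 \<Rightarrow>
    'v::ab_group_add set \<Rightarrow> ('e mat3 \<Rightarrow> 'v \<Rightarrow> 'v) \<Rightarrow> ('e mat3 \<Rightarrow> 'v) set" where
  "I_minus G K I a W \<sigma> =
     {\<lambda>g. \<Sum>n<N. r n g | N r. \<forall>n<N. r n \<in> R_minus G K I a n W \<sigma>}"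

end

theory Submission
  imports Defs "HOL-Algebra.Sylow"
begin

text \<open>
  Write \<open>B\<close> for the Iwahori subgroup, \<open>j\<close> for the embedding of \<open>\<sigma>\<close> and \<open>W\<close> for its space. As every
  \<open>f\<close> in the compact induction is a finite sum of translates of functions \<open>[1, x]\<close>, the images of
  \<open>I\<^sup>+\<close> and \<open>I\<^sup>-\<close> are spanned by the vectors \<open>\<pi> (b a\<^sup>m) (j x)\<close> with \<open>b \<in> B\<close> and \<open>m \<le> 0\<close>,
  respectively \<open>m > 0\<close>. The Iwahori factorization \<open>B = P Q = Q P\<close> shows that \<open>a\<^sup>-\<^sup>1\<close> preserves the
  first span, that \<open>a\<close> preserves the second one, and that \<open>s\<close> and \<open>a s\<close> carry the second into the
  first and the first into the second, where \<open>s \<in> K\<close> is the nontrivial Weyl element.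

  As the coefficients have characteristic \<open>p\<close> and the pro-\<open>p\<close> Iwahori subgroup acts on finite sets
  through \<open>p\<close>-groups, \<open>j W\<close> contains a nonzero vector \<open>v\<close> fixed by it. By hypothesis \<open>v\<close> lies in both spans attached to \<open>\<sigma>'\<close>, so by the Bruhat
  decomposition \<open>K = B \<union> U s B\<close> its \<open>K\<close>-orbit lies in the first one. Irreducibility of \<open>\<sigma>\<close> puts all of
  \<open>j W\<close> there, and the stability properties above then give the inclusion of the spans attached to
  \<open>\<sigma>\<close> in those attached to \<open>\<sigma>'\<close>. Exchange \<open>\<sigma>\<close> and \<open>\<sigma>'\<close>.
\<close>

section \<open>Groups acting through elements of \<open>p\<close>-power order\<close>

text \<open>All of \<open>B\<close> is explicit: it is cut out by bounds on the absolute values of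
  entries, and the lower left entry alone separates it from the rest of \<open>K\<close>. In
  contrast, \<open>Kp\<close> is known only as a maximal normal pro-p subgroup, and the Iwahori
  subgroups are defined through its cosets. The bridge is the inclusion of \<open>Kp\<close> in
  \<open>B\<close>, obtained without computing \<open>Kp\<close>, by counting fixed points on the
  finite set \<open>K/B\<close>. It identifies the Iwahori subgroup with \<open>B\<close>. Each
  element of the pro-p Iwahori subgroup is a product of an element of \<open>Kp\<close> and one of
  an explicit group \<open>U\<close>; hence the fixed vector is found in two stages, for
  \<open>Kp\<close> and then for \<open>U\<close>. For both groups the counting rests on a property
  of single elements: each has a p-power in any given open normal subgroup. Counting also requires a
  finite set while the coefficient field is infinite, so it takes place in the additive span of one
  \<open>K\<close>-orbit.\<close>

lemma (in group) prime_dvd_order_imp_ex: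
  assumes fin: "finite (carrier G)" and q: "Factorial_Ring.prime q" "q dvd order G"
  obtains x i where "x \<in> carrier G" "x \<noteq> \<one>" "x [^] (q ^ i :: nat) = \<one>"
proof -
  \<comment> \<open>Exponent one suffices, and \<open>m\<close> may still be divisible by
    \<open>q\<close>. The outcome is Cauchy's theorem, which serves to show that a finite group of
    elements of p-power order is a p-group.\<close>
  obtain m where m: "order G = q ^ 1 * m" using q by auto
  obtain H where H: "subgroup H G" "card H = q ^ 1"
    using sylow_thm[OF q(1) is_group m fin] by blast
  have "card H > 1" using H(2) q(1) prime_gt_1_nat by auto
  then have "H \<noteq> {\<one>}" by auto
  moreover have "\<one> \<in> H" using H(1) subgroup.one_closed by blast
  ultimately obtain x where x: "x \<in> H" "x \<noteq> \<one>" by blast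
  interpret S: group "G\<lparr>carrier := H\<rparr>" using H(1) by (simp add: subgroup.subgroup_is_group)
  have "x [^]\<^bsub>G\<lparr>carrier := H\<rparr>\<^esub> order (G\<lparr>carrier := H\<rparr>) = \<one>\<^bsub>G\<lparr>carrier := H\<rparr>\<^esub>"
    using S.pow_order_eq_1 x by simp
  then have "x [^] (q ^ 1) = \<one>"
    using H(2) by (simp add: order_def nat_pow_consistent[symmetric])
  then show thesis using that[of x 1] x subgroup.mem_carrier[OF H(1)] by simp
qed

text \<open>The congruence between a finite set and its fixed points, for a group \<open>H\<close>
  that may be infinite: what counts is the finite permutation group it induces on \<open>A\<close>.
  By \<open>ppow\<close> the elements of that group have p-power order, so p is the only prime that
  can divide its order, and every orbit with more than one point has size divisible by p.\<close>

lemma fixed_points_cong: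
  fixes H :: "'g monoid" and act :: "'g \<Rightarrow> 'x \<Rightarrow> 'x"
  assumes "group H" "finite A" "Factorial_Ring.prime p"
    and maps: "\<And>h x. h \<in> carrier H \<Longrightarrow> x \<in> A \<Longrightarrow> act h x \<in> A"
    and one: "\<And>x. x \<in> A \<Longrightarrow> act \<one>\<^bsub>H\<^esub> x = x"
    and mult: "\<And>g h x. g \<in> carrier H \<Longrightarrow> h \<in> carrier H \<Longrightarrow> x \<in> A \<Longrightarrow>
                 act (g \<otimes>\<^bsub>H\<^esub> h) x = act g (act h x)"
    and ppow: "\<And>h. h \<in> carrier H \<Longrightarrow> \<exists>i::nat. \<forall>x\<in>A. act (h [^]\<^bsub>H\<^esub> (p ^ i)) x = x"
  shows "p dvd card (A - {x\<in>A. \<forall>h\<in>carrier H. act h x = x})"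
proof -
  interpret H: group H by fact
  \<comment> \<open>Restriction to \<open>A\<close> makes elements with the same action equal as
    functions, so that the image \<open>P\<close> is finite.\<close>
  define T where "T h = restrict (act h) A" for h
  define P where "P = \<lparr>carrier = T ` carrier H, monoid.mult = (\<lambda>f g. compose A f g), one = T \<one>\<^bsub>H\<^esub>\<rparr>"
  have Tm: "compose A (T g) (T h) = T (g \<otimes>\<^bsub>H\<^esub> h)" if "g \<in> carrier H" "h \<in> carrier H" for g h
    using that maps mult by (auto simp: T_def compose_def fun_eq_iff)
  have gP: "group P"
  proof (rule groupI)
    fix x assume "x \<in> carrier P"
    then obtain h where h: "h \<in> carrier H" "x = T h" by (auto simp: P_def)
    then show "\<exists>y\<in>carrier P. y \<otimes>\<^bsub>P\<^esub> x = \<one>\<^bsub>P\<^esub>"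
      by (auto simp: P_def Tm intro!: bexI[of _ "inv\<^bsub>H\<^esub> h"])
  qed (auto simp: P_def Tm H.m_assoc)
  interpret P: group P by fact
  have "carrier P \<subseteq> (A \<rightarrow>\<^sub>E A)" using maps by (auto simp: P_def T_def)
  then have finP: "finite (carrier P)" using \<open>finite A\<close> finite_PiE finite_subset by metis
  have Tpow: "T h [^]\<^bsub>P\<^esub> n = T (h [^]\<^bsub>H\<^esub> n)" if "h \<in> carrier H" for h and n :: nat
    using that by (induction n) (auto simp: P_def Tm)
  have qp: "q = p" if q: "Factorial_Ring.prime q" "q dvd order P" for q
  proof -
    obtain x i where x: "x \<in> carrier P" "x \<noteq> \<one>\<^bsub>P\<^esub>" "x [^]\<^bsub>P\<^esub> (q ^ i :: nat) = \<one>\<^bsub>P\<^esub>"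
      using P.prime_dvd_order_imp_ex[OF finP q] by blast
    obtain h where h: "h \<in> carrier H" "x = T h" using x by (auto simp: P_def)
    obtain j :: nat where j: "\<forall>y\<in>A. act (h [^]\<^bsub>H\<^esub> (p ^ j)) y = y" using ppow h by blast
    have "x [^]\<^bsub>P\<^esub> (p ^ j) = \<one>\<^bsub>P\<^esub>"
      using j h one by (auto simp: Tpow) (auto simp: P_def T_def)
    then have "P.ord x dvd p ^ j" "P.ord x dvd q ^ i"
      using x P.pow_eq_id by auto
    moreover have "P.ord x \<noteq> 1" using x P.ord_eq_1 by auto
    ultimately have "\<not> coprime (p ^ j) (q ^ i)"
      by (metis coprime_common_divisor nat_dvd_1_iff_1)
    then have "\<not> coprime p q" by auto
    then show ?thesis using \<open>Factorial_Ring.prime p\<close> q(1) primes_coprime by blast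
  qed
  define Fx where "Fx = {x\<in>A. \<forall>h\<in>carrier H. act h x = x}"
  define orb where "orb x = (\<lambda>h. act h x) ` carrier H" for x
  have orbA: "orb x \<subseteq> A" if "x \<in> A" for x using that maps by (auto simp: orb_def)
  have orb_self: "x \<in> orb x" if "x \<in> A" for x
    using one[OF that] H.one_closed unfolding orb_def by (metis image_eqI)
  have actinv: "act (inv\<^bsub>H\<^esub> h) (act h x) = x" if "h \<in> carrier H" "x \<in> A" for h x
    using that by (simp add: mult[symmetric] one)
  have orb_eq: "orb y = orb x" if xy: "x \<in> A" "y \<in> orb x" for x y
  proof -
    obtain h where h: "h \<in> carrier H" "y = act h x" using xy by (auto simp: orb_def)
    have "orb (act h x) \<subseteq> orb x" if "h \<in> carrier H" "x \<in> A" for h x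
      using that by (auto simp: orb_def mult[symmetric])
    from this[OF h(1) xy(1)] this[of "inv\<^bsub>H\<^esub> h" "act h x"] show ?thesis
      using h xy(1) maps[OF h(1) xy(1)] actinv[OF h(1) xy(1)] by auto
  qed
  have dvd: "p dvd card (orb x)" if x: "x \<in> A" "x \<notin> Fx" for x
  proof -
    define ev where "ev f = f x" for f :: "'x \<Rightarrow> 'x"
    have img: "orb x = ev ` carrier P"
      using x by (auto simp: orb_def ev_def P_def T_def image_image)
    \<comment> \<open>Orbit-stabilizer in the form of equal fibres of the evaluation at
      \<open>x\<close>: left multiplication by \<open>T h\<close> moves the fibre over
      \<open>x\<close> to the fibre over \<open>act h x\<close>.\<close>
    have fib: "card {f\<in>carrier P. ev f = y} = card {f\<in>carrier P. ev f = x}" if y: "y \<in> orb x" for y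
    proof -
      obtain h where h: "h \<in> carrier H" "y = act h x" using y by (auto simp: orb_def)
      have *: "ev (T h \<otimes>\<^bsub>P\<^esub> f) = act h (ev f)" if "h \<in> carrier H" "f \<in> carrier P" for h f
        using that x maps by (auto simp: P_def ev_def T_def compose_def)
      have evA: "ev f \<in> A" if "f \<in> carrier P" for f
        using that x maps by (auto simp: P_def ev_def T_def)
      have "bij_betw (\<lambda>f. T h \<otimes>\<^bsub>P\<^esub> f) {f\<in>carrier P. ev f = x} {f\<in>carrier P. ev f = y}"
      proof (rule bij_betw_byWitness[where f' = "\<lambda>f. T (inv\<^bsub>H\<^esub> h) \<otimes>\<^bsub>P\<^esub> f"])
        have T1: "T (inv\<^bsub>H\<^esub> h) \<otimes>\<^bsub>P\<^esub> T h = \<one>\<^bsub>P\<^esub>" "T h \<otimes>\<^bsub>P\<^esub> T (inv\<^bsub>H\<^esub> h) = \<one>\<^bsub>P\<^esub>"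
          using h Tm by (auto simp: P_def)
        have TP: "T h \<in> carrier P" "T (inv\<^bsub>H\<^esub> h) \<in> carrier P" using h by (auto simp: P_def)
        show "\<forall>f\<in>{f \<in> carrier P. ev f = x}. T (inv\<^bsub>H\<^esub> h) \<otimes>\<^bsub>P\<^esub> (T h \<otimes>\<^bsub>P\<^esub> f) = f"
          "\<forall>f\<in>{f \<in> carrier P. ev f = y}. T h \<otimes>\<^bsub>P\<^esub> (T (inv\<^bsub>H\<^esub> h) \<otimes>\<^bsub>P\<^esub> f) = f"
          using TP T1 by (auto simp: P.m_assoc[symmetric])
        show "(\<otimes>\<^bsub>P\<^esub>) (T h) ` {f \<in> carrier P. ev f = x} \<subseteq> {f \<in> carrier P. ev f = y}"
          using TP h * by auto
        show "(\<otimes>\<^bsub>P\<^esub>) (T (inv\<^bsub>H\<^esub> h)) ` {f \<in> carrier P. ev f = y} \<subseteq> {f \<in> carrier P. ev f = x}"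
          using TP h *[of "inv\<^bsub>H\<^esub> h"] actinv x by auto
      qed
      then show ?thesis by (simp add: bij_betw_same_card)
    qed
    have "card (carrier P) = (\<Sum>y\<in>orb x. card {f\<in>carrier P. ev f = y})"
      unfolding img card_eq_sum using finP by (subst sum.image_gen[where g = ev]) auto
    also have "\<dots> = card (orb x) * card {f\<in>carrier P. ev f = x}"
      by (simp add: fib)
    finally have d: "card (orb x) dvd order P" by (simp add: order_def)
    have "card (orb x) \<noteq> 1"
    proof
      assume "card (orb x) = 1"
      then have "orb x = {x}" using orb_self[OF x(1)] by (metis card_1_singletonE singletonD)
      then have "act h x = x" if "h \<in> carrier H" for h using that by (auto simp: orb_def)
      then show False using x by (auto simp: Fx_def)
    qed
    then obtain q where "Factorial_Ring.prime q" "q dvd card (orb x)" using prime_factor_nat by blast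
    then show ?thesis using qp d dvd_trans by blast
  qed
  have un: "A - Fx = \<Union> (orb ` (A - Fx))"
  proof
    show "A - Fx \<subseteq> \<Union> (orb ` (A - Fx))" using orb_self by auto
    show "\<Union> (orb ` (A - Fx)) \<subseteq> A - Fx"
    proof clarsimp
      fix x y assume x: "x \<in> A" "x \<notin> Fx" "y \<in> orb x"
      have "y \<notin> Fx"
      proof
        assume "y \<in> Fx"
        then have "orb y = {y}" using orb_self by (auto simp: Fx_def orb_def)
        then have "orb x = {y}" using orb_eq x by simp
        then have "card (orb x) = 1" by simp
        with dvd[OF x(1,2)] \<open>Factorial_Ring.prime p\<close> show False by simp
      qed
      then show "y \<in> A \<and> y \<notin> Fx" using x orbA by auto
    qed
  qed
  have "p dvd card (\<Union> (orb ` (A - Fx)))"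
  proof (rule dvd_partition)
    show "finite (\<Union> (orb ` (A - Fx)))" unfolding un[symmetric] using \<open>finite A\<close> by (rule finite_Diff)
    show "\<forall>c\<in>orb ` (A - Fx). p dvd card c" using dvd by auto
    show "\<forall>c1\<in>orb ` (A - Fx). \<forall>c2\<in>orb ` (A - Fx). c1 \<noteq> c2 \<longrightarrow> c1 \<inter> c2 = {}"
      using orb_eq by blast
  qed
  then have "p dvd card (A - Fx)" unfolding un[symmetric] .
  then show ?thesis unfolding Fx_def .
qed

section \<open>Compactness, and pro-p groups of matrices acting on finite sets\<close>

lemma finite_image_locally_constant:
  assumes "compact S" and lc: "\<And>x. x \<in> S \<Longrightarrow> openin (top_of_set S) {y\<in>S. f y = f x}"
  shows "finite (f ` S)"
proof -
  let ?c = "\<lambda>x. {y\<in>S. f y = f x}"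
  have "\<exists>D\<subseteq>?c ` S. finite D \<and> S \<subseteq> \<Union>D"
    using assms(1)[unfolded compact_eq_openin_cover, rule_format, of "?c ` S"] lc by blast
  then obtain D where D: "D \<subseteq> ?c ` S" "finite D" "S \<subseteq> \<Union>D" by blast
  then obtain T where T: "T \<subseteq> S" "finite T" "D = ?c ` T" by (meson finite_subset_image)
  have "f ` S \<subseteq> f ` T"
  proof
    fix z assume "z \<in> f ` S"
    then obtain y where "y \<in> S" "z = f y" by blast
    moreover then obtain x where "x \<in> T" "y \<in> ?c x" using D(3) T(3) by blast
    ultimately show "z \<in> f ` T" by auto
  qed
  then show ?thesis using T(2) finite_subset by blast
qed

text \<open>Translations carry the topological input: the open sets below are preimages of open
  subgroups and of stabilizers under left and right multiplication.\<close>

locale topological_matrix_group = group G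
  for G :: "'e::{field,metric_space} mat3 monoid" (structure) +
  assumes continuous_right: "h \<in> carrier G \<Longrightarrow> continuous_on (carrier G) (\<lambda>g. g \<otimes> h)"
    and continuous_left: "h \<in> carrier G \<Longrightarrow> continuous_on (carrier G) (\<lambda>g. h \<otimes> g)"
begin

abbreviation op :: "'e mat3 set \<Rightarrow> bool" where
  "op V \<equiv> openin (top_of_set (carrier G)) V"

lemma op_right: "op V \<Longrightarrow> h \<in> carrier G \<Longrightarrow> op {g \<in> carrier G. g \<otimes> h \<in> V}"
  using continuous_openin_preimage[OF continuous_right, of h "carrier G" V] by (auto simp: vimage_def Int_def)

lemma op_left: "op V \<Longrightarrow> h \<in> carrier G \<Longrightarrow> op {g \<in> carrier G. h \<otimes> g \<in> V}"
  using continuous_openin_preimage[OF continuous_left, of h "carrier G" V] by (auto simp: vimage_def Int_def)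

lemma op_restrict: "op V \<Longrightarrow> H \<subseteq> carrier G \<Longrightarrow> openin (top_of_set H) (H \<inter> V)"
  by (auto simp: openin_open)

lemma restrict_simps [simp]:
  "carrier (G\<lparr>carrier := H\<rparr>) = H" "\<one>\<^bsub>G\<lparr>carrier := H\<rparr>\<^esub> = \<one>" "x \<otimes>\<^bsub>G\<lparr>carrier := H\<rparr>\<^esub> y = x \<otimes> y"
  by auto

text \<open>The common form in which the pro-p property enters for \<open>Kp\<close> and for
  \<open>U\<close>. For \<open>Kp\<close> it follows from the indices of open normal subgroups, for
  \<open>U\<close> from an explicit estimate of p-th powers of matrices.\<close>

definition pow_small :: "nat \<Rightarrow> 'e mat3 set \<Rightarrow> bool" where
  "pow_small p H \<longleftrightarrow> subgroup H G \<and>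
     (\<forall>N. N \<lhd> G\<lparr>carrier := H\<rparr> \<and> openin (top_of_set H) N \<longrightarrow> (\<forall>h\<in>H. \<exists>i::nat. h [^] (p ^ i) \<in> N))"

text \<open>The kernel \<open>N\<close> of the action on \<open>A\<close> is normal, and it is open
  as a finite intersection of open stabilizers. So every element of \<open>H\<close> has a p-power
  acting trivially, which is the hypothesis of \<open>fixed_points_cong\<close>.\<close>

lemma pow_small_fixed_points:
  fixes act :: "'e mat3 \<Rightarrow> 'x \<Rightarrow> 'x"
  assumes "pow_small p H" "finite A" "Factorial_Ring.prime p"
    and maps: "\<And>h x. h \<in> H \<Longrightarrow> x \<in> A \<Longrightarrow> act h x \<in> A"
    and one: "\<And>x. x \<in> A \<Longrightarrow> act \<one> x = x"
    and mult: "\<And>g h x. g \<in> H \<Longrightarrow> h \<in> H \<Longrightarrow> x \<in> A \<Longrightarrow> act (g \<otimes> h) x = act g (act h x)"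
    and stab: "\<And>x. x \<in> A \<Longrightarrow> openin (top_of_set H) {h \<in> H. act h x = x}"
  shows "p dvd card (A - {x\<in>A. \<forall>h\<in>H. act h x = x})"
proof -
  have sub: "subgroup H G" using assms(1) by (simp add: pow_small_def)
  let ?H = "G\<lparr>carrier := H\<rparr>"
  interpret H: group ?H by (rule subgroup_imp_group[OF sub])
  define N where "N = {h \<in> H. \<forall>x\<in>A. act h x = x}"
  have op: "openin (top_of_set H) N"
  proof -
    have *: "N = (\<Inter>x\<in>A. {h \<in> H. act h x = x}) \<inter> topspace (top_of_set H)" by (auto simp: N_def)
    show ?thesis unfolding * by (rule openin_INT[OF \<open>finite A\<close> stab])
  qed
  have HG: "H \<subseteq> carrier G" using sub subgroup.subset by blast
  have iH: "inv\<^bsub>?H\<^esub> h = inv h" "inv h \<in> H" if "h \<in> H" for h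
    using that sub by (auto simp: m_inv_consistent subgroup.m_inv_closed)
  have actinv: "act (inv h) (act h x) = x" "act h (act (inv h) x) = x" if "h \<in> H" "x \<in> A" for h x
    using that iH[of h] mult[of "inv h" h x] mult[of h "inv h" x] one HG by (auto simp: subsetD)
  have "subgroup N ?H"
  proof (rule H.subgroupI)
    show "N \<subseteq> carrier ?H" by (auto simp: N_def)
    show "N \<noteq> {}" using one sub subgroup.one_closed by (auto simp: N_def)
    show "inv\<^bsub>?H\<^esub> h \<in> N" if "h \<in> N" for h
    proof -
      have h: "h \<in> H" "\<And>x. x \<in> A \<Longrightarrow> act h x = x" using that by (auto simp: N_def)
      then have "act (inv h) x = x" if "x \<in> A" for x using actinv(1)[OF h(1) that] that by simp
      then show ?thesis using h iH by (auto simp: N_def)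
    qed
    show "g \<otimes>\<^bsub>?H\<^esub> h \<in> N" if "g \<in> N" "h \<in> N" for g h
      using that subgroup.m_closed[OF sub] mult by (auto simp: N_def)
  qed
  moreover have "x \<otimes>\<^bsub>?H\<^esub> h \<otimes>\<^bsub>?H\<^esub> inv\<^bsub>?H\<^esub> x \<in> N" if x: "x \<in> carrier ?H" and h: "h \<in> N" for x h
  proof -
    have hH: "h \<in> H" "x \<in> H" using x h by (auto simp: N_def)
    have "act (x \<otimes> h \<otimes> inv x) y = y" if "y \<in> A" for y
    proof -
      have "act (x \<otimes> h \<otimes> inv x) y = act x (act h (act (inv x) y))"
        using hH iH that maps subgroup.m_closed[OF sub] by (simp add: mult)
      also have "\<dots> = act x (act (inv x) y)" using h maps iH(2)[OF hH(2)] that by (simp add: N_def)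
      also have "\<dots> = y" using actinv hH that by simp
      finally show ?thesis .
    qed
    then show ?thesis using hH iH subgroup.m_closed[OF sub] by (simp add: N_def)
  qed
  ultimately have "N \<lhd> ?H" by (simp add: H.normal_inv_iff)
  then have pw: "\<exists>i::nat. h [^] (p ^ i) \<in> N" if "h \<in> H" for h
    using assms(1) op that by (simp add: pow_small_def)
  have "p dvd card (A - {x\<in>A. \<forall>h\<in>carrier ?H. act h x = x})"
  proof (rule fixed_points_cong[OF H.is_group \<open>finite A\<close> \<open>Factorial_Ring.prime p\<close>])
    show "\<exists>i::nat. \<forall>x\<in>A. act (h [^]\<^bsub>?H\<^esub> (p ^ i)) x = x" if "h \<in> carrier ?H" for h
      using pw[of h] that by (auto simp: N_def nat_pow_consistent[symmetric])
  qed (use maps one mult in auto)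
  then show ?thesis by simp
qed

text \<open>In the quotient by \<open>N\<close>, a group of order p^n, the p^n-th power of every
  element is trivial.\<close>

lemma pro_p_pow_small:
  assumes "subgroup H G" 
    and idx: "\<And>N. N \<lhd> G\<lparr>carrier := H\<rparr> \<Longrightarrow> openin (top_of_set H) N \<Longrightarrow>
                \<exists>n. card (rcosets\<^bsub>G\<lparr>carrier := H\<rparr>\<^esub> N) = p ^ n"
    and "Factorial_Ring.prime p"
  shows "pow_small p H"
  unfolding pow_small_def
proof (intro conjI allI impI ballI)
  fix N h assume N: "N \<lhd> G\<lparr>carrier := H\<rparr> \<and> openin (top_of_set H) N" and h: "h \<in> H"
  let ?H = "G\<lparr>carrier := H\<rparr>"
  obtain n where n: "card (rcosets\<^bsub>?H\<^esub> N) = p ^ n" using idx N by blast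
  interpret N: normal N ?H using N by blast
  interpret Q: group "?H Mod N" by (rule N.factorgroup_is_group)
  have c: "carrier (?H Mod N) = rcosets\<^bsub>?H\<^esub> N" by (simp add: FactGroup_def)
  have hc: "N #>\<^bsub>?H\<^esub> h \<in> carrier (?H Mod N)" using h by (auto simp: carrier_FactGroup)
  have "(N #>\<^bsub>?H\<^esub> h) [^]\<^bsub>?H Mod N\<^esub> order (?H Mod N) = N"
    using Q.pow_order_eq_1[OF hc] by simp
  moreover have "order (?H Mod N) = p ^ n" using c n by (simp add: order_def)
  ultimately have "N #>\<^bsub>?H\<^esub> (h [^]\<^bsub>?H\<^esub> (p ^ n)) = N"
    using N.FactGroup_pow[of h "p ^ n"] h by simp
  then have "h [^]\<^bsub>?H\<^esub> (p ^ n) \<in> N"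
    using h N.rcos_self[of "h [^]\<^bsub>?H\<^esub> (p ^ n)"] N.subgroup_axioms by (metis N.nat_pow_closed N.rcos_self restrict_simps(1))
  then show "\<exists>i::nat. h [^] (p ^ i) \<in> N" by (auto simp: nat_pow_consistent[symmetric])
qed (rule assms(1))

end

section \<open>The Iwahori subgroup contains \<open>K\<^sup>1\<close>\<close>

lemma (in group) inv_cancel_assoc:
  assumes "x \<in> carrier G" "y \<in> carrier G"
  shows "inv x \<otimes> (x \<otimes> y) = y" "x \<otimes> (inv x \<otimes> y) = y"
  using assms by (simp_all add: m_assoc[symmetric])

text \<open>A rank one Bruhat decomposition of \<open>K\<close> with Weyl element \<open>s\<close>.
  Here \<open>B\<close> and \<open>U\<close> stand for the Iwahori subgroup and its pro-p part in
  explicit form; their relation to the cosets of \<open>Kp\<close> is established afterwards, once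
  \<open>Kp\<close> is known to lie in \<open>B\<close>.\<close>

locale maximal_compact = topological_matrix_group G
  for G :: "'e::{field,metric_space} mat3 monoid" (structure) +
  fixes p :: nat and K B U Kp :: "'e mat3 set" and s :: "'e mat3"
  assumes prime_p: "Factorial_Ring.prime p"
    and K_subgroup: "subgroup K G" and compact_K: "compact K" and op_K: "op K"
    and B_subgroup: "subgroup B G" and B_subset: "B \<subseteq> K" and op_B: "op B"
    and U_subgroup: "subgroup U G" and U_subset: "U \<subseteq> B"
    and U_powers: "\<And>V u. open V \<Longrightarrow> \<one> \<in> V \<Longrightarrow> u \<in> U \<Longrightarrow> \<exists>i::nat. u [^] (p ^ i) \<in> V"
    and s_in_K: "s \<in> K"
    and s_square: "s \<otimes> s = \<one>"
    and bruhat: "\<And>g. g \<in> K \<Longrightarrow> g \<in> B \<or> (\<exists>u\<in>U. \<exists>b\<in>B. g = u \<otimes> s \<otimes> b)"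
    and s_not_normalizes: "\<exists>u\<in>U. s \<otimes> u \<otimes> s \<notin> B"
    and Kp: "maximal_normal_pro_p p (G\<lparr>carrier := K\<rparr>) Kp"
begin

lemma K_carrier: "g \<in> K \<Longrightarrow> g \<in> carrier G"
  using K_subgroup subgroup.subset by blast

lemma B_K: "g \<in> B \<Longrightarrow> g \<in> K" and U_B: "g \<in> U \<Longrightarrow> g \<in> B"
  using B_subset U_subset by auto

lemma B_carrier: "g \<in> B \<Longrightarrow> g \<in> carrier G" 
  using B_K K_carrier by blast

lemma U_carrier: "g \<in> U \<Longrightarrow> g \<in> carrier G"
  using U_B B_carrier by blast

lemmas K_closed [simp, intro] = subgroup.one_closed[OF K_subgroup] subgroup.m_closed[OF K_subgroup]
  subgroup.m_inv_closed[OF K_subgroup]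

lemmas B_closed [simp, intro] = subgroup.one_closed[OF B_subgroup] subgroup.m_closed[OF B_subgroup]
  subgroup.m_inv_closed[OF B_subgroup]

lemmas U_closed [simp, intro] = subgroup.one_closed[OF U_subgroup] subgroup.m_closed[OF U_subgroup]
  subgroup.m_inv_closed[OF U_subgroup]

lemma s_carrier: "s \<in> carrier G"
  using s_in_K K_carrier by blast

lemma s_inv: "inv s = s"
  using s_square s_carrier inv_equality by blast

lemma s_cancel: "g \<in> carrier G \<Longrightarrow> s \<otimes> (s \<otimes> g) = g"
  using s_square s_carrier by (simp add: m_assoc[symmetric])

lemma Kp_normal: "Kp \<lhd> G\<lparr>carrier := K\<rparr>"
  using Kp by (simp add: maximal_normal_pro_p_def)

lemma Kp_subgroup: "subgroup Kp G"
  using Kp_normal incl_subgroup[OF K_subgroup] normal_imp_subgroup by blast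

lemma Kp_K: "g \<in> Kp \<Longrightarrow> g \<in> K"
  using Kp_normal normal_imp_subgroup subgroup.subset by fastforce

lemma Kp_conj: "g \<in> K \<Longrightarrow> h \<in> Kp \<Longrightarrow> g \<otimes> h \<otimes> inv g \<in> Kp"
  using normal.inv_op_closed2[OF Kp_normal, of g h] by (simp add: m_inv_consistent[OF K_subgroup])

lemma pow_small_Kp: "pow_small p Kp"
proof (rule pro_p_pow_small[OF Kp_subgroup _ prime_p])
  have "pro_p p ((G\<lparr>carrier := K\<rparr>)\<lparr>carrier := Kp\<rparr>)"
    using Kp by (simp only: maximal_normal_pro_p_def)
  then have "pro_p p (G\<lparr>carrier := Kp\<rparr>)" by simp
  then show "\<exists>n. card (rcosets\<^bsub>G\<lparr>carrier := Kp\<rparr>\<^esub> N) = p ^ n"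
    if "N \<lhd> G\<lparr>carrier := Kp\<rparr>" "openin (top_of_set Kp) N" for N
    using that by (simp add: pro_p_def)
qed

lemma pow_small_U: "pow_small p U"
  unfolding pow_small_def
proof (intro conjI allI impI ballI)
  fix N h assume N: "N \<lhd> G\<lparr>carrier := U\<rparr> \<and> openin (top_of_set U) N" and h: "h \<in> U"
  then obtain V where V: "open V" "N = U \<inter> V" by (auto simp: openin_open)
  have "\<one> \<in> N" using N normal_imp_subgroup subgroup.one_closed by fastforce
  then obtain i :: nat where "h [^] (p ^ i) \<in> V" using V h U_powers by blast
  moreover have "h [^] n \<in> U" for n :: nat by (induction n) (use h in auto)
  ultimately show "\<exists>i::nat. h [^] (p ^ i) \<in> N" using V by blast
qed (rule U_subgroup)

definition lcos :: "'e mat3 \<Rightarrow> 'e mat3 set" where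
  "lcos g = (\<lambda>b. g \<otimes> b) ` B"

lemma lcos_eq_iff:
  assumes "g \<in> K" "h \<in> K"
  shows "lcos h = lcos g \<longleftrightarrow> inv g \<otimes> h \<in> B"
proof
  assume "lcos h = lcos g"
  moreover have "h \<in> lcos h"
    unfolding lcos_def using r_one[OF K_carrier[OF assms(2)]] B_closed(1) by (metis image_eqI)
  ultimately obtain b where "b \<in> B" "h = g \<otimes> b" by (auto simp: lcos_def)
  then show "inv g \<otimes> h \<in> B"
    using assms K_carrier B_carrier by (simp add: m_assoc[symmetric])
next
  assume b: "inv g \<otimes> h \<in> B"
  have *: "lcos h \<subseteq> lcos g" if "g \<in> K" "h \<in> K" "inv g \<otimes> h \<in> B" for g h
  proof
    fix x assume "x \<in> lcos h"
    then obtain b where "b \<in> B" "x = h \<otimes> b" by (auto simp: lcos_def)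
    then have "x = g \<otimes> (inv g \<otimes> h \<otimes> b)"
      using that K_carrier B_carrier by (simp add: m_assoc[symmetric])
    then show "x \<in> lcos g" using \<open>b \<in> B\<close> that by (auto simp: lcos_def)
  qed
  have "inv h \<otimes> g = inv (inv g \<otimes> h)"
    using assms K_carrier by (simp add: inv_mult_group)
  then have "inv h \<otimes> g \<in> B" using b by simp
  then show "lcos h = lcos g" using * assms b by blast
qed

lemma lcos_act: "h \<in> K \<Longrightarrow> g \<in> K \<Longrightarrow> (\<lambda>x. h \<otimes> x) ` lcos g = lcos (h \<otimes> g)"
  using K_carrier B_carrier by (auto simp: lcos_def image_image m_assoc)

lemma lcos_fixed_iff: "h \<in> K \<Longrightarrow> g \<in> K \<Longrightarrow> (\<lambda>x. h \<otimes> x) ` lcos g = lcos g \<longleftrightarrow> inv g \<otimes> h \<otimes> g \<in> B"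
  using lcos_act lcos_eq_iff[of g "h \<otimes> g"] K_carrier by (simp add: m_assoc)

lemma finite_lcos: "finite (lcos ` K)"
proof (rule finite_image_locally_constant[OF compact_K])
  fix g assume g: "g \<in> K"
  have "{h \<in> K. lcos h = lcos g} = K \<inter> {h \<in> carrier G. inv g \<otimes> h \<in> B}"
    using lcos_eq_iff[OF g] K_carrier by auto
  then show "openin (top_of_set K) {h \<in> K. lcos h = lcos g}"
    using op_restrict[OF op_left[OF op_B]] g K_carrier subgroup.subset[OF K_subgroup] by simp
qed

text \<open>The stabilizer in \<open>H\<close> of the coset \<open>gB\<close> is the trace on
  \<open>H\<close> of the conjugate of \<open>B\<close> by \<open>g\<close>, which is open.\<close>

lemma lcos_fixed_points:
  assumes H: "pow_small p H" "H \<subseteq> K"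
  shows "p dvd card (lcos ` K - {C \<in> lcos ` K. \<forall>h\<in>H. (\<lambda>x. h \<otimes> x) ` C = C})"
proof (rule pow_small_fixed_points[OF H(1) finite_lcos prime_p])
  show "(\<lambda>x. h \<otimes> x) ` C \<in> lcos ` K" if "h \<in> H" "C \<in> lcos ` K" for h C
    using that H by (auto simp: lcos_act)
  show "(\<lambda>x. \<one> \<otimes> x) ` C = C" if C: "C \<in> lcos ` K" for C
  proof -
    obtain g where "g \<in> K" "C = lcos g" using C by blast
    then show ?thesis using lcos_act[OF K_closed(1), of g] K_carrier[of g] by simp
  qed
  show "(\<lambda>x. g \<otimes> h \<otimes> x) ` C = (\<lambda>x. g \<otimes> x) ` (\<lambda>x. h \<otimes> x) ` C"
    if gh: "g \<in> H" "h \<in> H" and C: "C \<in> lcos ` K" for g h C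
  proof -
    obtain k where k: "k \<in> K" "C = lcos k" using C by blast
    have "g \<in> K" "h \<in> K" using gh H(2) by auto
    then show ?thesis using k by (simp add: lcos_act m_assoc K_carrier)
  qed
  show "openin (top_of_set H) {h \<in> H. (\<lambda>x. h \<otimes> x) ` C = C}" if C: "C \<in> lcos ` K" for C
  proof -
    obtain g where g: "g \<in> K" "C = lcos g" using C by blast
    have HG: "H \<subseteq> carrier G" using H(2) subgroup.subset[OF K_subgroup] by blast
    have "h \<in> H \<Longrightarrow> (\<lambda>x. h \<otimes> x) ` C = C \<longleftrightarrow> inv g \<otimes> (h \<otimes> g) \<in> B" for h
      using lcos_fixed_iff[of h g] g H(2) K_carrier[OF g(1)] HG by (simp add: m_assoc subset_iff)
    then have *: "{h \<in> H. (\<lambda>x. h \<otimes> x) ` C = C} =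
        H \<inter> {h \<in> carrier G. h \<otimes> g \<in> {h \<in> carrier G. inv g \<otimes> h \<in> B}}"
      unfolding set_eq_iff Int_iff mem_Collect_eq using K_carrier[OF g(1)] HG m_closed by blast
    show ?thesis unfolding *
      by (rule op_restrict[OF op_right[OF op_left[OF op_B]] HG]) (use K_carrier[OF g(1)] in auto)
  qed
qed

text \<open>Counting fixed points on \<open>K/B\<close>, once for \<open>U\<close> and once for \<open>Kp\<close>: the group \<open>U\<close> fixes
  only the trivial coset, so the number of cosets is prime to \<open>p\<close> and \<open>Kp\<close> fixes some coset.\<close>

lemma Kp_subset_B: "Kp \<subseteq> B"
proof -
  have U1: "{C \<in> lcos ` K. \<forall>h\<in>U. (\<lambda>x. h \<otimes> x) ` C = C} = {lcos \<one>}"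
  proof (intro equalityI subsetI)
    fix C assume "C \<in> {C \<in> lcos ` K. \<forall>h\<in>U. (\<lambda>x. h \<otimes> x) ` C = C}"
    then obtain g where g: "g \<in> K" "C = lcos g" "\<And>h. h \<in> U \<Longrightarrow> (\<lambda>x. h \<otimes> x) ` lcos g = lcos g"
      by blast
    then have fx: "inv g \<otimes> h \<otimes> g \<in> B" if "h \<in> U" for h
      using lcos_fixed_iff[OF B_K[OF U_B[OF that]] g(1)] g(3)[OF that] by simp
    have "g \<in> B"
    proof (rule ccontr)
      assume "g \<notin> B"
      then obtain u b where ub: "u \<in> U" "b \<in> B" "g = u \<otimes> s \<otimes> b" using bruhat[OF g(1)] by blast
      \<comment> \<open>The fixed coset is tested on the conjugate of \<open>v\<close> by
        \<open>u\<close>, again in \<open>U\<close>: with \<open>g = u s b\<close> the factors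
        \<open>u\<close> cancel and a \<open>B\<close>-conjugate of \<open>s v s\<close>
        remains.\<close>
      have "s \<otimes> v \<otimes> s \<in> B" if v: "v \<in> U" for v
      proof -
        note c = U_carrier[OF v] U_carrier[OF ub(1)] B_carrier[OF ub(2)] s_carrier
        have "b \<otimes> (inv g \<otimes> (u \<otimes> v \<otimes> inv u) \<otimes> g) \<otimes> inv b \<in> B" 
          by (intro B_closed(2,3) fx U_closed(2,3) ub v)
        also have "b \<otimes> (inv g \<otimes> (u \<otimes> v \<otimes> inv u) \<otimes> g) \<otimes> inv b = s \<otimes> v \<otimes> s"
          using c by (simp add: ub(3) inv_mult_group m_assoc s_inv inv_cancel_assoc)
        finally show ?thesis .
      qed
      then show False using s_not_normalizes by blast
    qed
    then show "C \<in> {lcos \<one>}" using g(1,2) lcos_eq_iff[of \<one> g] K_carrier by simp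
  next
    fix C assume "C \<in> {lcos \<one>}"
    then show "C \<in> {C \<in> lcos ` K. \<forall>h\<in>U. (\<lambda>x. h \<otimes> x) ` C = C}"
      using lcos_fixed_iff[of _ \<one>] U_B B_K B_carrier by auto
  qed
  have "p dvd card (lcos ` K - {lcos \<one>})"
    using lcos_fixed_points[OF pow_small_U] U_subset B_subset unfolding U1 by blast
  then have "p dvd card (lcos ` K) - 1" using finite_lcos by (simp add: card_Diff_singleton)
  moreover have "card (lcos ` K) \<noteq> 0" using finite_lcos by auto
  ultimately have nd: "\<not> p dvd card (lcos ` K)"
    using prime_p dvd_diff_nat[of p "card (lcos ` K)" "card (lcos ` K) - 1"] by auto
  have "{C \<in> lcos ` K. \<forall>h\<in>Kp. (\<lambda>x. h \<otimes> x) ` C = C} \<noteq> {}"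
  proof
    assume e: "{C \<in> lcos ` K. \<forall>h\<in>Kp. (\<lambda>x. h \<otimes> x) ` C = C} = {}"
    show False using lcos_fixed_points[OF pow_small_Kp] Kp_K nd unfolding e by auto
  qed
  then obtain g where g: "g \<in> K" "\<And>h. h \<in> Kp \<Longrightarrow> (\<lambda>x. h \<otimes> x) ` lcos g = lcos g" by blast
  show ?thesis
  proof
    \<comment> \<open>A fixed coset \<open>gB\<close> only places the conjugates of
      \<open>Kp\<close> by the inverse of \<open>g\<close> in \<open>B\<close>. Normality of
      \<open>Kp\<close> in \<open>K\<close> removes \<open>g\<close>: the criterion is applied to
      the conjugate of \<open>h\<close> by \<open>g\<close>.\<close>
    fix h assume h: "h \<in> Kp"
    then have "inv g \<otimes> (g \<otimes> h \<otimes> inv g) \<otimes> g \<in> B"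
      using g(2)[OF Kp_conj[OF g(1) h]] lcos_fixed_iff[OF Kp_K[OF Kp_conj[OF g(1) h]] g(1)] by simp
    also have "inv g \<otimes> (g \<otimes> h \<otimes> inv g) \<otimes> g = h"
      using K_carrier[OF g(1)] K_carrier[OF Kp_K[OF h]] by (simp add: m_assoc inv_cancel_assoc)
    finally show "h \<in> B" .
  qed
qed

end

section \<open>Vectors fixed by the pro-\<open>p\<close> Iwahori subgroup\<close>

text \<open>Sums only, no scalars: in positive characteristic the span of a finite set is then
  finite, whereas the linear span over an infinite field is not. The same notion describes the
  images of \<open>I_plus\<close> and \<open>I_minus\<close>, whose generators are already closed
  under scalars.\<close>

inductive_set addspan :: "'v::ab_group_add set \<Rightarrow> 'v set" for S where
  zero [intro, simp]: "0 \<in> addspan S"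
| plus: "x \<in> S \<Longrightarrow> y \<in> addspan S \<Longrightarrow> x + y \<in> addspan S"

lemma addspan_base: "x \<in> S \<Longrightarrow> x \<in> addspan S"
  using addspan.plus[of x S 0] by simp

lemma addspan_add: "x \<in> addspan S \<Longrightarrow> y \<in> addspan S \<Longrightarrow> x + y \<in> addspan S"
  by (induction rule: addspan.induct) (auto simp: add.assoc intro: addspan.plus)

lemma addspan_image:
  assumes "x \<in> addspan S" and add: "\<And>x y. f (x + y) = f x + f y"
    and base: "\<And>x. x \<in> S \<Longrightarrow> f x \<in> addspan T"
  shows "f x \<in> addspan T"
proof -
  have "f 0 = 0" using add[of 0 0] by simp
  from assms(1) show ?thesis
    by induction (auto simp: add \<open>f 0 = 0\<close> intro: addspan_add base)
qed

lemma addspan_subset: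
  assumes "S \<subseteq> addspan T"
  shows "addspan S \<subseteq> addspan T"
proof
  fix x assume "x \<in> addspan S"
  then have "id x \<in> addspan T" by (rule addspan_image) (use assms in auto)
  then show "x \<in> addspan T" by simp
qed

text \<open>Coefficients can be taken in the image \<open>R\<close> of the natural numbers, which is
  finite because they matter only modulo the characteristic.\<close>

lemma finite_addspan:
  fixes scl :: "'k::field \<Rightarrow> 'v::ab_group_add \<Rightarrow> 'v" and S :: "'v set"
  assumes "vector_space scl" "finite S" "CHAR('k) > 0"
  shows "finite (addspan S)"
proof -
  interpret vector_space scl by fact
  define R where "R = range (of_nat :: nat \<Rightarrow> 'k)"
  have "R \<subseteq> of_nat ` {..<CHAR('k)}"
  proof
    fix c assume "c \<in> R"
    then obtain n where n: "c = of_nat n" by (auto simp: R_def)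
    show "c \<in> of_nat ` {..<CHAR('k)}"
      by (rule image_eqI[of _ _ "n mod CHAR('k)"]) (use assms(3) n in auto)
  qed
  then have "finite R" by (rule finite_subset) simp
  have R0: "0 \<in> R" unfolding R_def by (rule range_eqI[of _ _ 0]) simp
  have R1: "1 + c \<in> R" if c: "c \<in> R" for c
  proof -
    obtain n where "c = of_nat n" using c by (auto simp: R_def)
    then have "1 + c = of_nat (Suc n)" by simp
    then show ?thesis unfolding R_def by (rule range_eqI)
  qed
  define L where "L = (\<lambda>c. \<Sum>y\<in>S. scl (c y) y) ` (S \<rightarrow>\<^sub>E R)"
  have "x \<in> L" if "x \<in> addspan S" for x
    using that
  proof induction
    case zero
    show ?case unfolding L_def
      by (rule image_eqI[of _ _ "\<lambda>x\<in>S. 0"]) (auto simp: R0)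
  next
    case (plus x y)
    then obtain c where c: "c \<in> S \<rightarrow>\<^sub>E R" "y = (\<Sum>y\<in>S. scl (c y) y)" by (auto simp: L_def)
    show ?case unfolding L_def
    proof (rule image_eqI[of _ _ "c(x := 1 + c x)"])
      have "(\<Sum>y\<in>S. scl ((c(x := 1 + c x)) y) y) = scl (1 + c x) x + (\<Sum>y\<in>S - {x}. scl (c y) y)"
        using plus(1) assms(2) by (simp add: sum.remove)
      also have "\<dots> = x + (\<Sum>y\<in>S. scl (c y) y)"
        using plus(1) assms(2) by (simp add: sum.remove[of S x] scale_left_distrib add.assoc)
      finally show "x + y = (\<Sum>y\<in>S. scl ((c(x := 1 + c x)) y) y)" using c by simp
      show "c(x := 1 + c x) \<in> S \<rightarrow>\<^sub>E R" using c plus(1) R1 by (auto simp: PiE_iff extensional_def)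
    qed
  qed
  moreover have "finite L" unfolding L_def using \<open>finite R\<close> assms(2) by (intro finite_imageI finite_PiE)
  ultimately show ?thesis by (meson finite_subset subsetI)
qed

text \<open>The span is a group of exponent p acting on itself by translation. As it contains
  \<open>x \<noteq> 0\<close>, no point is fixed by all translations, and
  \<open>fixed_points_cong\<close> gives the divisibility.\<close>

lemma CHAR_dvd_card_addspan:
  fixes scl :: "'k::field \<Rightarrow> 'v::ab_group_add \<Rightarrow> 'v" and x :: 'v
  assumes "vector_space scl" "finite S" "Factorial_Ring.prime CHAR('k)" "x \<in> addspan S" "x \<noteq> 0"
  shows "CHAR('k) dvd card (addspan S)"
proof -
  interpret vector_space scl by fact
  let ?A = "addspan S"
  let ?M = "\<lparr>carrier = ?A, monoid.mult = (+), one = (0::'v)\<rparr>"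
  have pos: "CHAR('k) > 0" using assms(3) prime_gt_0_nat by blast
  have mem: "scl (of_nat n) y \<in> ?A" if "y \<in> ?A" for n and y :: 'v
    using that by (induction n) (auto simp: scale_left_distrib intro: addspan_add)
  have "group ?M"
  proof (rule groupI)
    fix y assume "y \<in> carrier ?M"
    \<comment> \<open>In characteristic p the negative of \<open>y\<close> is the positive multiple
      \<open>(p - 1) y\<close>, so it lies in the additive span.\<close>
    then have "scl (of_nat (CHAR('k) - 1)) y \<in> ?A" using mem by simp
    moreover have "scl (of_nat (CHAR('k) - 1)) y + y = scl (of_nat (CHAR('k) - 1 + 1)) y"
      by (simp add: scale_left_distrib del: of_nat_CHAR)
    then have "scl (of_nat (CHAR('k) - 1)) y + y = 0" using pos by simp
    ultimately show "\<exists>z\<in>carrier ?M. z \<otimes>\<^bsub>?M\<^esub> y = \<one>\<^bsub>?M\<^esub>" by auto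
  qed (auto simp: addspan_add add.assoc)
  then interpret M: group ?M .
  have pw: "y [^]\<^bsub>?M\<^esub> n = scl (of_nat n) y" for y and n :: nat
    by (induction n) (simp_all add: scale_left_distrib add.commute)
  have fin: "finite ?A" using finite_addspan[OF assms(1,2) pos] .
  have "CHAR('k) dvd card (?A - {y\<in>?A. \<forall>h\<in>carrier ?M. h + y = y})"
  proof (rule fixed_points_cong[OF M.is_group fin assms(3)])
    show "\<exists>i::nat. \<forall>y\<in>?A. h [^]\<^bsub>?M\<^esub> (CHAR('k) ^ i) + y = y" for h
      by (rule exI[of _ 1]) (simp add: pw)
  qed (auto simp: addspan_add add.assoc)
  moreover have "{y\<in>?A. \<forall>h\<in>carrier ?M. h + y = y} = {}" using assms(4,5) by auto
  ultimately show ?thesis by (simp only: Diff_empty)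
qed

context maximal_compact
begin

text \<open>The finite additive span of a \<open>K\<close>-orbit has size divisible by p. This
  divisibility passes to the vectors fixed by \<open>Kp\<close>, and from there to those also fixed
  by \<open>U\<close>. In the application \<open>S\<close> is the image of a weight.\<close>

lemma exists_fixed_vector:
  fixes scl :: "'k::field \<Rightarrow> 'v::ab_group_add \<Rightarrow> 'v"
  assumes rep: "smooth_rep scl G UNIV \<pi>" and char: "CHAR('k) = p"
    and S: "0 \<in> S" "\<And>x y. x \<in> S \<Longrightarrow> y \<in> S \<Longrightarrow> x + y \<in> S" "\<And>k x. k \<in> K \<Longrightarrow> x \<in> S \<Longrightarrow> \<pi> k x \<in> S"
    and x: "x \<in> S" "x \<noteq> 0"
  obtains v where "v \<in> S" "v \<noteq> 0" "\<And>h. h \<in> Kp \<Longrightarrow> \<pi> h v = v" "\<And>u. u \<in> U \<Longrightarrow> \<pi> u v = v"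
proof -
  have vs: "vector_space scl" using rep by (simp add: smooth_rep_def)
  have padd: "\<pi> g (y + z) = \<pi> g y + \<pi> g z" if "g \<in> carrier G" for g y z
    using rep that by (simp add: smooth_rep_def linear_map_on_def)
  have p0: "\<pi> g 0 = 0" if "g \<in> carrier G" for g using padd[OF that, of 0 0] by simp
  have pone: "\<pi> \<one> y = y" for y using rep by (simp add: smooth_rep_def)
  have pmult: "\<pi> (g \<otimes> h) y = \<pi> g (\<pi> h y)" if "g \<in> carrier G" "h \<in> carrier G" for g h y
    using rep that by (simp add: smooth_rep_def)
  have pop: "op {g \<in> carrier G. \<pi> g y = y}" for y using rep by (simp add: smooth_rep_def)
  define orb where "orb = (\<lambda>k. \<pi> k x) ` K"
  have forb: "finite orb" unfolding orb_def
  proof (rule finite_image_locally_constant[OF compact_K])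
    fix g assume g: "g \<in> K"
    have "\<pi> k x = \<pi> g x \<longleftrightarrow> \<pi> (inv g \<otimes> k) x = x" if "k \<in> K" for k
      using g that K_carrier by (metis inv_closed inv_inv l_inv pmult pone r_inv)
    then have "{k \<in> K. \<pi> k x = \<pi> g x} = K \<inter> {k \<in> carrier G. inv g \<otimes> k \<in> {g \<in> carrier G. \<pi> g x = x}}"
      using g K_carrier by auto
    then show "openin (top_of_set K) {k \<in> K. \<pi> k x = \<pi> g x}"
      using op_restrict[OF op_left[OF pop]] g K_carrier subgroup.subset[OF K_subgroup] by simp
  qed
  let ?A = "addspan orb"
  have stab: "\<pi> k y \<in> ?A" if k: "k \<in> K" and y: "y \<in> ?A" for k y
    using y
  proof (rule addspan_image)
    show "\<pi> k (y + z) = \<pi> k y + \<pi> k z" for y z using padd k K_carrier by blast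
    show "\<pi> k y \<in> ?A" if y: "y \<in> orb" for y
    proof (rule addspan_base)
      obtain g where "g \<in> K" "y = \<pi> g x" using y by (auto simp: orb_def)
      then have "\<pi> k y = \<pi> (k \<otimes> g) x" "k \<otimes> g \<in> K" using k K_carrier by (simp_all add: pmult)
      then show "\<pi> k y \<in> orb" by (auto simp: orb_def)
    qed
  qed
  have AS: "y \<in> S" if "y \<in> ?A" for y
    using that by induction (use S x in \<open>auto simp: orb_def\<close>)
  have xA: "x \<in> ?A"
    by (rule addspan_base) (use pone[of x] in \<open>auto simp: orb_def intro!: rev_image_eqI[of \<one>]\<close>)
  have pos: "CHAR('k) > 0" using prime_p char prime_gt_0_nat by blast
  have fA: "finite ?A" by (rule finite_addspan[OF vs forb pos])
  have d0: "p dvd card ?A"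
    using CHAR_dvd_card_addspan[OF vs forb _ xA x(2)] prime_p by (simp add: char)
  define A1 where "A1 = {y \<in> ?A. \<forall>h\<in>Kp. \<pi> h y = y}"
  have sub: "openin (top_of_set H) {h \<in> H. \<pi> h y = y}" if "H \<subseteq> carrier G" for H y
  proof -
    have "{h \<in> H. \<pi> h y = y} = H \<inter> {g \<in> carrier G. \<pi> g y = y}" using that by auto
    then show ?thesis using op_restrict[OF pop that] by simp
  qed
  have "p dvd card (?A - A1)" unfolding A1_def
  proof (rule pow_small_fixed_points[OF pow_small_Kp fA prime_p])
    show "openin (top_of_set Kp) {h \<in> Kp. \<pi> h y = y}" for y
      by (rule sub) (use Kp_K K_carrier in auto)
  qed (use stab pone pmult Kp_K K_carrier in auto)
  moreover have "card (?A - A1) = card ?A - card A1" "card A1 \<le> card ?A"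
    using fA by (auto simp: A1_def card_Diff_subset card_mono)
  ultimately have d1: "p dvd card A1" using d0 by (metis dvd_diffD1)
  define A2 where "A2 = {y \<in> A1. \<forall>h\<in>U. \<pi> h y = y}"
  have fA1: "finite A1" using fA by (simp add: A1_def)
  have "p dvd card (A1 - A2)" unfolding A2_def
  proof (rule pow_small_fixed_points[OF pow_small_U fA1 prime_p])
    show "openin (top_of_set U) {h \<in> U. \<pi> h y = y}" for y
      by (rule sub) (use U_carrier in auto)
    \<comment> \<open>\<open>U\<close> acts on the vectors fixed by \<open>Kp\<close> because it
      lies in \<open>K\<close>, which normalizes \<open>Kp\<close>.\<close>
    show "\<pi> u y \<in> A1" if u: "u \<in> U" and y: "y \<in> A1" for u y
    proof -
      have uK: "u \<in> K" using u U_B B_K by blast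
      have "\<pi> h (\<pi> u y) = \<pi> u y" if h: "h \<in> Kp" for h
      proof -
        note c = K_carrier[OF uK] K_carrier[OF Kp_K[OF h]]
        have "inv u \<otimes> h \<otimes> u \<in> Kp" using Kp_conj[of "inv u" h] uK h c by simp
        then have "\<pi> u y = \<pi> u (\<pi> (inv u \<otimes> h \<otimes> u) y)" using y by (simp add: A1_def)
        also have "\<dots> = \<pi> (u \<otimes> (inv u \<otimes> h \<otimes> u)) y" using c by (simp add: pmult)
        also have "u \<otimes> (inv u \<otimes> h \<otimes> u) = h \<otimes> u" using c by (simp add: m_assoc inv_cancel_assoc)
        also have "\<pi> (h \<otimes> u) y = \<pi> h (\<pi> u y)" using c by (simp add: pmult)
        finally show ?thesis by simp
      qed
      then show ?thesis using y stab uK by (simp add: A1_def)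
    qed
  qed (use pone pmult U_carrier in auto)
  moreover have "card (A1 - A2) = card A1 - card A2" "card A2 \<le> card A1"
    using fA1 by (auto simp: A2_def card_Diff_subset card_mono)
  ultimately have d2: "p dvd card A2" using d1 by (metis dvd_diffD1)
  have z: "0 \<in> A2" using p0 Kp_K K_carrier U_carrier by (auto simp: A2_def A1_def)
  \<comment> \<open>Zero is among the fixed vectors, and their number is a multiple of p, so it
    cannot be one.\<close>
  have "A2 \<noteq> {0}" using d2 prime_p by auto
  then obtain v where "v \<in> A2" "v \<noteq> 0" using z by blast
  then show thesis using that[of v] AS by (auto simp: A2_def A1_def)
qed

end

section \<open>Images of the compact induction\<close>

text \<open>\<open>P\<close> and \<open>Q\<close> will be the upper and lower triangular elements of
  \<open>B\<close>, both containing its diagonal matrices. Conjugation by \<open>inv a\<close>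
  shrinks the former and conjugation by \<open>a\<close> the latter. The last two assumptions
  concern the two involutions \<open>s\<close> and \<open>a s\<close>: the first conjugates
  \<open>Q\<close> into \<open>B\<close>, the second \<open>P\<close>.\<close>

locale iwahori_decomposition = maximal_compact G p K B U Kp s
  for G :: "'e::{field,metric_space} mat3 monoid" (structure) and p K B U Kp s +
  fixes a :: "'e mat3" and P Q :: "'e mat3 set"
  assumes a_carrier: "a \<in> carrier G" and s_a_s: "s \<otimes> a \<otimes> s = inv a"
    and P_subset: "P \<subseteq> B" and Q_subset: "Q \<subseteq> B"
    and factor_PQ: "\<And>b. b \<in> B \<Longrightarrow> \<exists>u\<in>P. \<exists>l\<in>Q. b = u \<otimes> l"
    and factor_QP: "\<And>b. b \<in> B \<Longrightarrow> \<exists>l\<in>Q. \<exists>u\<in>P. b = l \<otimes> u"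
    and P_contract: "\<And>u. u \<in> P \<Longrightarrow> inv a \<otimes> u \<otimes> a \<in> P"
    and Q_contract: "\<And>l. l \<in> Q \<Longrightarrow> a \<otimes> l \<otimes> inv a \<in> Q"
    and s_Q_s: "\<And>l. l \<in> Q \<Longrightarrow> s \<otimes> l \<otimes> s \<in> B"
    and as_P_sa: "\<And>u. u \<in> P \<Longrightarrow> a \<otimes> (s \<otimes> u \<otimes> s) \<otimes> inv a \<in> B"
begin

lemma apow_carrier [simp]: "a [^] (n::nat) \<in> carrier G"
  using a_carrier by simp

lemma P_carrier: "u \<in> P \<Longrightarrow> u \<in> carrier G" and Q_carrier: "u \<in> Q \<Longrightarrow> u \<in> carrier G"
  using P_subset Q_subset B_carrier by auto

lemma P_contract_pow: "u \<in> P \<Longrightarrow> inv (a [^] (n::nat)) \<otimes> u \<otimes> a [^] n \<in> P"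
proof (induction n)
  case (Suc n)
  have "inv (a [^] Suc n) \<otimes> u \<otimes> a [^] Suc n = inv a \<otimes> (inv (a [^] n) \<otimes> u \<otimes> a [^] n) \<otimes> a"
    using P_carrier[OF Suc.prems] a_carrier by (simp add: inv_mult_group m_assoc)
  then show ?case using P_contract[OF Suc.IH[OF Suc.prems]] by simp
qed (use P_carrier in auto)

lemma Q_contract_pow: "l \<in> Q \<Longrightarrow> a [^] (n::nat) \<otimes> l \<otimes> inv (a [^] n) \<in> Q"
proof (induction n)
  case (Suc n)
  have "a [^] Suc n \<otimes> l \<otimes> inv (a [^] Suc n) = a \<otimes> (a [^] n \<otimes> l \<otimes> inv (a [^] n)) \<otimes> inv a"
    unfolding nat_pow_Suc2[OF a_carrier]
    using Q_carrier[OF Suc.prems] a_carrier by (simp add: inv_mult_group m_assoc)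
  then show ?case using Q_contract[OF Suc.IH[OF Suc.prems]] by simp
qed (use Q_carrier in auto)

lemma s_apow: "s \<otimes> a [^] (n::nat) = inv (a [^] n) \<otimes> s"
proof (induction n)
  case (Suc n)
  have sa: "s \<otimes> a = inv a \<otimes> s"
  proof -
    have "s \<otimes> a = s \<otimes> a \<otimes> s \<otimes> s" using s_carrier a_carrier s_square by (simp add: m_assoc)
    then show ?thesis by (simp add: s_a_s)
  qed
  have "s \<otimes> a [^] Suc n = (s \<otimes> a [^] n) \<otimes> a" using s_carrier a_carrier by (simp add: m_assoc)
  also have "\<dots> = inv (a [^] n) \<otimes> (s \<otimes> a)" using s_carrier a_carrier by (simp add: Suc m_assoc)
  also have "\<dots> = inv (a \<otimes> a [^] n) \<otimes> s" using s_carrier a_carrier by (simp add: sa m_assoc inv_mult_group)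
  also have "a \<otimes> a [^] n = a [^] Suc n" using a_carrier by (simp only: nat_pow_Suc2)
  finally show ?case .
qed (use s_carrier in auto)

lemma s_inv_apow: "s \<otimes> inv (a [^] (n::nat)) = a [^] n \<otimes> s"
proof -
  have "s \<otimes> inv (a [^] n) = s \<otimes> (inv (a [^] n) \<otimes> s) \<otimes> s"
    using s_carrier s_square by (simp add: m_assoc)
  also have "\<dots> = s \<otimes> (s \<otimes> a [^] n) \<otimes> s" by (simp add: s_apow)
  finally show ?thesis using s_carrier by (simp add: s_cancel)
qed

end

text \<open>One instance for each weight. The group data and \<open>\<pi>\<close> are parameters, so
  that two instances over the same groups can be compared.\<close>

locale induced_map = iwahori_decomposition G p K B U Kp s a P Q
  for G :: "'e::{field,metric_space} mat3 monoid" (structure) and p K B U Kp s a P Q +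
  fixes scl :: "'k::field \<Rightarrow> 'v::ab_group_add \<Rightarrow> 'v"
    and \<pi> :: "'e mat3 \<Rightarrow> 'v \<Rightarrow> 'v" and W :: "'v set" and \<sigma> :: "'e mat3 \<Rightarrow> 'v \<Rightarrow> 'v"
    and j :: "'v \<Rightarrow> 'v" and \<phi> :: "('e mat3 \<Rightarrow> 'v) \<Rightarrow> 'v"
  assumes rep: "smooth_rep scl G UNIV \<pi>"
    and weight: "smooth_rep scl (G\<lparr>carrier := K\<rparr>) W \<sigma>"
    and embedding: "rep_embedding scl (G\<lparr>carrier := K\<rparr>) W \<sigma> \<pi> j"
    and frobenius: "frobenius_induced scl G K W \<sigma> \<pi> j \<phi>"
begin

sublocale vector_space scl
  using rep by (simp add: smooth_rep_def)

lemma pi_add: "g \<in> carrier G \<Longrightarrow> \<pi> g (x + y) = \<pi> g x + \<pi> g y"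
  and pi_scale: "g \<in> carrier G \<Longrightarrow> \<pi> g (scl c x) = scl c (\<pi> g x)"
  and pi_one: "\<pi> \<one> x = x"
  and pi_mult: "g \<in> carrier G \<Longrightarrow> h \<in> carrier G \<Longrightarrow> \<pi> (g \<otimes> h) x = \<pi> g (\<pi> h x)"
  using rep by (simp_all add: smooth_rep_def linear_map_on_def)

lemma W_subspace: "subspace W"
  using weight by (simp add: smooth_rep_def)

lemma sigma_closed: "k \<in> K \<Longrightarrow> x \<in> W \<Longrightarrow> \<sigma> k x \<in> W"
  and sigma_add: "k \<in> K \<Longrightarrow> x \<in> W \<Longrightarrow> y \<in> W \<Longrightarrow> \<sigma> k (x + y) = \<sigma> k x + \<sigma> k y"
  and sigma_scale: "k \<in> K \<Longrightarrow> x \<in> W \<Longrightarrow> \<sigma> k (scl c x) = scl c (\<sigma> k x)"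
  and sigma_one: "x \<in> W \<Longrightarrow> \<sigma> \<one> x = x"
  and sigma_mult: "k \<in> K \<Longrightarrow> k' \<in> K \<Longrightarrow> x \<in> W \<Longrightarrow> \<sigma> (k \<otimes> k') x = \<sigma> k (\<sigma> k' x)"
  and sigma_smooth: "x \<in> W \<Longrightarrow> openin (top_of_set K) {k \<in> K. \<sigma> k x = x}"
  using weight by (simp_all add: smooth_rep_def linear_map_on_def image_subset_iff)

lemma j_add: "x \<in> W \<Longrightarrow> y \<in> W \<Longrightarrow> j (x + y) = j x + j y"
  and j_scale: "x \<in> W \<Longrightarrow> j (scl c x) = scl c (j x)"
  and j_inj: "inj_on j W"
  and j_sigma: "k \<in> K \<Longrightarrow> x \<in> W \<Longrightarrow> j (\<sigma> k x) = \<pi> k (j x)"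
  using embedding by (simp_all add: rep_embedding_def linear_map_on_def)

lemma W_zero: "0 \<in> W" and W_add: "x \<in> W \<Longrightarrow> y \<in> W \<Longrightarrow> x + y \<in> W"
  and W_scale: "x \<in> W \<Longrightarrow> scl c x \<in> W"
  using W_subspace by (auto simp: subspace_def)

lemma W_uminus: "x \<in> W \<Longrightarrow> - x \<in> W"
  using W_scale[of x "- 1"] by simp

lemma j_zero: "j 0 = 0"
  using j_add[OF W_zero W_zero] by simp

lemma sigma_uminus: "k \<in> K \<Longrightarrow> x \<in> W \<Longrightarrow> \<sigma> k (- x) = - \<sigma> k x"
  using sigma_scale[of k x "- 1"] by simp

lemma sigma_zero: "k \<in> K \<Longrightarrow> \<sigma> k 0 = 0"
  using sigma_scale[of k 0 0] W_zero by simp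

abbreviation "ind \<equiv> compact_ind G K W \<sigma>"

text \<open>The translate by \<open>h\<close> of the function \<open>[1, x]\<close>.\<close>

definition bracket :: "'e mat3 \<Rightarrow> 'v \<Rightarrow> 'e mat3 \<Rightarrow> 'v" where
  "bracket h x = (\<lambda>g. if g \<in> carrier G then (if g \<otimes> h \<in> K then \<sigma> (g \<otimes> h) x else 0) else 0)"

lemma ind_zero: "(\<lambda>g. 0) \<in> ind"
proof -
  have "\<exists>U. op U \<and> g \<in> U \<and> (\<forall>h\<in>U. (0::'v) = 0)" if "g \<in> carrier G" for g
    using that by (intro exI[of _ "carrier G"]) simp
  moreover have "\<exists>C. compact C \<and> C \<subseteq> carrier G \<and> (\<forall>g. (0::'v) \<noteq> 0 \<longrightarrow> g \<in> C)"
    by (intro exI[of _ "{}"]) simp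
  ultimately show ?thesis unfolding compact_ind_def using W_zero sigma_zero by simp
qed

lemma ind_add:
  assumes f: "f \<in> ind" and f': "f' \<in> ind"
  shows "(\<lambda>g. f g + f' g) \<in> ind"
proof -
  obtain C C' where C: "compact C" "C \<subseteq> carrier G" "\<And>g. f g \<noteq> 0 \<Longrightarrow> g \<in> C"
      "compact C'" "C' \<subseteq> carrier G" "\<And>g. f' g \<noteq> 0 \<Longrightarrow> g \<in> C'"
    using f f' unfolding compact_ind_def by blast
  have "\<exists>U. op U \<and> g \<in> U \<and> (\<forall>h\<in>U. f h + f' h = f g + f' g)" if "g \<in> carrier G" for g
  proof -
    obtain T T' where T: "op T" "g \<in> T" "\<forall>h\<in>T. f h = f g" "op T'" "g \<in> T'" "\<forall>h\<in>T'. f' h = f' g"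
      using f f' \<open>g \<in> carrier G\<close> unfolding compact_ind_def by blast
    have "op (T \<inter> T')" using T(1,4) by (rule openin_Int)
    moreover have "g \<in> T \<inter> T'" "\<forall>h\<in>T \<inter> T'. f h + f' h = f g + f' g"
      using T(2,3,5,6) by (blast, metis IntD1 IntD2)
    ultimately show ?thesis by blast
  qed
  moreover have "\<exists>C. compact C \<and> C \<subseteq> carrier G \<and> (\<forall>g. f g + f' g \<noteq> 0 \<longrightarrow> g \<in> C)"
  proof (intro exI conjI allI impI)
    show "compact (C \<union> C')" "C \<union> C' \<subseteq> carrier G" using C by auto
    show "g \<in> C \<union> C'" if "f g + f' g \<noteq> 0" for g using that C(3,6)[of g] by (cases "f g = 0") auto
  qed
  ultimately show ?thesis
    using f f' W_add sigma_add unfolding compact_ind_def mem_Collect_eq by simp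
qed

lemma bracket_in_ind:
  assumes h: "h \<in> carrier G" and x: "x \<in> W"
  shows "bracket h x \<in> ind"
proof -
  have 1: "bracket h x (k \<otimes> g) = \<sigma> k (bracket h x g)" if k: "k \<in> K" and g: "g \<in> carrier G" for k g
  proof -
    have kG: "k \<in> carrier G" using k K_carrier by blast
    have "k \<otimes> g \<otimes> h \<in> K \<longleftrightarrow> g \<otimes> h \<in> K"
    proof
      assume "k \<otimes> g \<otimes> h \<in> K"
      then have "inv k \<otimes> (k \<otimes> g \<otimes> h) \<in> K" using k by blast
      then show "g \<otimes> h \<in> K" using kG g h by (simp add: m_assoc inv_cancel_assoc)
    qed (use k kG g h in \<open>simp add: m_assoc\<close>)
    then show ?thesis using k kG g h x by (simp add: bracket_def m_assoc sigma_mult sigma_zero)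
  qed
  have 2: "\<exists>V. op V \<and> g \<in> V \<and> (\<forall>g'\<in>V. bracket h x g' = bracket h x g)" if g: "g \<in> carrier G" for g
  proof (cases "g \<otimes> h \<in> K")
    case True
    \<comment> \<open>The stabilizer of \<open>x\<close> is open in \<open>K\<close> by smoothness,
      hence open in the whole group. On the translate of it through \<open>g h\<close> the value
      does not change.\<close>
    let ?T = "{k \<in> K. \<sigma> k x = x}"
    have "op ?T" using sigma_smooth[OF x] op_K by (rule openin_trans)
    then have "op {g' \<in> carrier G. g' \<otimes> h \<in> {g' \<in> carrier G. inv (g \<otimes> h) \<otimes> g' \<in> ?T}}"
      using g h by (intro op_right op_left) auto
    moreover have "g \<in> {g' \<in> carrier G. g' \<otimes> h \<in> {g' \<in> carrier G. inv (g \<otimes> h) \<otimes> g' \<in> ?T}}"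
      using g h x by (simp add: sigma_one)
    moreover have "bracket h x g' = bracket h x g"
      if g': "g' \<in> {g' \<in> carrier G. g' \<otimes> h \<in> {g' \<in> carrier G. inv (g \<otimes> h) \<otimes> g' \<in> ?T}}" for g'
    proof -
      let ?k = "inv (g \<otimes> h) \<otimes> (g' \<otimes> h)"
      have c: "g' \<in> carrier G" and k: "?k \<in> K" "\<sigma> ?k x = x" using g' by auto
      have e: "g' \<otimes> h = (g \<otimes> h) \<otimes> ?k" using c g h by (simp add: inv_cancel_assoc)
      have "(g \<otimes> h) \<otimes> ?k \<in> K" using True k by blast
      moreover have "\<sigma> ((g \<otimes> h) \<otimes> ?k) x = \<sigma> (g \<otimes> h) x"
        using sigma_mult[OF True k(1) x] k(2) by simp
      ultimately have "g' \<otimes> h \<in> K" "\<sigma> (g' \<otimes> h) x = \<sigma> (g \<otimes> h) x"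
        unfolding e[symmetric] by auto
      then show ?thesis using c g True by (simp add: bracket_def)
    qed
    ultimately show ?thesis by blast
  next
    case False
    \<comment> \<open>Here \<open>g' h\<close> ranges over the coset of \<open>g h\<close> modulo
      \<open>K\<close>, which is disjoint from \<open>K\<close> since \<open>g h\<close> is not in
      \<open>K\<close>; the function vanishes on this neighbourhood.\<close>
    have "op {g' \<in> carrier G. g' \<otimes> h \<in> {g' \<in> carrier G. inv (g \<otimes> h) \<otimes> g' \<in> K}}"
      using g h by (intro op_right op_left op_K) auto
    moreover have "g \<in> {g' \<in> carrier G. g' \<otimes> h \<in> {g' \<in> carrier G. inv (g \<otimes> h) \<otimes> g' \<in> K}}"
      using g h by simp
    moreover have "bracket h x g' = bracket h x g"
      if g': "g' \<in> {g' \<in> carrier G. g' \<otimes> h \<in> {g' \<in> carrier G. inv (g \<otimes> h) \<otimes> g' \<in> K}}" for g'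
    proof -
      let ?k = "inv (g \<otimes> h) \<otimes> (g' \<otimes> h)"
      have c: "g' \<in> carrier G" and k: "?k \<in> K" using g' by auto
      have "g \<otimes> h = (g' \<otimes> h) \<otimes> inv ?k" using c g h by (simp add: inv_mult_group m_assoc inv_cancel_assoc)
      then have "g' \<otimes> h \<notin> K" using False k K_closed by metis
      then show ?thesis using c g False by (simp add: bracket_def)
    qed
    ultimately show ?thesis by blast
  qed
  have "\<exists>C. compact C \<and> C \<subseteq> carrier G \<and> (\<forall>g. bracket h x g \<noteq> 0 \<longrightarrow> g \<in> C)"
  proof (intro exI conjI allI impI)
    show "compact ((\<lambda>k. k \<otimes> inv h) ` K)"
      using h subgroup.subset[OF K_subgroup] 
      by (intro compact_continuous_image continuous_on_subset[OF continuous_right] compact_K) auto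
    show "(\<lambda>k. k \<otimes> inv h) ` K \<subseteq> carrier G" using h K_carrier by auto
    fix g assume "bracket h x g \<noteq> 0"
    then have "g \<in> carrier G" "g \<otimes> h \<in> K" by (auto simp: bracket_def split: if_splits)
    then show "g \<in> (\<lambda>k. k \<otimes> inv h) ` K"
      using h by (intro image_eqI[of _ _ "g \<otimes> h"]) (auto simp: m_assoc)
  qed
  moreover have "bracket h x g \<in> W" for g using x W_zero sigma_closed by (simp add: bracket_def)
  moreover have "bracket h x g = 0" if "g \<notin> carrier G" for g using that by (simp add: bracket_def)
  ultimately show ?thesis using 1 2 by (simp add: compact_ind_def)
qed

lemma phi_add: "f \<in> ind \<Longrightarrow> f' \<in> ind \<Longrightarrow> \<phi> (\<lambda>g. f g + f' g) = \<phi> f + \<phi> f'"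
  using frobenius by (simp add: frobenius_induced_def)

lemma phi_zero: "\<phi> (\<lambda>g. 0) = 0"
  using phi_add[OF ind_zero ind_zero] by simp

lemma phi_bracket:
  assumes h: "h \<in> carrier G" and x: "x \<in> W"
  shows "\<phi> (bracket h x) = \<pi> h (j x)"
proof -
  have b1: "bracket \<one> x = (\<lambda>g. if g \<in> K then \<sigma> g x else 0)"
    using K_carrier by (auto simp: bracket_def fun_eq_iff)
  have "bracket h x = (\<lambda>g. if g \<in> carrier G then bracket \<one> x (g \<otimes> h) else 0)"
    using h by (auto simp: bracket_def fun_eq_iff)
  then have "\<phi> (bracket h x) = \<pi> h (\<phi> (bracket \<one> x))"
    using frobenius bracket_in_ind[OF one_closed x] h by (simp add: frobenius_induced_def)
  also have "\<phi> (bracket \<one> x) = j x" unfolding b1 using frobenius x by (simp add: frobenius_induced_def)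
  finally show ?thesis .
qed

lemma bracket_uminus: "x \<in> W \<Longrightarrow> bracket h (- x) g = - bracket h x g"
  by (simp add: bracket_def sigma_uminus)

text \<open>Equivariance determines \<open>f\<close> on the coset \<open>K d\<close> by its value at
  \<open>d\<close>. Subtracting this bracket therefore removes exactly one coset from the
  support.\<close>

lemma bracket_inv_left:
  assumes "f \<in> ind" "d \<in> carrier G" "g \<in> carrier G" "g \<otimes> inv d \<in> K"
  shows "bracket (inv d) (f d) g = f g"
proof -
  have "f (g \<otimes> inv d \<otimes> d) = \<sigma> (g \<otimes> inv d) (f d)" using assms(1,2,4) unfolding compact_ind_def by blast
  then show ?thesis using assms by (simp add: bracket_def m_assoc)
qed

text \<open>The translate of \<open>[1, x]\<close> by \<open>i a^(-m)\<close> is supported in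
  \<open>K a^m B\<close>. So \<open>m\<close> is the exponent of the double coset, and it appears
  with the opposite sign in the group element.\<close>

definition gens :: "int set \<Rightarrow> 'v set" where
  "gens M = {\<pi> (i \<otimes> a [^] (- m)) (j x) | i m x. i \<in> B \<and> m \<in> M \<and> x \<in> W}"

lemma gensI: "i \<in> B \<Longrightarrow> m \<in> M \<Longrightarrow> x \<in> W \<Longrightarrow> \<pi> (i \<otimes> a [^] (- m)) (j x) \<in> gens M"
  unfolding gens_def by blast

text \<open>Induction on a finite set of representatives of the cosets \<open>K d\<close> that meet
  the support; each step splits off the part of \<open>f\<close> living on one coset.\<close>

lemma phi_finite_support:
  assumes "finite D" "D \<subseteq> carrier G" "f \<in> ind"
    and "\<And>g. f g \<noteq> 0 \<Longrightarrow> \<exists>d\<in>D. g \<otimes> inv d \<in> K"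
    and "\<And>g. f g \<noteq> 0 \<Longrightarrow> \<exists>k\<in>K. \<exists>i\<in>B. g = k \<otimes> a [^] m \<otimes> i"
  shows "\<phi> f \<in> addspan (gens {m})"
  using assms
proof (induction D arbitrary: f rule: finite_induct)
  case empty
  then have "f = (\<lambda>g. 0)" by auto
  then show ?case by (simp add: phi_zero)
next
  case (insert d D)
  have d: "d \<in> carrier G" using insert.prems(1) by simp
  have suppG: "g \<in> carrier G" if "f g \<noteq> 0" for g using insert.prems(2) that unfolding compact_ind_def by blast
  show ?case
  proof (cases "f d = 0")
    case True
    have "\<exists>d\<in>D. g \<otimes> inv d \<in> K" if fg: "f g \<noteq> 0" for g
    proof -
      have "g \<otimes> inv d \<notin> K"
      proof
        assume "g \<otimes> inv d \<in> K"
        then have "bracket (inv d) 0 g = f g" using bracket_inv_left insert.prems(2) d suppG[OF fg] True by metis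
        then show False using fg sigma_zero by (simp add: bracket_def split: if_splits)
      qed
      then show ?thesis using insert.prems(3)[OF fg] by blast
    qed
    then show ?thesis using insert.IH[of f] insert.prems by blast
  next
    case False
    obtain k i where ki: "k \<in> K" "i \<in> B" "d = k \<otimes> a [^] m \<otimes> i" using insert.prems(4)[OF False] by blast
    have x: "f d \<in> W" using insert.prems(2) d by (simp add: compact_ind_def)
    let ?b = "bracket (inv d) (f d)"
    define f2 where "f2 = (\<lambda>g. f g + bracket (inv d) (- f d) g)"
    have f2: "f2 \<in> ind" unfolding f2_def using ind_add[OF insert.prems(2) bracket_in_ind] d x W_uminus by simp
    have f2': "f2 g = f g \<and> \<not> g \<otimes> inv d \<in> K" if "f2 g \<noteq> 0" for g
    proof -
      have "g \<in> carrier G" using f2 that by (auto simp: compact_ind_def)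
      moreover have "\<not> g \<otimes> inv d \<in> K"
        using that bracket_inv_left[OF insert.prems(2) d calculation] by (auto simp: f2_def bracket_uminus x)
      ultimately show ?thesis by (simp add: f2_def bracket_def)
    qed
    have "\<phi> f2 \<in> addspan (gens {m})"
    proof (rule insert.IH[OF _ f2])
      show "\<exists>d\<in>D. g \<otimes> inv d \<in> K" if g: "f2 g \<noteq> 0" for g
        using f2'[OF g] g insert.prems(3)[of g] by auto
      show "\<exists>k\<in>K. \<exists>i\<in>B. g = k \<otimes> a [^] m \<otimes> i" if g: "f2 g \<noteq> 0" for g
        using f2'[OF g] g insert.prems(4)[of g] by auto
    qed (use insert.prems in auto)
    moreover have "\<phi> ?b \<in> gens {m}"
    proof -
      have c: "k \<in> carrier G" "i \<in> carrier G" "a [^] m \<in> carrier G"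
        using ki K_carrier B_carrier a_carrier by auto
      \<comment> \<open>Inverting \<open>d = k a^m i\<close> puts the factor from \<open>K\<close>
        on the right, where it is absorbed into the vector of the weight; what remains has the form
        required by \<open>gens\<close>.\<close>
      have "inv d = (inv i \<otimes> a [^] (- m)) \<otimes> inv k"
        using c a_carrier by (simp add: ki(3) inv_mult_group m_assoc int_pow_neg)
      then have "\<pi> (inv d) (j (f d)) = \<pi> (inv i \<otimes> a [^] (- m)) (\<pi> (inv k) (j (f d)))"
        using c a_carrier by (simp add: pi_mult)
      also have "\<pi> (inv k) (j (f d)) = j (\<sigma> (inv k) (f d))" using j_sigma[of "inv k"] ki x by simp
      finally show ?thesis
        using gensI[of "inv i" m "{m}"] ki x sigma_closed d by (simp add: phi_bracket)
    qed
    moreover have "\<phi> f = \<phi> ?b + \<phi> f2"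
    proof -
      have "f = (\<lambda>g. ?b g + f2 g)" by (simp add: f2_def bracket_uminus[OF x])
      then have "\<phi> f = \<phi> (\<lambda>g. ?b g + f2 g)" by (rule arg_cong)
      then show ?thesis using phi_add[OF bracket_in_ind f2] d x by simp
    qed
    ultimately show ?thesis by (simp add: addspan.plus)
  qed
qed

lemma double_coset_iff:
  "g \<in> (K #> (a [^] (m::int))) <#> B \<longleftrightarrow> (\<exists>k\<in>K. \<exists>i\<in>B. g = k \<otimes> a [^] m \<otimes> i)"
  by (auto simp: r_coset_def set_mult_def)

text \<open>The cosets \<open>K c\<close> are open and cover the compact support, so finitely many
  of them suffice.\<close>

lemma phi_supported:
  assumes "f \<in> supported_ind G K B a m W \<sigma>"
  shows "\<phi> f \<in> addspan (gens {m})"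
proof -
  have f: "f \<in> ind" and supp: "\<And>g. f g \<noteq> 0 \<Longrightarrow> \<exists>k\<in>K. \<exists>i\<in>B. g = k \<otimes> a [^] m \<otimes> i"
    using assms by (auto simp: supported_ind_def double_coset_iff)
  obtain C where C: "compact C" "C \<subseteq> carrier G" "\<And>g. f g \<noteq> 0 \<Longrightarrow> g \<in> C"
    using f unfolding compact_ind_def by blast
  have "\<forall>c\<in>C. \<exists>T. open T \<and> {g \<in> carrier G. g \<otimes> inv c \<in> K} = carrier G \<inter> T"
  proof
    fix c assume "c \<in> C"
    then have "op {g \<in> carrier G. g \<otimes> inv c \<in> K}" using op_right[OF op_K] C(2) by auto
    then show "\<exists>T. open T \<and> {g \<in> carrier G. g \<otimes> inv c \<in> K} = carrier G \<inter> T"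
      by (simp only: openin_open)
  qed
  then have "\<exists>T. \<forall>c\<in>C. open (T c) \<and> {g \<in> carrier G. g \<otimes> inv c \<in> K} = carrier G \<inter> T c"
    by (rule bchoice)
  then obtain T where T0: "\<forall>c\<in>C. open (T c) \<and>
      {g \<in> carrier G. g \<otimes> inv c \<in> K} = carrier G \<inter> T c" by (rule exE) (rule that)
  have T: "open (T c)" "{g \<in> carrier G. g \<otimes> inv c \<in> K} = carrier G \<inter> T c" if "c \<in> C" for c
    using bspec[OF T0 that] by (rule conjunct1, rule conjunct2)
  have cov: "C \<subseteq> (\<Union>c\<in>C. T c)"
  proof
    fix c assume c: "c \<in> C"
    then have "c \<in> {g \<in> carrier G. g \<otimes> inv c \<in> K}" using C(2) by auto
    then show "c \<in> (\<Union>c\<in>C. T c)" using T(2)[OF c] c by blast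
  qed
  obtain D where D: "D \<subseteq> C" "finite D" "C \<subseteq> (\<Union>c\<in>D. T c)"
    using compactE_image[OF C(1) T(1) cov] by blast
  show ?thesis
  proof (rule phi_finite_support[OF D(2) _ f _ supp])
    show "D \<subseteq> carrier G" using D C by blast
    fix g assume "f g \<noteq> 0"
    then have g: "g \<in> C" "g \<in> carrier G" using C by auto
    then obtain c where "c \<in> D" "g \<in> T c" using D by blast
    then show "\<exists>d\<in>D. g \<otimes> inv d \<in> K" using T(2)[of c] D g by blast
  qed
qed

lemma supported_zero: "(\<lambda>g. 0) \<in> supported_ind G K B a m W \<sigma>"
  by (simp add: supported_ind_def ind_zero)

lemma supported_add:
  "f \<in> supported_ind G K B a m W \<sigma> \<Longrightarrow> f' \<in> supported_ind G K B a m W \<sigma> \<Longrightarrow>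
    (\<lambda>g. f g + f' g) \<in> supported_ind G K B a m W \<sigma>"
  (is "f \<in> ?S \<Longrightarrow> f' \<in> ?S \<Longrightarrow> _")
proof -
  assume f: "f \<in> ?S" and f': "f' \<in> ?S"
  have "f g \<noteq> 0 \<or> f' g \<noteq> 0" if "f g + f' g \<noteq> 0" for g using that by auto
  then show "(\<lambda>g. f g + f' g) \<in> ?S"
    using f f' ind_add[of f f'] unfolding supported_ind_def mem_Collect_eq by blast
qed

lemma bracket_supported:
  assumes "i \<in> B" "x \<in> W"
  shows "bracket (i \<otimes> a [^] (- m)) x \<in> supported_ind G K B a m W \<sigma>"
proof -
  have c: "i \<in> carrier G" "a [^] m \<in> carrier G" using assms B_carrier a_carrier by auto
  have "\<exists>k\<in>K. \<exists>i\<in>B. g = k \<otimes> a [^] m \<otimes> i" if "bracket (i \<otimes> a [^] (- m)) x g \<noteq> 0" for g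
  proof -
    have g: "g \<in> carrier G" "g \<otimes> (i \<otimes> a [^] (- m)) \<in> K"
      using that by (auto simp: bracket_def split: if_splits)
    have "g = (g \<otimes> (i \<otimes> a [^] (- m))) \<otimes> a [^] m \<otimes> inv i"
      using c g(1) a_carrier by (simp add: m_assoc int_pow_neg inv_cancel_assoc)
    then show ?thesis using g(2) assms(1) by blast
  qed
  then show ?thesis
    using bracket_in_ind[OF _ assms(2), of "i \<otimes> a [^] (- m)"] c a_carrier
    by (simp add: supported_ind_def double_coset_iff)
qed

text \<open>The sequence of exponents is left arbitrary so that \<open>I_plus\<close> and
  \<open>I_minus\<close> are both instances, with exponents \<open>n\<close> and
  \<open>- (n + 1)\<close>.\<close>

lemma image_phi:
  fixes m :: "nat \<Rightarrow> int"
  shows "\<phi> ` {\<lambda>g. \<Sum>n<N. r n g | N r. \<forall>n<N. r n \<in> supported_ind G K B a (m n) W \<sigma>} =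
    addspan (gens (range m))" (is "\<phi> ` ?J = _")
proof (intro equalityI subsetI)
  fix y assume "y \<in> \<phi> ` ?J"
  then obtain f where "f \<in> ?J" and yf: "y = \<phi> f" by (rule imageE)
  then obtain N r where f: "f = (\<lambda>g. \<Sum>n<N. r n g)"
    and r: "\<forall>n<N. r n \<in> supported_ind G K B a (m n) W \<sigma>"
    unfolding mem_Collect_eq by (elim exE conjE) (rule that; assumption)
  have y: "y = \<phi> (\<lambda>g. \<Sum>n<N. r n g)" unfolding yf f ..
  have "(\<lambda>g. \<Sum>n<N. r n g) \<in> ind \<and> \<phi> (\<lambda>g. \<Sum>n<N. r n g) \<in> addspan (gens (range m))"
    using r
  proof (induction N)
    case 0
    then show ?case using ind_zero phi_zero by simp
  next
    case (Suc N)
    have rN: "r N \<in> ind" "\<phi> (r N) \<in> addspan (gens {m N})"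
      using Suc.prems phi_supported by (auto simp: supported_ind_def)
    have "gens {m N} \<subseteq> gens (range m)" unfolding gens_def by blast
    then have "gens {m N} \<subseteq> addspan (gens (range m))" using addspan_base by blast
    then have "\<phi> (r N) \<in> addspan (gens (range m))" using rN(2) addspan_subset by blast
    then show ?case using Suc rN(1) by (simp add: ind_add phi_add addspan_add)
  qed
  then show "y \<in> addspan (gens (range m))" using y by simp
next
  fix y assume "y \<in> addspan (gens (range m))"
  then show "y \<in> \<phi> ` ?J"
  proof induction
    case zero
    have "(\<lambda>g. 0) \<in> ?J" by (rule CollectI, intro exI[of _ 0] exI[of _ "\<lambda>_ _. 0"]) simp
    from image_eqI[where f = \<phi>, OF phi_zero[symmetric] this] show ?case .
  next
    case (plus z y)
    obtain i n x where z: "i \<in> B" "x \<in> W" "z = \<pi> (i \<otimes> a [^] (- m n)) (j x)"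
      using plus(1) by (auto simp: gens_def)
    from plus(3) obtain f where "f \<in> ?J" and yf: "y = \<phi> f" by (rule imageE)
    then obtain N r where f: "f = (\<lambda>g. \<Sum>n<N. r n g)"
      and r: "\<forall>n<N. r n \<in> supported_ind G K B a (m n) W \<sigma>"
      unfolding mem_Collect_eq by (elim exE conjE) (rule that; assumption)
    have y: "y = \<phi> (\<lambda>g. \<Sum>n<N. r n g)" unfolding yf f ..
    let ?b = "bracket (i \<otimes> a [^] (- m n)) x"
    have b: "?b \<in> supported_ind G K B a (m n) W \<sigma>" using bracket_supported z by blast
    \<comment> \<open>The new bracket must enter the slot \<open>n\<close> of its own double coset,
      which may be occupied already or lie beyond \<open>N\<close>. Padding by zero covers both
      cases.\<close>
    define r' where "r' k = (\<lambda>g. (if k = n then ?b g else 0) + (if k < N then r k g else 0))" for k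
    have r': "r' k \<in> supported_ind G K B a (m k) W \<sigma>" for k
      unfolding r'_def
      by (rule supported_add) (use b r supported_zero in \<open>cases "k = n"; cases "k < N"; simp\<close>)+
    have "(\<Sum>k<max N (Suc n). r' k g) = ?b g + (\<Sum>n<N. r n g)" for g
    proof -
      have "(\<Sum>k<max N (Suc n). if k < N then r k g else 0) = (\<Sum>k<N. r k g)"
        by (rule sum.mono_neutral_cong_right) auto
      moreover have "n < max N (Suc n)" by simp
      ultimately show ?thesis by (simp add: r'_def sum.distrib)
    qed
    then have "(\<lambda>g. ?b g + (\<Sum>n<N. r n g)) = (\<lambda>g. \<Sum>k<max N (Suc n). r' k g)" by simp
    then have mem: "(\<lambda>g. ?b g + (\<Sum>n<N. r n g)) \<in> ?J"
      unfolding mem_Collect_eq using r' by (intro exI conjI) auto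
    have sum_ind: "(\<lambda>g. \<Sum>n<N. r n g) \<in> ind" using r
    proof (induction N)
      case (Suc N)
      then show ?case using ind_add[of "\<lambda>g. \<Sum>n<N. r n g" "r N"] by (simp add: supported_ind_def)
    qed (simp add: ind_zero)
    have "\<phi> (\<lambda>g. ?b g + (\<Sum>n<N. r n g)) = z + y"
      using phi_add[OF _ sum_ind, of ?b] b phi_bracket[of "i \<otimes> a [^] (- m n)" x] z y B_carrier a_carrier
      by (simp add: supported_ind_def)
    from image_eqI[where f = \<phi>, OF this[symmetric] mem] show ?case .
  qed
qed

lemma image_I_plus: "\<phi> ` I_plus G K B a W \<sigma> = addspan (gens {0..})"
proof -
  have "range int = {0..}" by (auto simp: image_iff) (metis nonneg_int_cases)
  then show ?thesis using image_phi[of int] by (simp add: I_plus_def)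
qed

lemma image_I_minus: "\<phi> ` I_minus G K B a W \<sigma> = addspan (gens {..<0})"
proof -
  have "range (\<lambda>n. - (int n + 1)) = {..<0}"
  proof (intro equalityI subsetI)
    fix x :: int assume "x \<in> {..<0}"
    then show "x \<in> range (\<lambda>n. - (int n + 1))" by (intro range_eqI[of _ _ "nat (- x - 1)"]) auto
  qed auto
  then show ?thesis using image_phi[of "\<lambda>n. - (int n + 1)"] by (simp add: I_minus_def)
qed

section \<open>Stability of the two spans\<close>

lemma pi_absorb:
  "g \<in> carrier G \<Longrightarrow> k \<in> K \<Longrightarrow> x \<in> W \<Longrightarrow> \<pi> (g \<otimes> k) (j x) = \<pi> g (j (\<sigma> k x))"
  using K_carrier by (simp add: pi_mult j_sigma)

lemma gensE:
  assumes "y \<in> gens M"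
  obtains i x and m :: int where "i \<in> B" "m \<in> M" "x \<in> W" "y = \<pi> (i \<otimes> a [^] (- m)) (j x)"
  using assms unfolding gens_def mem_Collect_eq by (elim exE conjE) (rule that)

text \<open>\<open>addspan\<close> itself provides no scalars; they come from the generators, whose
  vectors run through the whole subspace \<open>W\<close>.\<close>

lemma gens_scale: "y \<in> gens M \<Longrightarrow> scl c y \<in> gens M"
proof -
  assume "y \<in> gens M"
  then obtain i x and m :: int where y: "i \<in> B" "m \<in> M" "x \<in> W" "y = \<pi> (i \<otimes> a [^] (- m)) (j x)"
    by (rule gensE)
  then have "scl c y = \<pi> (i \<otimes> a [^] (- m)) (j (scl c x))"
    using B_carrier a_carrier by (simp add: pi_scale j_scale)
  then show ?thesis using gensI[OF y(1,2) W_scale[OF y(3)]] by simp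
qed

lemma addspan_gens_scale: "y \<in> addspan (gens M) \<Longrightarrow> scl c y \<in> addspan (gens M)"
  by (rule addspan_image) (auto simp: scale_right_distrib intro: addspan_base gens_scale)

text \<open>A normal form with \<open>P\<close> in place of \<open>B\<close>: write
  \<open>i = u l\<close> and move \<open>l\<close> to the right past \<open>a^(-n)\<close>. It
  becomes an element of \<open>Q\<close>, hence of \<open>K\<close>, and is absorbed into the
  vector.\<close>

lemma gens_plusE:
  assumes "y \<in> gens {0..}"
  obtains u x and n :: nat where "u \<in> P" "x \<in> W" "y = \<pi> (u \<otimes> inv (a [^] n)) (j x)"
proof -
  obtain i x and m :: int where y: "i \<in> B" "m \<in> {0..}" "x \<in> W" "y = \<pi> (i \<otimes> a [^] (- m)) (j x)"
    using assms by (rule gensE)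
  obtain n where n: "m = int n" using y(2) nonneg_int_cases by auto
  obtain u l where ul: "u \<in> P" "l \<in> Q" "i = u \<otimes> l" using factor_PQ[OF y(1)] by blast
  note c = P_carrier[OF ul(1)] Q_carrier[OF ul(2)] apow_carrier[of n]
  have k: "a [^] n \<otimes> l \<otimes> inv (a [^] n) \<in> K" using Q_contract_pow[OF ul(2)] Q_subset B_K by blast
  have "i \<otimes> a [^] (- m) = (u \<otimes> inv (a [^] n)) \<otimes> (a [^] n \<otimes> l \<otimes> inv (a [^] n))"
    using c a_carrier by (simp add: n ul(3) int_pow_neg_int m_assoc inv_cancel_assoc)
  then have "y = \<pi> (u \<otimes> inv (a [^] n)) (j (\<sigma> (a [^] n \<otimes> l \<otimes> inv (a [^] n)) x))"
    using pi_absorb[OF _ k y(3)] c by (simp add: y(4))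
  then show thesis using that ul(1) sigma_closed[OF k y(3)] by blast
qed

text \<open>The mirror image of \<open>gens_plusE\<close>: now \<open>u\<close> is moved to the
  right past a positive power of \<open>a\<close>. The exponent \<open>Suc n\<close> records that it
  is at least one.\<close>

lemma gens_minusE:
  assumes "y \<in> gens {..<0}"
  obtains l x and n :: nat where "l \<in> Q" "x \<in> W" "y = \<pi> (l \<otimes> a [^] Suc n) (j x)"
proof -
  obtain i x and m :: int where y: "i \<in> B" "m \<in> {..<0}" "x \<in> W" "y = \<pi> (i \<otimes> a [^] (- m)) (j x)"
    using assms by (rule gensE)
  have "- m = int (Suc (nat (- m - 1)))" using y(2) by auto
  then obtain n where n: "- m = int (Suc n)" ..
  obtain l u where ul: "u \<in> P" "l \<in> Q" "i = l \<otimes> u" using factor_QP[OF y(1)] by blast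
  define b where "b = a [^] Suc n"
  have c: "u \<in> carrier G" "l \<in> carrier G" "b \<in> carrier G"
    using P_carrier[OF ul(1)] Q_carrier[OF ul(2)] by (simp_all add: b_def a_carrier)
  have k: "inv b \<otimes> u \<otimes> b \<in> K"
    using P_contract_pow[OF ul(1), of "Suc n"] P_subset B_K unfolding b_def by blast
  have "a [^] (- m) = b" unfolding n b_def by (rule int_pow_int)
  then have "i \<otimes> a [^] (- m) = (l \<otimes> b) \<otimes> (inv b \<otimes> u \<otimes> b)"
    using c by (simp add: ul(3) m_assoc inv_cancel_assoc)
  then have "y = \<pi> (l \<otimes> b) (j (\<sigma> (inv b \<otimes> u \<otimes> b) x))"
    using pi_absorb[OF _ k y(3)] c by (simp add: y(4))
  then show thesis using that ul(2) sigma_closed[OF k y(3)] unfolding b_def by blast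
qed

lemma gens_plusI:
  "i \<in> B \<Longrightarrow> x \<in> W \<Longrightarrow> \<pi> (i \<otimes> inv (a [^] (n::nat))) (j x) \<in> gens {0..}"
  using gensI[of i "int n" "{0..}" x] by (simp add: int_pow_neg_int a_carrier)

lemma gens_minusI:
  "i \<in> B \<Longrightarrow> x \<in> W \<Longrightarrow> \<pi> (i \<otimes> a [^] Suc n) (j x) \<in> gens {..<0}"
  using gensI[of i "- int (Suc n)" "{..<0}" x] by (simp only: int_pow_int minus_minus) simp

lemma span_B:
  assumes "b \<in> B" "y \<in> addspan (gens M)"
  shows "\<pi> b y \<in> addspan (gens M)"
  using assms(2)
proof (rule addspan_image)
  have c: "b \<in> carrier G" using assms B_carrier by blast
  then show "\<pi> b (y + z) = \<pi> b y + \<pi> b z" for y z by (rule pi_add)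
  fix y assume "y \<in> gens M"
  then obtain i x and m :: int where y: "i \<in> B" "m \<in> M" "x \<in> W" "y = \<pi> (i \<otimes> a [^] (- m)) (j x)"
    by (rule gensE)
  then have "\<pi> b y = \<pi> ((b \<otimes> i) \<otimes> a [^] (- m)) (j x)"
    using c B_carrier a_carrier by (simp add: pi_mult)
  then show "\<pi> b y \<in> addspan (gens M)"
    using gensI[of "b \<otimes> i" m M x] y assms(1) by (auto intro: addspan_base)
qed

text \<open>Because \<open>s\<close> inverts \<open>a\<close>, one has
  \<open>s l a^(n+1) = (s l s) a^(-(n+1)) s\<close>; the first factor is in \<open>B\<close> by
  \<open>s_Q_s\<close>, and the last \<open>s\<close> is absorbed into the weight.\<close>

lemma span_s:
  assumes "y \<in> addspan (gens {..<0})"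
  shows "\<pi> s y \<in> addspan (gens {0..})"
  using assms
proof (rule addspan_image)
  show "\<pi> s (y + z) = \<pi> s y + \<pi> s z" for y z by (rule pi_add[OF s_carrier])
  fix y assume "y \<in> gens {..<0}"
  then obtain l x and n :: nat where y: "l \<in> Q" "x \<in> W" "y = \<pi> (l \<otimes> a [^] Suc n) (j x)" by (rule gens_minusE)
  note c = s_carrier Q_carrier[OF y(1)]
  have "\<pi> s y = \<pi> (s \<otimes> (l \<otimes> a [^] Suc n)) (j x)" using c a_carrier by (simp add: y(3) pi_mult)
  also have "s \<otimes> (l \<otimes> a [^] Suc n) = (s \<otimes> l \<otimes> s) \<otimes> (s \<otimes> a [^] Suc n)"
    using c a_carrier by (simp add: m_assoc s_cancel)
  also have "\<dots> = ((s \<otimes> l \<otimes> s) \<otimes> inv (a [^] Suc n)) \<otimes> s"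
    unfolding s_apow using c a_carrier by (simp add: m_assoc)
  also have "\<pi> \<dots> (j x) = \<pi> ((s \<otimes> l \<otimes> s) \<otimes> inv (a [^] Suc n)) (j (\<sigma> s x))"
    using c a_carrier y(2) s_in_K by (intro pi_absorb) auto
  finally show "\<pi> s y \<in> addspan (gens {0..})"
    using gens_plusI[OF s_Q_s[OF y(1)] sigma_closed[OF s_in_K y(2)], of "Suc n"] by (simp add: addspan_base)
qed

lemma span_inv_a:
  assumes "y \<in> addspan (gens {0..})"
  shows "\<pi> (inv a) y \<in> addspan (gens {0..})"
  using assms
proof (rule addspan_image)
  show "\<pi> (inv a) (y + z) = \<pi> (inv a) y + \<pi> (inv a) z" for y z by (rule pi_add) (simp add: a_carrier)
  fix y assume "y \<in> gens {0..}"
  then obtain u x and n :: nat where y: "u \<in> P" "x \<in> W" "y = \<pi> (u \<otimes> inv (a [^] n)) (j x)" by (rule gens_plusE)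
  note c = a_carrier P_carrier[OF y(1)]
  have "\<pi> (inv a) y = \<pi> (inv a \<otimes> (u \<otimes> inv (a [^] n))) (j x)" using c by (simp add: y(3) pi_mult)
  also have "inv a \<otimes> (u \<otimes> inv (a [^] n)) = (inv a \<otimes> u \<otimes> a) \<otimes> inv (a [^] Suc n)"
    using c by (simp add: m_assoc inv_mult_group inv_cancel_assoc)
  finally show "\<pi> (inv a) y \<in> addspan (gens {0..})"
    using gens_plusI[of "inv a \<otimes> u \<otimes> a" x "Suc n"] P_contract[OF y(1)] P_subset y(2)
    by (simp add: addspan_base subset_iff)
qed

lemma span_a:
  assumes "y \<in> addspan (gens {..<0})"
  shows "\<pi> a y \<in> addspan (gens {..<0})"
  using assms
proof (rule addspan_image)
  show "\<pi> a (y + z) = \<pi> a y + \<pi> a z" for y z by (rule pi_add[OF a_carrier])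
  fix y assume "y \<in> gens {..<0}"
  then obtain l x and n :: nat where y: "l \<in> Q" "x \<in> W" "y = \<pi> (l \<otimes> a [^] Suc n) (j x)" by (rule gens_minusE)
  note c = a_carrier Q_carrier[OF y(1)]
  have "\<pi> a y = \<pi> (a \<otimes> (l \<otimes> a [^] Suc n)) (j x)" using c by (simp add: y(3) pi_mult)
  also have "a \<otimes> (l \<otimes> a [^] Suc n) = (a \<otimes> l \<otimes> inv a) \<otimes> (a \<otimes> a [^] Suc n)"
    using c by (simp add: m_assoc inv_cancel_assoc)
  also have "a \<otimes> a [^] Suc n = a [^] Suc (Suc n)" by (rule nat_pow_Suc2[OF a_carrier, symmetric])
  finally show "\<pi> a y \<in> addspan (gens {..<0})"
    using gens_minusI[of "a \<otimes> l \<otimes> inv a" x "Suc n"] Q_contract[OF y(1)] Q_subset y(2)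
    by (simp add: addspan_base subset_iff)
qed

text \<open>With \<open>b\<close> the conjugate of \<open>s u s\<close> by \<open>a\<close>, one has
  \<open>a s u a^(-n) = b a^(n+1) s\<close>. The extra factor \<open>a\<close> makes the exponent
  positive even for \<open>n = 0\<close>, as the second span requires.\<close>

lemma span_a_s:
  assumes "y \<in> addspan (gens {0..})"
  shows "\<pi> (a \<otimes> s) y \<in> addspan (gens {..<0})"
  using assms
proof (rule addspan_image)
  show "\<pi> (a \<otimes> s) (y + z) = \<pi> (a \<otimes> s) y + \<pi> (a \<otimes> s) z" for y z
    by (rule pi_add) (simp add: a_carrier s_carrier)
  fix y assume "y \<in> gens {0..}"
  then obtain u x and n :: nat where y: "u \<in> P" "x \<in> W" "y = \<pi> (u \<otimes> inv (a [^] n)) (j x)" by (rule gens_plusE)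
  note c = a_carrier s_carrier P_carrier[OF y(1)]
  let ?b = "a \<otimes> (s \<otimes> u \<otimes> s) \<otimes> inv a"
  have "\<pi> (a \<otimes> s) y = \<pi> (a \<otimes> s \<otimes> (u \<otimes> inv (a [^] n))) (j x)" using c by (simp add: y(3) pi_mult)
  also have "a \<otimes> s \<otimes> (u \<otimes> inv (a [^] n)) = ?b \<otimes> (a \<otimes> (s \<otimes> inv (a [^] n)))"
    using c by (simp add: m_assoc inv_cancel_assoc s_cancel)
  also have "\<dots> = (?b \<otimes> (a \<otimes> a [^] n)) \<otimes> s"
    unfolding s_inv_apow using c by (simp add: m_assoc)
  also have "a \<otimes> a [^] n = a [^] Suc n" by (rule nat_pow_Suc2[OF a_carrier, symmetric])
  also have "\<pi> (?b \<otimes> a [^] Suc n \<otimes> s) (j x) = \<pi> (?b \<otimes> a [^] Suc n) (j (\<sigma> s x))"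
    using c y(2) s_in_K by (intro pi_absorb) auto
  finally show "\<pi> (a \<otimes> s) y \<in> addspan (gens {..<0})"
    using gens_minusI[OF as_P_sa[OF y(1)] sigma_closed[OF s_in_K y(2)], of n] by (simp only: addspan_base)
qed

lemma span_inv_apow: "y \<in> addspan (gens {0..}) \<Longrightarrow> \<pi> (inv (a [^] (n::nat))) y \<in> addspan (gens {0..})"
proof (induction n)
  case (Suc n)
  have "\<pi> (inv (a [^] Suc n)) y = \<pi> (inv a) (\<pi> (inv (a [^] n)) y)"
    using a_carrier by (simp add: inv_mult_group pi_mult)
  then show ?case using span_inv_a[OF Suc.IH[OF Suc.prems]] by simp
qed (simp add: pi_one)

lemma span_apow: "y \<in> addspan (gens {..<0}) \<Longrightarrow> \<pi> (a [^] (n::nat)) y \<in> addspan (gens {..<0})"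
proof (induction n)
  case (Suc n)
  have "\<pi> (a [^] Suc n) y = \<pi> a (\<pi> (a [^] n) y)"
    unfolding nat_pow_Suc2[OF a_carrier] using a_carrier by (simp add: pi_mult)
  then show ?case using span_a[OF Suc.IH[OF Suc.prems]] by simp
qed (simp add: pi_one)

lemma span_K:
  assumes "k \<in> K" "v \<in> addspan (gens {0..})" "v \<in> addspan (gens {..<0})"
  shows "\<pi> k v \<in> addspan (gens {0..})"
proof -
  consider "k \<in> B" | u b where "u \<in> U" "b \<in> B" "k = u \<otimes> s \<otimes> b" using bruhat[OF assms(1)] by blast
  then show ?thesis
  proof cases
    case 1
    then show ?thesis using span_B assms(2) by blast
  next
    case 2
    then have "\<pi> k v = \<pi> u (\<pi> s (\<pi> b v))" using U_carrier B_carrier s_carrier by (simp add: pi_mult m_assoc)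
    then show ?thesis using span_B[OF U_B[OF 2(1)] span_s[OF span_B[OF 2(2) assms(3)]]] by simp
  qed
qed

end

text \<open>The vector \<open>v\<close> links the two weights: it comes from the first one and lies
  in both spans of the second. Irreducibility is used for the first weight, so the inclusion is
  one-sided and is applied twice in the end.\<close>

lemma span_le:
  fixes scl :: "'k::field \<Rightarrow> 'v::ab_group_add \<Rightarrow> 'v"
  assumes 1: "induced_map G p K B U Kp s a P Q scl \<pi> W \<sigma> j \<phi>"
    and 2: "induced_map G p K B U Kp s a P Q scl \<pi> W' \<sigma>' j' \<phi>'"
    and irr: "irreducible_smooth_rep scl (G\<lparr>carrier := K\<rparr>) W \<sigma>"
    and v: "v \<in> j ` W" "v \<noteq> 0" "v \<in> \<phi>' ` I_plus G K B a W' \<sigma>'" "v \<in> \<phi>' ` I_minus G K B a W' \<sigma>'"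
  shows "\<phi> ` I_plus G K B a W \<sigma> \<inter> \<phi> ` I_minus G K B a W \<sigma> \<subseteq>
         \<phi>' ` I_plus G K B a W' \<sigma>' \<inter> \<phi>' ` I_minus G K B a W' \<sigma>'"
proof -
  interpret A: induced_map G p K B U Kp s a P Q scl \<pi> W \<sigma> j \<phi> by fact
  interpret A': induced_map G p K B U Kp s a P Q scl \<pi> W' \<sigma>' j' \<phi>' by fact
  note [simp] = A.image_I_plus A'.image_I_plus A.image_I_minus A'.image_I_minus
  let ?A = "addspan (A'.gens {0..})" and ?B = "addspan (A'.gens {..<0})"
  \<comment> \<open>Asking for the whole \<open>K\<close>-orbit makes \<open>D\<close> stable under
    \<open>K\<close> by construction, while the span \<open>?A\<close> has only been shown to be
    stable under \<open>B\<close> and \<open>inv a\<close>.\<close>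
  define D where "D = {x \<in> W. \<forall>k\<in>K. \<pi> k (j x) \<in> ?A}"
  have "A.subspace D" unfolding A.subspace_def
  proof (intro conjI ballI allI)
    show "0 \<in> D"
      using A.W_zero A.pi_add[of _ 0 0] A.K_carrier by (auto simp: D_def A.j_zero)
    show "x + y \<in> D" if "x \<in> D" "y \<in> D" for x y
      using that A.W_add A.K_carrier by (auto simp: D_def A.j_add A.pi_add intro: addspan_add)
    show "scl c x \<in> D" if "x \<in> D" for c x
      using that A.W_scale A.K_carrier by (auto simp: D_def A.j_scale A.pi_scale intro: A'.addspan_gens_scale)
  qed
  moreover have "\<sigma> g x \<in> D" if g: "g \<in> K" and x: "x \<in> D" for g x
  proof -
    have xW: "x \<in> W" using x by (simp add: D_def)
    have "\<pi> k (j (\<sigma> g x)) \<in> ?A" if k: "k \<in> K" for k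
    proof -
      have "\<pi> k (j (\<sigma> g x)) = \<pi> (k \<otimes>\<^bsub>G\<^esub> g) (j x)"
        using A.pi_absorb[OF A.K_carrier[OF k] g xW] by simp
      then show ?thesis using x A.K_closed(2)[OF k g] by (simp add: D_def)
    qed
    then show ?thesis using A.sigma_closed[OF g xW] by (simp add: D_def)
  qed
  moreover have "D \<noteq> {0}"
  proof -
    obtain x where x: "x \<in> W" "v = j x" using v(1) by blast
    then have "x \<noteq> 0" using v(2) A.j_zero by auto
    moreover have "x \<in> D" using x v(3,4) A'.span_K by (simp add: D_def)
    ultimately show ?thesis by blast
  qed
  moreover have "D \<subseteq> W" by (auto simp: D_def)
  moreover have "A.subspace D \<and> D \<subseteq> W \<and> (\<forall>g\<in>K. \<sigma> g ` D \<subseteq> D) \<Longrightarrow> D = {0} \<or> D = W"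
    using irr unfolding irreducible_smooth_rep_def by simp
  ultimately have "D = W" by blast
  then have jA: "j x \<in> ?A" if "x \<in> W" for x
    using that A.K_closed(1) A.pi_one by (metis (no_types, lifting) D_def mem_Collect_eq)
  have jB: "\<pi> a (j x) \<in> ?B" if x: "x \<in> W" for x
  proof -
    \<comment> \<open>An \<open>s\<close> is inserted twice: \<open>a = (a s) s\<close>. The inner
      one acts on the weight, the outer product carries the first span into the second.\<close>
    have "\<pi> a (j x) = \<pi> (a \<otimes>\<^bsub>G\<^esub> s) (j (\<sigma> s x))"
      using A.pi_absorb[of "a \<otimes>\<^bsub>G\<^esub> s" s x] A.a_carrier A.s_carrier A.s_in_K x
      by (simp add: A.m_assoc A.s_square)
    then show ?thesis using A'.span_a_s jA[OF A.sigma_closed[OF A.s_in_K x]] by simp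
  qed
  have "A.gens {0..} \<subseteq> ?A"
  proof
    fix y assume "y \<in> A.gens {0..}"
    then obtain u x and n :: nat where y: "u \<in> P" "x \<in> W" "y = \<pi> (u \<otimes>\<^bsub>G\<^esub> inv\<^bsub>G\<^esub> (a [^]\<^bsub>G\<^esub> (n::nat))) (j x)"
      by (rule A.gens_plusE)
    then have "y = \<pi> u (\<pi> (inv\<^bsub>G\<^esub> (a [^]\<^bsub>G\<^esub> n)) (j x))"
      using A.P_carrier A.a_carrier by (simp add: A.pi_mult)
    moreover have "u \<in> B" using y(1) A.P_subset by blast
    ultimately show "y \<in> ?A" using A'.span_B A'.span_inv_apow[OF jA[OF y(2)]] by simp
  qed
  moreover have "A.gens {..<0} \<subseteq> ?B"
  proof
    fix y assume "y \<in> A.gens {..<0}"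
    then obtain l x and n :: nat where y: "l \<in> Q" "x \<in> W" "y = \<pi> (l \<otimes>\<^bsub>G\<^esub> a [^]\<^bsub>G\<^esub> Suc n) (j x)"
      by (rule A.gens_minusE)
    then have "y = \<pi> l (\<pi> (a [^]\<^bsub>G\<^esub> n) (\<pi> a (j x)))"
      using A.Q_carrier A.a_carrier by (simp add: A.pi_mult)
    moreover have "l \<in> B" using y(1) A.Q_subset by blast
    ultimately show "y \<in> ?B" using A'.span_B A'.span_apow[OF jB[OF y(2)]] by simp
  qed
  ultimately show ?thesis using addspan_subset by (simp, blast)
qed

section \<open>The absolute value and the Galois conjugation\<close>

abbreviation av :: "'e::{field,metric_space} \<Rightarrow> real" where
  "av x \<equiv> dist x 0"

lemma tendsto_dist_le:
  fixes f :: "'a \<Rightarrow> 'b::metric_space"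
  assumes "\<And>x. dist (f x) l \<le> h x" "(h \<longlongrightarrow> 0) A"
  shows "(f \<longlongrightarrow> l) A"
  unfolding tendsto_dist_iff[of f]
  by (rule tendsto_sandwich[OF _ _ tendsto_const assms(2)]) (simp_all add: assms(1))

locale unramified_extension =
  fixes F :: "'e::{field,metric_space} set" and cj :: "'e \<Rightarrow> 'e" and w :: 'e
  assumes ext: "unramified_quadratic F" and gal: "nontrivial_galois F cj"
    and w_F: "w \<in> F" and unif: "is_uniformizer UNIV w"
begin

lemma nonarch: "nonarch_abs TYPE('e)"
  using ext by (simp add: unramified_quadratic_def nonarch_local_field_def)

lemma dist_av: "dist x y = av (x - y)" for x y :: 'e
  using nonarch by (simp only: nonarch_abs_def)

lemma av_mult: "av (x * y) = av x * av y" for x y :: 'e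
  using nonarch by (simp add: nonarch_abs_def)

lemma av_add: "av (x + y) \<le> max (av x) (av y)" for x y :: 'e
  using nonarch by (simp add: nonarch_abs_def)

lemma av_one [simp]: "av (1::'e) = 1"
  using av_mult[of 1 1] by (metis dist_eq_0_iff mult_cancel_left1 mult_1 one_neq_zero)

lemma av_minus [simp]: "av (- x) = av x" for x :: 'e
proof -
  have "av (- 1 :: 'e) * av (- 1 :: 'e) = av ((- 1 :: 'e) * - 1)" by (rule av_mult[symmetric])
  also have "\<dots> = 1" by simp
  finally have "av (- 1 :: 'e) * av (- 1 :: 'e) = 1" .
  then have "av (- 1 :: 'e) ^ 2 = 1 ^ 2" by (simp add: power2_eq_square)
  then have "av (- 1 :: 'e) = 1" by (rule power2_eq_imp_eq) auto
  then show ?thesis using av_mult[of "- 1" x] by (simp only: mult_minus1 mult_1)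
qed

lemma av_diff: "av (x - y) \<le> max (av x) (av y)" for x y :: 'e
  using av_add[of x "- y"] by simp

lemma av_inverse: "av (inverse x) = inverse (av x)" for x :: 'e
proof (cases "x = 0")
  case False
  then have "av x * av (inverse x) = 1" using av_mult[of x "inverse x"] by simp
  then show ?thesis by (metis inverse_unique)
qed simp

lemma av_divide: "av (x / y) = av x / av y" for x y :: 'e
  by (simp add: divide_inverse av_mult av_inverse)

lemma av_add_le: "av x \<le> c \<Longrightarrow> av y \<le> c \<Longrightarrow> av (x + y) \<le> c" for x y :: 'e
  using av_add[of x y] by linarith

lemma av_add_less: "av x < c \<Longrightarrow> av y < c \<Longrightarrow> av (x + y) < c" for x y :: 'e
  using av_add[of x y] by linarith

text \<open>Otherwise \<open>y = (x + y) - x\<close> would be smaller than itself.\<close>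

lemma av_add_eq: "av x < av y \<Longrightarrow> av (x + y) = av y" for x y :: 'e
  using av_add[of x y] av_diff[of "x + y" x] by (simp add: max_def split: if_splits)

abbreviation q :: real where "q \<equiv> av w"

lemma q_pos: "0 < q" and q_less: "q < 1" 
  using unif by (auto simp: is_uniformizer_def)

lemma w_nonzero: "w \<noteq> 0"
  using q_pos by auto

text \<open>Strict and non-strict bounds become interchangeable, so the maximal ideal and the
  subgroups below can all be described by non-strict inequalities.\<close>

lemma av_discrete: "av x < 1 \<longleftrightarrow> av x \<le> q" for x :: 'e
proof
  assume "av x < 1"
  then obtain y where "av y \<le> 1" "x = w * y" using unif by (auto simp: is_uniformizer_def)
  then show "av x \<le> q" using q_pos by (simp add: av_mult mult_left_le)
qed (use q_less in auto)

lemma int_ring_iff: "x \<in> int_ring \<longleftrightarrow> av x \<le> 1" for x :: 'e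
  by (simp add: int_ring_def)

lemma max_ideal_iff: "x \<in> max_ideal \<longleftrightarrow> av x \<le> q" for x :: 'e
  using av_discrete by (simp add: max_ideal_def)

lemma inv_max_ideal_iff: "x \<in> inv_max_ideal \<longleftrightarrow> av x \<le> 1 / q" for x :: 'e
proof
  assume "x \<in> inv_max_ideal"
  then have "x * w \<in> int_ring" using max_ideal_iff[of w] by (simp add: inv_max_ideal_def)
  then show "av x \<le> 1 / q" using q_pos by (simp add: int_ring_iff av_mult field_simps)
next
  assume x: "av x \<le> 1 / q"
  have "av (x * y) \<le> 1" if "av y \<le> q" for y
    using mult_mono[OF x that] q_pos by (simp add: av_mult)
  then show "x \<in> inv_max_ideal" by (simp add: inv_max_ideal_def int_ring_iff max_ideal_iff)
qed

text \<open>The field operations of \<open>'e\<close> are tied to its metric only by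
  \<open>nonarch_abs\<close>; their continuity is derived from it.\<close>

lemma tendsto_av_add:
  fixes f g :: "'a \<Rightarrow> 'e"
  assumes "(f \<longlongrightarrow> l) A" "(g \<longlongrightarrow> m) A"
  shows "((\<lambda>x. f x + g x) \<longlongrightarrow> l + m) A"
proof -
  have "((\<lambda>x. max (dist (f x) l) (dist (g x) m)) \<longlongrightarrow> max 0 0) A"
    using assms by (intro tendsto_max) (simp_all flip: tendsto_dist_iff)
  then have lim: "((\<lambda>x. max (dist (f x) l) (dist (g x) m)) \<longlongrightarrow> 0) A" by simp
  have "dist (f x + g x) (l + m) \<le> max (dist (f x) l) (dist (g x) m)" for x
  proof -
    have "f x + g x - (l + m) = (f x - l) + (g x - m)" by simp
    then show ?thesis
      using av_add[of "f x - l" "g x - m"] by (simp only: dist_av[of "f x" l] dist_av[of "g x" m] dist_av[of "f x + g x" "l + m"])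
  qed
  then show ?thesis using lim by (rule tendsto_dist_le)
qed

lemma tendsto_av_mult:
  fixes f g :: "'a \<Rightarrow> 'e"
  assumes f: "(f \<longlongrightarrow> l) A" and g: "(g \<longlongrightarrow> m) A"
  shows "((\<lambda>x. f x * g x) \<longlongrightarrow> l * m) A"
proof -
  have 1: "((\<lambda>x. dist (f x) l) \<longlongrightarrow> 0) A" "((\<lambda>x. dist (g x) m) \<longlongrightarrow> 0) A"
    using assms by (simp_all flip: tendsto_dist_iff)
  have "((\<lambda>x. dist (f x) l * av (g x) + av l * dist (g x) m) \<longlongrightarrow> 0 * av m + av l * 0) A"
    by (intro tendsto_add tendsto_mult tendsto_const 1 tendsto_dist g)
  then have lim: "((\<lambda>x. dist (f x) l * av (g x) + av l * dist (g x) m) \<longlongrightarrow> 0) A" by simp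
  have "dist (f x * g x) (l * m) \<le> dist (f x) l * av (g x) + av l * dist (g x) m" for x
  proof -
    have "av (f x * g x - l * m) = av ((f x - l) * g x + l * (g x - m))" by (simp add: algebra_simps)
    also have "\<dots> \<le> max (av ((f x - l) * g x)) (av (l * (g x - m)))" by (rule av_add)
    also have "\<dots> \<le> av (f x - l) * av (g x) + av l * av (g x - m)" by (simp add: av_mult)
    finally show ?thesis
      by (simp only: dist_av[of "f x * g x" "l * m"] dist_av[of "f x" l] dist_av[of "g x" m])
  qed
  then show ?thesis using lim by (rule tendsto_dist_le)
qed

lemma continuous_on_av_add:
  fixes f g :: "'a::topological_space \<Rightarrow> 'e"
  shows "continuous_on S f \<Longrightarrow> continuous_on S g \<Longrightarrow> continuous_on S (\<lambda>x. f x + g x)"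
  by (simp add: continuous_on_def tendsto_av_add)

lemma continuous_on_av_mult:
  fixes f g :: "'a::topological_space \<Rightarrow> 'e"
  shows "continuous_on S f \<Longrightarrow> continuous_on S g \<Longrightarrow> continuous_on S (\<lambda>x. f x * g x)"
  by (simp add: continuous_on_def tendsto_av_mult)

text \<open>Completeness is given. Total boundedness comes from digit expansions: with
  representatives \<open>R\<close> of the finite residue field, sums of \<open>w ^ n * r\<close>
  approximate every integer up to any power of \<open>q\<close>.\<close>

lemma compact_int_ring: "compact {x::'e. av x \<le> 1}"
proof -
  let ?O = "{x::'e. av x \<le> 1}" and ?ball = "\<lambda>x. {y::'e. dist y x < 1}"
  have cpl: "complete (UNIV :: 'e set)" and "finite (?ball ` {x\<in>UNIV. av x \<le> 1})"
    using ext by (simp_all add: unramified_quadratic_def nonarch_local_field_def)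
  then have fin: "finite (?ball ` ?O)" by simp
  define R where "R = (\<lambda>C. SOME y. y \<in> C) ` (?ball ` ?O)"
  have finR: "finite R" using fin by (simp add: R_def)
  have R: "\<exists>r\<in>R. av (x - r) \<le> q" if "av x \<le> 1" for x :: 'e
  proof -
    let ?r = "SOME y. y \<in> ?ball x"
    have "x \<in> ?ball x" by simp
    then have "?r \<in> ?ball x" by (rule someI)
    then have "av (?r - x) < 1" by (simp add: dist_av[of _ x])
    then have "av (x - ?r) < 1" by (metis av_minus minus_diff_eq)
    then have "av (x - ?r) \<le> q" by (simp only: av_discrete)
    moreover have "?ball x \<in> ?ball ` ?O" using that by simp
    then have "?r \<in> R" unfolding R_def by (rule imageI)
    ultimately show ?thesis by (rule bexI)
  qed
  have cover: "\<exists>T. finite T \<and> (\<forall>x::'e. av x \<le> 1 \<longrightarrow> (\<exists>t\<in>T. av (x - t) \<le> q ^ n))" for n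
  proof (induction n)
    case 0
    show ?case by (intro exI[of _ "{0}"]) auto
  next
    case (Suc n)
    then obtain T where T: "finite T" "\<And>x::'e. av x \<le> 1 \<Longrightarrow> \<exists>t\<in>T. av (x - t) \<le> q ^ n" by auto
    let ?T = "(\<lambda>(t, r). t + w ^ n * r) ` (T \<times> R)"
    have avw: "av (w ^ n) = q ^ n" by (induction n) (simp_all add: av_mult)
    have "\<exists>t\<in>?T. av (x - t) \<le> q ^ Suc n" if x: "av x \<le> 1" for x :: 'e
    proof -
      obtain t where t: "t \<in> T" "av (x - t) \<le> q ^ n" using T(2)[OF x] by blast
      let ?z = "(x - t) / w ^ n"
      have "av ?z \<le> 1" using t(2) q_pos by (simp add: av_divide avw)
      then obtain r where r: "r \<in> R" "av (?z - r) \<le> q" using R by blast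
      have "x - (t + w ^ n * r) = w ^ n * (?z - r)" using w_nonzero by (simp add: field_simps)
      then have "av (x - (t + w ^ n * r)) = q ^ n * av (?z - r)" by (simp only: av_mult avw)
      also have "\<dots> \<le> q ^ Suc n" using r(2) q_pos by simp
      finally show ?thesis using t(1) r(1) by force
    qed
    then show ?case using T(1) finR by (intro exI[of _ ?T]) auto
  qed
  show ?thesis unfolding compact_eq_totally_bounded
  proof (intro conjI allI impI)
    have "?O = cball 0 1" by (auto simp: dist_commute)
    then show "complete ?O" using cpl complete_closed_subset[of ?O UNIV] by simp
    fix e :: real assume "e > 0"
    then obtain n where n: "q ^ n < e" using real_arch_pow_inv q_less by blast
    obtain T where T: "finite T" "\<And>x::'e. av x \<le> 1 \<Longrightarrow> \<exists>t\<in>T. av (x - t) \<le> q ^ n"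
      using cover[of n] by auto
    have "?O \<subseteq> (\<Union>t\<in>T. ball t e)"
    proof
      fix x assume "x \<in> ?O"
      then obtain t where "t \<in> T" "av (x - t) \<le> q ^ n" using T(2) by auto
      then have "dist t x < e" using n by (simp add: dist_commute[of t x] dist_av[of x t])
      then show "x \<in> (\<Union>t\<in>T. ball t e)" using \<open>t \<in> T\<close> by auto
    qed
    then show "\<exists>k. finite k \<and> ?O \<subseteq> (\<Union>x\<in>k. ball x e)" using T(1) by blast
  qed
qed

lemma compact_inv_max_ideal: "compact {x::'e. av x \<le> 1 / q}"
proof -
  have "{x::'e. av x \<le> 1 / q} = (\<lambda>x. inverse w * x) ` {x. av x \<le> 1}"
  proof (intro equalityI subsetI)
    fix x :: 'e assume "x \<in> {x. av x \<le> 1 / q}"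
    then have "w * x \<in> {x. av x \<le> 1}" using q_pos by (simp add: av_mult field_simps)
    moreover have "x = inverse w * (w * x)" using w_nonzero by simp
    ultimately show "x \<in> (\<lambda>x. inverse w * x) ` {x. av x \<le> 1}" by blast
  next
    fix x :: 'e assume "x \<in> (\<lambda>x. inverse w * x) ` {x. av x \<le> 1}"
    then obtain z where z: "av z \<le> 1" "x = inverse w * z" by blast
    have "av x = inverse q * av z" by (simp only: z av_mult av_inverse)
    also have "\<dots> \<le> inverse q" using z(1) q_pos by (intro mult_left_le) auto
    finally show "x \<in> {x. av x \<le> 1 / q}" by (simp add: inverse_eq_divide)
  qed
  then show ?thesis
    by (simp add: compact_continuous_image compact_int_ring continuous_on_av_mult)
qed

section \<open>The Galois conjugation is an isometric involution\<close>

lemma cj_add: "cj (x + y) = cj x + cj y" and cj_mult: "cj (x * y) = cj x * cj y"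
  and cj_F: "x \<in> F \<Longrightarrow> cj x = x" and bij_cj: "bij cj"
  using gal by (auto simp: nontrivial_galois_def)

lemma cj_zero [simp]: "cj 0 = 0"
  by (metis add.right_neutral add_left_cancel cj_add)

lemma cj_one [simp]: "cj 1 = 1"
proof -
  have "cj 1 \<noteq> 0" using bij_cj cj_zero by (metis bij_pointE zero_neq_one)
  then show ?thesis using cj_mult[of 1 1] by simp
qed

lemma cj_minus [simp]: "cj (- x) = - cj x"
  using cj_add[of x "- x"] by (simp add: eq_neg_iff_add_eq_0 add.commute)

lemma cj_diff: "cj (x - y) = cj x - cj y"
  using cj_add[of x "- y"] by simp

lemma cj_eq_0_iff [simp]: "cj x = 0 \<longleftrightarrow> x = 0"
  using bij_cj cj_zero by (metis bij_pointE)

lemma cj_inverse: "cj (inverse x) = inverse (cj x)"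
proof (cases "x = 0")
  case False
  then have "cj x * cj (inverse x) = 1" by (simp flip: cj_mult)
  then show ?thesis by (metis inverse_unique)
qed simp

lemma cj_divide: "cj (x / y) = cj x / cj y"
  by (simp add: divide_inverse cj_mult cj_inverse)

lemma cj_power: "cj (x ^ n) = cj x ^ n"
  by (induction n) (simp_all add: cj_mult)

lemma F_subfield: "0 \<in> F" "1 \<in> F" "x \<in> F \<Longrightarrow> y \<in> F \<Longrightarrow> x + y \<in> F" "x \<in> F \<Longrightarrow> y \<in> F \<Longrightarrow> x * y \<in> F"
    "x \<in> F \<Longrightarrow> - x \<in> F" "x \<in> F \<Longrightarrow> inverse x \<in> F"
  using ext by (simp_all add: unramified_quadratic_def nonarch_local_field_def subfield_of_def)

lemma generator: obtains t where "t \<notin> F" "\<And>x. \<exists>a\<in>F. \<exists>b\<in>F. x = a + b * t" "cj t \<noteq> t"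
proof -
  obtain t where t: "t \<notin> F" "\<And>x. \<exists>a\<in>F. \<exists>b\<in>F. x = a + b * t"
    using ext by (auto simp: unramified_quadratic_def)
  have "cj t \<noteq> t"
  proof
    assume "cj t = t"
    then have "cj x = x" for x using t(2)[of x] by (auto simp: cj_add cj_mult cj_F)
    then show False using gal by (auto simp: nontrivial_galois_def fun_eq_iff)
  qed
  then show thesis using that t by blast
qed

lemma cj_fixed: "cj x = x \<longleftrightarrow> x \<in> F"
proof
  assume x: "cj x = x"
  obtain t where t: "\<And>x. \<exists>a\<in>F. \<exists>b\<in>F. x = a + b * t" "cj t \<noteq> t" using generator by blast
  obtain a b where ab: "a \<in> F" "b \<in> F" "x = a + b * t" using t(1) by blast
  then have "b * cj t = b * t" using x by (simp add: cj_add cj_mult cj_F)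
  then show "x \<in> F" using ab t(2) by simp
qed (rule cj_F)

text \<open>If \<open>t\<^sup>2 = A + B t\<close> then \<open>cj t\<close> is the other root \<open>B - t\<close> of the same quadratic polynomial.\<close>

lemma cj_cj [simp]: "cj (cj x) = x"
proof -
  obtain t where t: "\<And>x. \<exists>a\<in>F. \<exists>b\<in>F. x = a + b * t" "cj t \<noteq> t" using generator by blast
  obtain A B where AB: "A \<in> F" "B \<in> F" "t * t = A + B * t" using t(1) by blast
  have "cj t * cj t = A + B * cj t" using AB by (metis cj_F cj_add cj_mult)
  then have "(cj t - t) * (cj t + t - B) = 0" using AB(3) by (simp add: algebra_simps)
  then have "cj t + t - B = 0" using t(2) by (simp only: mult_eq_0_iff right_minus_eq) simp
  then have "cj t = B - t" by (simp add: algebra_simps)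
  then have tt: "cj (cj t) = t" using AB(2) by (simp add: cj_diff cj_F)
  obtain a b where "a \<in> F" "b \<in> F" "x = a + b * t" using t(1) by blast
  then show ?thesis using tt by (simp add: cj_add cj_mult cj_F)
qed

lemma value_group:
  fixes x :: 'e
  obtains f where "f \<in> F" "av f = av x"
proof -
  have "(\<lambda>x. av x) ` F = range (\<lambda>x::'e. av x)" using ext by (simp add: unramified_quadratic_def)
  moreover have "av x \<in> range (\<lambda>x::'e. av x)" by (rule rangeI)
  ultimately have "av x \<in> (\<lambda>x. av x) ` F" by (simp only:)
  then show thesis using that by (auto simp: image_iff)
qed

lemma closed_F: "closed F"
  using ext complete_imp_closed by (auto simp: unramified_quadratic_def nonarch_local_field_def)

lemma av_power: "av (x ^ n) = av x ^ n" for x :: 'e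
  by (induction n) (simp_all add: av_mult)

text \<open>If \<open>av x = 1\<close> and \<open>av (cj x) < 1\<close>, then \<open>x\<close> is the limit of the ratios of
  consecutive traces \<open>x\<^sup>n + cj x\<^sup>n\<close>, which lie in the closed subfield \<open>F\<close>.\<close>

lemma av_cj_ge_1:
  assumes x: "av x = 1"
  shows "av (cj x) \<ge> 1"
proof (rule ccontr)
  assume "\<not> av (cj x) \<ge> 1"
  then have c: "av (cj x) < 1" by simp
  define T where "T n = x ^ n + cj x ^ n" for n
  have TF: "T n \<in> F" for n unfolding cj_fixed[symmetric] by (simp add: T_def cj_add cj_power add.commute)
  \<comment> \<open>The exponent is positive so that the power of \<open>x\<close> strictly
    dominates; at exponent zero both summands equal one.\<close>
  have avT: "av (T (Suc n)) = 1" for n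
  proof -
    have "av (cj x ^ Suc n) < av (x ^ Suc n)"
      using c x power_Suc_less_one[of "av (cj x)" n] by (cases "cj x = 0") (auto simp: av_power simp del: power_Suc)
    then show ?thesis using av_add_eq[of "cj x ^ Suc n" "x ^ Suc n"] x
      by (simp add: T_def av_power add.commute del: power_Suc)
  qed
  define r where "r n = T (Suc (Suc n)) * inverse (T (Suc n))" for n
  have rF: "r n \<in> F" for n by (simp add: r_def TF F_subfield)
  have "dist (r n) x \<le> av (cj x) ^ n" for n
  proof -
    have nz: "T (Suc n) \<noteq> 0" using avT[of n] by auto
    have "r n - x = (T (Suc (Suc n)) - x * T (Suc n)) * inverse (T (Suc n))"
      using nz by (simp add: r_def algebra_simps)
    also have "T (Suc (Suc n)) - x * T (Suc n) = cj x ^ Suc n * (cj x - x)"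
      by (simp add: T_def algebra_simps)
    finally have "av (r n - x) = av (cj x) ^ Suc n * av (cj x - x)"
      by (simp add: av_mult av_inverse avT av_power del: power_Suc)
    moreover have "av (cj x - x) \<le> 1" using av_diff[of "cj x" x] x c by simp
    moreover have "av (cj x) ^ Suc n \<le> av (cj x) ^ n" using c by (intro power_decreasing) auto
    ultimately have "av (r n - x) \<le> av (cj x) ^ n * 1"
      using mult_mono[of "av (cj x) ^ Suc n" "av (cj x) ^ n" "av (cj x - x)" 1] by simp
    then show ?thesis by (simp add: dist_av[of "r n" x])
  qed
  moreover have "(\<lambda>n. av (cj x) ^ n) \<longlonglongrightarrow> 0" using c by (intro LIMSEQ_power_zero) simp
  ultimately have "r \<longlonglongrightarrow> x" by (rule tendsto_dist_le)
  then have "x \<in> F" using closed_F rF unfolding closed_sequential_limits by blast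
  then show False using x c by (simp add: cj_F)
qed

text \<open>Since the extension is unramified, \<open>x\<close> can be scaled by an element of
  \<open>F\<close> to absolute value one, where \<open>av_cj_ge_1\<close> applies. The reverse
  inequality follows because \<open>cj\<close> is an involution.\<close>

lemma av_cj [simp]: "av (cj x) = av x"
proof -
  have ge: "av x \<le> av (cj x)" for x
  proof (cases "x = 0")
    case False
    obtain f where f: "f \<in> F" "av f = av x" by (rule value_group)
    have "av (x / f) = 1" using f False by (simp add: av_divide)
    then have "av (cj (x / f)) \<ge> 1" by (rule av_cj_ge_1)
    then show ?thesis using f False by (simp add: cj_divide cj_F av_divide field_simps)
  qed simp
  show ?thesis using ge[of x] ge[of "cj x"] by simp
qed

lemma continuous_on_cj: "continuous_on S cj"
proof -
  have "dist (cj x) (cj y) = dist x y" for x y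
  proof -
    have "dist (cj x) (cj y) = av (cj x - cj y)" by (rule dist_av)
    also have "cj x - cj y = cj (x - y)" by (rule cj_diff[symmetric])
    also have "av (cj (x - y)) = av (x - y)" by (rule av_cj)
    also have "av (x - y) = dist x y" by (rule dist_av[symmetric])
    finally show ?thesis .
  qed
  then show ?thesis unfolding continuous_on_iff by metis
qed

text \<open>The difference \<open>t - cj t\<close> is antisymmetric, and unramifiedness supplies an
  element of \<open>F\<close> by which to normalize it. It will be the corner entry of a unipotent
  element that \<open>s\<close> does not keep in \<open>B\<close>.\<close>

lemma trace_zero_unit: obtains z where "cj z = - z" "av z = 1"
proof -
  obtain t where t: "t \<notin> F" "cj t \<noteq> t" by (rule generator)
  obtain f where f: "f \<in> F" "av f = av (t - cj t)" by (rule value_group)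
  show thesis
  proof (rule that)
    show "cj ((t - cj t) / f) = - ((t - cj t) / f)" using f by (simp add: cj_divide cj_diff cj_F minus_divide_left)
    show "av ((t - cj t) / f) = 1" using f t by (simp add: av_divide)
  qed
qed

lemma cj_w [simp]: "cj w = w"
  using w_F by (rule cj_F)

end

section \<open>Unitary matrices with bounded entries\<close>

definition rev3 :: "3 \<Rightarrow> 3" where
  "rev3 a = (if a = 1 then 3 else if a = 3 then 1 else 2)"

lemma rev3_simps [simp]: "rev3 1 = 3" "rev3 2 = 2" "rev3 3 = 1"
  by (simp_all add: rev3_def)

lemma rev3_rev3 [simp]: "rev3 (rev3 a) = a"
  using exhaust_3[of a] by auto

definition cjm :: "('e \<Rightarrow> 'e) \<Rightarrow> 'e mat3 \<Rightarrow> 'e mat3" where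
  "cjm cj g = (\<chi> i j. cj (g $ i $ j))"

text \<open>The matrix \<open>beta * t * beta\<close>, where \<open>t\<close> is the conjugate
  transpose of \<open>g\<close>: conjugation by \<open>beta\<close> reverses rows and columns. It is
  the inverse of a unitary \<open>g\<close>.\<close>

definition adj :: "('e \<Rightarrow> 'e) \<Rightarrow> 'e mat3 \<Rightarrow> 'e mat3" where
  "adj cj g = (\<chi> a b. cj (g $ rev3 b $ rev3 a))"

lemma compact_vec3:
  fixes C :: "'a::topological_space set"
  assumes "compact C"
  shows "compact {v::'a^3. \<forall>i. v $ i \<in> C}"
proof -
  let ?f = "\<lambda>p. (\<chi> i. if i = 1 then fst p else if i = 2 then fst (snd p) else snd (snd p)) :: 'a^3"
  have "{v::'a^3. \<forall>i. v $ i \<in> C} = ?f ` (C \<times> C \<times> C)"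
  proof (intro equalityI subsetI)
    fix v :: "'a^3" assume "v \<in> {v. \<forall>i. v $ i \<in> C}"
    then show "v \<in> ?f ` (C \<times> C \<times> C)"
      by (intro image_eqI[of _ _ "(v $ 1, v $ 2, v $ 3)"]) (auto simp: vec_eq_iff forall_3)
  qed auto
  moreover have "continuous_on (C \<times> C \<times> C) (\<lambda>p. if i = 1 then fst p else if i = 2 then fst (snd p) else snd (snd p))"
    for i :: 3
    using exhaust_3[of i] by (auto intro!: continuous_intros)
  then have "continuous_on (C \<times> C \<times> C) ?f" by (rule continuous_on_vec_lambda)
  ultimately show ?thesis using assms by (simp add: compact_continuous_image compact_Times)
qed

context unramified_extension
begin

abbreviation GG :: "'e mat3 monoid" where "GG \<equiv> unitary_group cj"

lemma GG_simps [simp]: "\<one>\<^bsub>GG\<^esub> = mat 1" "g \<otimes>\<^bsub>GG\<^esub> h = g ** h"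
  by (simp_all add: unitary_group_def)

lemma cj_sum: "cj (sum f A) = (\<Sum>x\<in>A. cj (f x))"
  by (induction A rule: infinite_finite_induct) (simp_all add: cj_add)

lemma cjm_mult: "cjm cj (g ** h) = cjm cj g ** cjm cj h"
  by (simp add: cjm_def matrix_matrix_mult_def vec_eq_iff cj_sum cj_mult)

lemma cjm_one [simp]: "cjm cj (mat 1) = mat 1"
  by (simp add: cjm_def mat_def vec_eq_iff)

lemma form_entry:
  "(transpose g ** beta ** cjm cj g) $ a $ b =
     g$3$a * cj (g$1$b) + g$2$a * cj (g$2$b) + g$1$a * cj (g$3$b)"
  by (simp add: matrix_matrix_mult_def transpose_def beta_def sum_3 cjm_def)

lemma beta_rev3: "beta $ rev3 a $ b = (mat 1 :: 'e mat3) $ a $ b"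
  using exhaust_3[of a] exhaust_3[of b] by (auto simp: beta_def mat_def)

lemma adj_mult:
  assumes "transpose g ** beta ** cjm cj g = beta"
  shows "adj cj g ** g = mat 1" "g ** adj cj g = mat 1"
proof -
  have "(adj cj g ** g) $ a $ b = mat 1 $ a $ b" for a b
  proof -
    have "(adj cj g ** g) $ a $ b = cj ((transpose g ** beta ** cjm cj g) $ rev3 a $ b)"
      unfolding form_entry by (simp add: adj_def matrix_matrix_mult_def sum_3 cj_add cj_mult)
    also have "\<dots> = cj ((mat 1 :: 'e mat3) $ a $ b)" by (simp add: assms beta_rev3)
    also have "\<dots> = (mat 1 :: 'e mat3) $ a $ b" by (simp add: mat_def)
    finally show ?thesis .
  qed
  then show "adj cj g ** g = mat 1" by (simp add: vec_eq_iff)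
  then show "g ** adj cj g = mat 1" by (simp add: matrix_left_right_inverse)
qed

lemma carrier_GG: "carrier GG = {g. transpose g ** beta ** cjm cj g = beta}"
  using adj_mult by (auto simp: unitary_group_def cjm_def[symmetric] invertible_def)

lemma GG_iff:
  "g \<in> carrier GG \<longleftrightarrow>
    (\<forall>a b. g$3$a * cj (g$1$b) + g$2$a * cj (g$2$b) + g$1$a * cj (g$3$b) = beta$a$b)"
  by (simp only: carrier_GG mem_Collect_eq form_entry vec_eq_iff)

lemma GG_group: "group GG"
proof (rule groupI)
  fix g h assume "g \<in> carrier GG" "h \<in> carrier GG"
  then have g: "transpose g ** beta ** cjm cj g = beta" and h: "transpose h ** beta ** cjm cj h = beta"
    by (simp_all add: carrier_GG)
  have "transpose (g ** h) ** beta ** cjm cj (g ** h) =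
      transpose h ** (transpose g ** beta ** cjm cj g) ** cjm cj h"
    by (simp add: matrix_transpose_mul cjm_mult matrix_mul_assoc)
  then show "g \<otimes>\<^bsub>GG\<^esub> h \<in> carrier GG" by (simp add: carrier_GG g h)
next
  fix g assume "g \<in> carrier GG"
  then have g: "transpose g ** beta ** cjm cj g = beta" by (simp add: carrier_GG)
  let ?y = "adj cj g"
  have "transpose ?y ** beta ** cjm cj ?y = transpose ?y ** (transpose g ** beta ** cjm cj g) ** cjm cj ?y"
    by (simp add: g)
  also have "\<dots> = transpose (g ** ?y) ** beta ** cjm cj (g ** ?y)"
    by (simp add: matrix_transpose_mul cjm_mult matrix_mul_assoc)
  also have "\<dots> = beta" by (simp add: adj_mult[OF g])
  finally show "\<exists>y\<in>carrier GG. y \<otimes>\<^bsub>GG\<^esub> g = \<one>\<^bsub>GG\<^esub>"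
    using adj_mult[OF g] by (intro bexI[of _ ?y]) (simp_all add: carrier_GG)
qed (simp_all add: carrier_GG matrix_mul_assoc)

sublocale GG: group GG
  by (rule GG_group)

lemma adj_GG: "g \<in> carrier GG \<Longrightarrow> inv\<^bsub>GG\<^esub> g = adj cj g"
proof -
  assume g: "g \<in> carrier GG"
  have "inv\<^bsub>GG\<^esub> g ** g = mat 1" "g ** adj cj g = mat 1"
    using GG.l_inv[OF g] adj_mult g by (simp_all add: carrier_GG)
  then show ?thesis by (metis matrix_mul_assoc matrix_mul_lid matrix_mul_rid)
qed

text \<open>\<open>GG_iff\<close> lists the relations between columns; the rows satisfy the same
  ones because \<open>adj cj g\<close> is also a right inverse.\<close>

lemma GG_row:
  assumes "g \<in> carrier GG"
  shows "g$a$1 * cj (g$b$3) + g$a$2 * cj (g$b$2) + g$a$3 * cj (g$b$1) = beta$a$b"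
proof -
  have "g ** adj cj g = mat 1" using adj_mult assms by (simp add: carrier_GG)
  moreover have "(g ** adj cj g) $ a $ rev3 b =
      g$a$1 * cj (g$b$3) + g$a$2 * cj (g$b$2) + g$a$3 * cj (g$b$1)"
    by (simp add: matrix_matrix_mult_def adj_def sum_3)
  moreover have "a = rev3 b \<longleftrightarrow> rev3 a = b" by (metis rev3_rev3)
  then have "(mat 1 :: 'e mat3) $ a $ rev3 b = mat 1 $ rev3 a $ b" by (simp add: mat_def)
  moreover have "\<dots> = beta $ a $ b" using beta_rev3[of "rev3 a" b] by simp
  ultimately show ?thesis by simp
qed

sublocale GG: topological_matrix_group GG
proof
  fix h assume "h \<in> carrier GG"
  have entry: "continuous_on (carrier GG) (\<lambda>g. g $ a $ b)" for a b :: 3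
    by (intro continuous_on_component continuous_on_id)
  show "continuous_on (carrier GG) (\<lambda>g. g \<otimes>\<^bsub>GG\<^esub> h)" "continuous_on (carrier GG) (\<lambda>g. h \<otimes>\<^bsub>GG\<^esub> g)"
    unfolding GG_simps matrix_matrix_mult_def sum_3
    by (intro continuous_on_vec_lambda continuous_on_av_add continuous_on_av_mult entry continuous_on_const)+
qed

definition bounded_by :: "(3 \<Rightarrow> 3 \<Rightarrow> real) \<Rightarrow> 'e mat3 set" where
  "bounded_by e = {g \<in> carrier GG. \<forall>a b. av (g $ a $ b) \<le> e a b}"

text \<open>Products are controlled by submultiplicativity of \<open>e\<close> and the ultrametric
  inequality, inverses by the symmetry of \<open>e\<close> in the antidiagonal, since the inverse is
  \<open>adj cj g\<close>.\<close>

lemma bounded_by_subgroup: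
  assumes e: "\<And>a. 1 \<le> e a a" "\<And>a b. 0 < e a b" "\<And>a b c. e a b * e b c \<le> e a c"
    "\<And>a b. e (rev3 b) (rev3 a) = e a b"
  shows "subgroup (bounded_by e) GG"
proof (rule GG.subgroupI)
  have "av ((mat 1 :: 'e mat3) $ a $ b) \<le> e a b" for a b
    using e(1)[of a] e(2)[of a b] by (auto simp: mat_def)
  then show "bounded_by e \<noteq> {}" using GG.one_closed by (auto simp: bounded_by_def)
  show "inv\<^bsub>GG\<^esub> g \<in> bounded_by e" if g: "g \<in> bounded_by e" for g
  proof -
    have gG: "g \<in> carrier GG" using g by (simp add: bounded_by_def)
    have "av (adj cj g $ a $ b) \<le> e a b" for a b
      using g e(4)[of b a] by (simp add: bounded_by_def adj_def) (metis e(4))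
    then show ?thesis using GG.inv_closed[OF gG] by (simp add: bounded_by_def adj_GG[OF gG])
  qed
  show "g \<otimes>\<^bsub>GG\<^esub> h \<in> bounded_by e" if g: "g \<in> bounded_by e" and h: "h \<in> bounded_by e" for g h
  proof -
    have "av (g $ a $ c * h $ c $ b) \<le> e a b" for a b c
    proof -
      have "av (g $ a $ c * h $ c $ b) \<le> e a c * e c b"
        unfolding av_mult using g h e(2)[of a c] by (intro mult_mono) (auto simp: bounded_by_def)
      then show ?thesis using e(3)[of a c b] by linarith
    qed
    then have "av ((g ** h) $ a $ b) \<le> e a b" for a b
      by (simp add: matrix_matrix_mult_def sum_3 av_add_le)
    then show ?thesis using GG.m_closed[of g h] g h by (simp add: bounded_by_def)
  qed
qed (auto simp: bounded_by_def)

lemma continuous_on_entry: "continuous_on S (\<lambda>g::'e mat3. g $ a $ b)"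
  by (intro continuous_on_component continuous_on_id)

lemma bounded_by_open:
  assumes e: "\<And>a b. 0 < e a b"
  shows "openin (top_of_set (carrier GG)) (bounded_by e)"
proof -
  have "open {x::'e. av x \<le> c}" if "c > 0" for c
    unfolding open_dist
  proof (intro ballI exI conjI allI impI)
    fix x y :: 'e assume x: "x \<in> {x. av x \<le> c}" and d: "dist y x < c"
    have "av ((y - x) + x) \<le> c" using x d by (intro av_add_le) (auto simp: dist_av[of y x])
    then show "y \<in> {x. av x \<le> c}" by simp
  qed (rule that)
  then have "open ((\<lambda>g::'e mat3. g $ a $ b) -` {x. av x \<le> e a b})" for a b
    using e by (intro open_vimage continuous_on_entry) auto
  then have "open (\<Inter>a. \<Inter>b. (\<lambda>g::'e mat3. g $ a $ b) -` {x. av x \<le> e a b})"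
    by (intro open_INT) auto
  moreover have "bounded_by e = carrier GG \<inter> (\<Inter>a. \<Inter>b. (\<lambda>g::'e mat3. g $ a $ b) -` {x. av x \<le> e a b})"
    by (auto simp: bounded_by_def)
  ultimately show ?thesis by (auto simp: openin_open)
qed

text \<open>A closed subset of the compact box of matrices with entries of size at most
  \<open>1 / q\<close>, the bound for the upper right corner in \<open>K_one\<close>.\<close>

lemma bounded_by_compact:
  assumes e: "\<And>a b. e a b \<le> 1 / q"
  shows "compact (bounded_by e)"
proof -
  let ?M = "{g::'e mat3. \<forall>a. g $ a \<in> {v. \<forall>b. v $ b \<in> {x. av x \<le> 1 / q}}}"
  have M: "compact ?M" by (intro compact_vec3 compact_inv_max_ideal)
  have cl: "closed {x::'e. av x \<le> c}" for c
  proof -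
    have "{x::'e. av x \<le> c} = cball 0 c" by (auto simp: dist_commute)
    then show ?thesis by simp
  qed
  have cje: "continuous_on UNIV (\<lambda>g::'e mat3. cj (g $ a $ b))" for a b
    using continuous_on_compose2[OF continuous_on_cj[of UNIV] continuous_on_entry[of UNIV a b]] by auto
  have "carrier GG = {g. \<forall>a b. g$3$a * cj (g$1$b) + g$2$a * cj (g$2$b) + g$1$a * cj (g$3$b) = beta$a$b}"
    using GG_iff by blast
  moreover have "closed \<dots>"
    by (intro closed_Collect_all closed_Collect_eq continuous_on_av_add continuous_on_av_mult
        continuous_on_entry cje continuous_on_const)
  ultimately have cG: "closed (carrier GG)" by simp
  have "closed ((\<lambda>g::'e mat3. g $ a $ b) -` {x. av x \<le> e a b})" for a b
    by (intro closed_vimage continuous_on_entry cl)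
  then have "closed (\<Inter>a. \<Inter>b. (\<lambda>g::'e mat3. g $ a $ b) -` {x. av x \<le> e a b})" by auto
  moreover note cG
  moreover have eq: "bounded_by e = carrier GG \<inter> (\<Inter>a. \<Inter>b. (\<lambda>g::'e mat3. g $ a $ b) -` {x. av x \<le> e a b})"
    by (auto simp: bounded_by_def)
  ultimately have "closed (bounded_by e)" unfolding eq by (intro closed_Int)
  moreover have "bounded_by e \<subseteq> ?M"
  proof
    fix g assume g: "g \<in> bounded_by e"
    have "av (g $ a $ b) \<le> 1 / q" for a b
      using g by (intro order_trans[OF _ e[of a b]]) (simp add: bounded_by_def)
    then show "g \<in> ?M" by simp
  qed
  ultimately show ?thesis using M compact_Int_closed[of ?M "bounded_by e"] by (simp add: Int_absorb1)
qed

text \<open>The norms \<open>max av (N a b) * h b / h a\<close> with positive weights \<open>h\<close> are submultiplicative.\<close>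

definition wnorm_le :: "(3 \<Rightarrow> real) \<Rightarrow> real \<Rightarrow> 'e mat3 \<Rightarrow> bool" where
  "wnorm_le h c N \<longleftrightarrow> (\<forall>a b. av (N $ a $ b) \<le> c * (h a / h b))"

lemma wnorm_le_add: "wnorm_le h c N \<Longrightarrow> wnorm_le h c M \<Longrightarrow> wnorm_le h c (N + M)"
  by (simp add: wnorm_le_def av_add_le)

lemma wnorm_le_mult:
  assumes h: "\<And>a. 0 < h a" and c: "0 \<le> c" and N: "wnorm_le h c N" and M: "wnorm_le h d M"
  shows "wnorm_le h (c * d) (N ** M)"
proof -
  have "av (N $ a $ b * M $ b $ k) \<le> (c * d) * (h a / h k)" for a b k
  proof -
    have "av (N $ a $ b * M $ b $ k) \<le> (c * (h a / h b)) * (d * (h b / h k))"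
      unfolding av_mult using N M c h[of a] h[of b] by (intro mult_mono) (auto simp: wnorm_le_def)
    also have "\<dots> = (c * d) * (h a / h k)" using h[of b] by simp
    finally show ?thesis .
  qed
  then show ?thesis by (simp add: wnorm_le_def matrix_matrix_mult_def sum_3 av_add_le)
qed

lemma wnorm_le_mono:
  assumes "\<And>a. 0 < h a" "c \<le> d" "wnorm_le h c N"
  shows "wnorm_le h d N"
  unfolding wnorm_le_def
proof (intro allI)
  fix a b
  have "c * (h a / h b) \<le> d * (h a / h b)"
    using assms(1)[of a] assms(1)[of b] assms(2) by (intro mult_right_mono) auto
  then show "av (N $ a $ b) \<le> d * (h a / h b)" using assms(3) unfolding wnorm_le_def by (meson order_trans)
qed

lemma matrix_mult_add_right: "(A + B) ** C = A ** C + B ** (C :: 'e mat3)"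
  by (simp add: matrix_matrix_mult_def vec_eq_iff sum.distrib distrib_right)

text \<open>The expansion of \<open>(1 + N) ^ k\<close> up to quadratic terms, with
  \<open>N = g - 1\<close>. Both estimates share one induction because the quadratic one uses the
  linear one. The product with \<open>of_nat k\<close> is entrywise, hence a scaling.\<close>

lemma wnorm_le_power:
  fixes k :: nat
  assumes h: "\<And>a. 0 < h a" and c: "0 \<le> c" "c \<le> 1" and N: "wnorm_le h c (g - mat 1)"
  shows "wnorm_le h c (g [^]\<^bsub>GG\<^esub> k - mat 1)"
    "wnorm_le h (c * c) (g [^]\<^bsub>GG\<^esub> k - mat 1 - of_nat k * (g - mat 1))"
proof (induction k)
  case 0
  {
    case 1
    show ?case using c h[THEN less_imp_le] by (simp add: wnorm_le_def)
  next
    case 2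
    show ?case using c h[THEN less_imp_le] by (simp add: wnorm_le_def)
  }
next
  case (Suc k)
  let ?N = "g - mat 1" and ?D = "g [^]\<^bsub>GG\<^esub> k - mat 1"
  have "(?D + mat 1) ** (?N + mat 1) = ?D ** ?N + ?D + (?N + mat 1)"
    by (simp only: matrix_add_ldistrib matrix_mul_rid matrix_mult_add_right matrix_mul_lid) (simp add: add_ac)
  then have D: "g [^]\<^bsub>GG\<^esub> Suc k - mat 1 = ?D + ?N + ?D ** ?N" by (simp add: algebra_simps)
  have DN: "wnorm_le h (c * c) (?D ** ?N)" by (rule wnorm_le_mult[OF h c(1) Suc(1) N])
  {
    case 1
    have "wnorm_le h c (?D ** ?N)"
      by (rule wnorm_le_mono[OF h _ DN]) (use c in \<open>simp add: mult_left_le\<close>)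
    then show ?case unfolding D by (intro wnorm_le_add Suc N)
  next
    case 2
    have e: "g [^]\<^bsub>GG\<^esub> Suc k - mat 1 - of_nat (Suc k) * ?N = (?D - of_nat k * ?N) + ?D ** ?N"
      unfolding D by (simp add: algebra_simps)
    show ?case unfolding e by (rule wnorm_le_add[OF Suc(2) DN])
  }
qed

end

section \<open>The Iwahori and Bruhat decompositions of the unitary group\<close>

text \<open>
  With \<open>q\<close> the absolute value of the uniformizer, \<open>kbound\<close> and \<open>bbound\<close> bound the absolute values of
  the entries of the elements of \<open>K\<close> and of its Iwahori subgroup.
\<close>

fun kbound :: "real \<Rightarrow> max_compact \<Rightarrow> 3 \<Rightarrow> 3 \<Rightarrow> real" where
  "kbound q K_zero a b = 1"
| "kbound q K_one a b = (vector [vector [1, 1, 1 / q], vector [q, 1, 1], vector [q, q, 1]] :: real^3^3) $ a $ b"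

fun bbound :: "real \<Rightarrow> max_compact \<Rightarrow> 3 \<Rightarrow> 3 \<Rightarrow> real" where
  "bbound q K_zero a b = (vector [vector [1, 1, 1], vector [q, 1, 1], vector [q, q, 1]] :: real^3^3) $ a $ b"
| "bbound q K_one a b =
    (vector [vector [1, 1, 1 / q], vector [q, 1, 1], vector [q * q, q, 1]] :: real^3^3) $ a $ b"

context
  fixes q :: real
  assumes q: "0 < q" "q < 1"
begin

lemma q_powers: "q * q \<le> q" "q * q < q" "q * q < 1" "q * q \<le> 1" "1 \<le> 1 / q" "q \<le> 1 / q" "q * q * q \<le> q"
proof -
  show qq: "q * q < q" "q * q < 1" using q mult_strict_mono[of q 1 q 1] by auto
  then show "q * q \<le> q" "q * q \<le> 1" by auto
  show "1 \<le> 1 / q" using q by simp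
  then show "q \<le> 1 / q" using q by linarith
  show "q * q * q \<le> q" using mult_right_le_one_le[of q "q * q"] q qq by (simp add: mult.commute)
qed

text \<open>Object-level quantifiers let \<open>forall_3\<close> expand the claims into finitely
  many inequalities between powers of \<open>q\<close>.\<close>

lemma kbound_forall:
  "\<forall>a. 1 \<le> kbound q \<kappa> a a" "\<forall>a b. 0 < kbound q \<kappa> a b"
  "\<forall>a b c. kbound q \<kappa> a b * kbound q \<kappa> b c \<le> kbound q \<kappa> a c"
  "\<forall>a b. kbound q \<kappa> (rev3 b) (rev3 a) = kbound q \<kappa> a b" "\<forall>a b. kbound q \<kappa> a b \<le> 1 / q"
  by (cases \<kappa>; simp add: forall_3 q q_powers less_imp_le[OF q(1)] less_imp_le[OF q(2)])+

lemma bbound_forall: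
  "\<forall>a. bbound q \<kappa> a a = 1" "\<forall>a b. 0 < bbound q \<kappa> a b"
  "\<forall>a b c. bbound q \<kappa> a b * bbound q \<kappa> b c \<le> bbound q \<kappa> a c"
  "\<forall>a b. bbound q \<kappa> (rev3 b) (rev3 a) = bbound q \<kappa> a b" "\<forall>a b. bbound q \<kappa> a b \<le> kbound q \<kappa> a b"
  "\<forall>a b. a \<noteq> b \<longrightarrow> bbound q \<kappa> a b * bbound q \<kappa> b a < 1"
  by (cases \<kappa>; simp add: forall_3 q q_powers less_imp_le[OF q(1)] less_imp_le[OF q(2)])+

end

context unramified_extension
begin

lemma av_less_q_iff: "av x < q \<longleftrightarrow> av x \<le> q * q" for x :: 'e
  using av_discrete[of "x / w"]
  by (simp only: av_divide pos_divide_less_eq[OF q_pos] pos_divide_le_eq[OF q_pos] mult_1)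

lemmas kbound_props [rule_format] = kbound_forall[OF q_pos q_less]

lemmas bbound_props [rule_format] = bbound_forall[OF q_pos q_less]

lemmas bbound_offdiag = bbound_props(6)

abbreviation KK :: "max_compact \<Rightarrow> 'e mat3 set" where "KK \<kappa> \<equiv> bounded_by (kbound q \<kappa>)"

abbreviation BB :: "max_compact \<Rightarrow> 'e mat3 set" where "BB \<kappa> \<equiv> bounded_by (bbound q \<kappa>)"

text \<open>An explicit pro-p counterpart of \<open>BB\<close>, defined without reference to
  \<open>Kp\<close>.\<close>

definition UU :: "max_compact \<Rightarrow> 'e mat3 set" where
  "UU \<kappa> = {g \<in> BB \<kappa>. \<forall>i. av (g $ i $ i - 1) < 1}"

lemma KK_subgroup: "subgroup (KK \<kappa>) GG"
  by (rule bounded_by_subgroup) (rule kbound_props)+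

lemma BB_subgroup: "subgroup (BB \<kappa>) GG"
  by (rule bounded_by_subgroup) (simp_all only: bbound_props order_refl)

lemma BB_subset: "BB \<kappa> \<subseteq> KK \<kappa>"
  using bbound_props(5) order_trans unfolding bounded_by_def by blast

lemma Kset_eq: "Kset cj \<kappa> = KK \<kappa>"
proof (cases \<kappa>)
  case K_zero
  have "g \<in> GL3_int" if "g \<in> KK \<kappa>" for g
  proof -
    have "adj cj g \<in> KK \<kappa>"
      using subgroup.m_inv_closed[OF KK_subgroup that] that by (simp add: adj_GG bounded_by_def)
    then show ?thesis using that adj_mult[of g]
      by (auto simp: GL3_int_def int_ring_iff bounded_by_def K_zero carrier_GG intro!: exI[of _ "adj cj g"])
  qed
  then show ?thesis by (auto simp: K_zero bounded_by_def GL3_int_def int_ring_iff)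
next
  case K_one
  show ?thesis
    by (auto simp: K_one bounded_by_def K1_lattice_def forall_3 int_ring_iff max_ideal_iff inv_max_ideal_iff)
qed

text \<open>Columns one and three pair to one. In this relation all products except
  \<open>g$1$1 * cj (g$3$3)\<close> contain opposite off-diagonal bounds and are small, so both
  diagonal factors are units.\<close>

lemma BB_diag:
  assumes "g \<in> BB \<kappa>"
  shows "av (g $ 1 $ 1) = 1"
proof -
  have g: "g \<in> carrier GG" "\<And>a b. av (g $ a $ b) \<le> bbound q \<kappa> a b" using assms by (auto simp: bounded_by_def)
  have small: "av (g $ a $ 1 * cj (g $ b $ 3)) < 1" if "a \<noteq> 1" "b = rev3 a" for a b
  proof -
    have "av (g $ a $ 1 * cj (g $ b $ 3)) \<le> bbound q \<kappa> a 1 * bbound q \<kappa> b 3"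
      unfolding av_mult av_cj using g(2) bbound_props(2)[of \<kappa> a 1] by (intro mult_mono) auto
    also have "bbound q \<kappa> b 3 = bbound q \<kappa> 1 a" using bbound_props(4)[where a = 1 and b = a] that by simp
    finally show ?thesis using bbound_offdiag[of a 1 \<kappa>] that by simp
  qed
  have eq: "g$3$1 * cj (g$1$3) + g$2$1 * cj (g$2$3) + g$1$1 * cj (g$3$3) = 1"
    using g(1) unfolding GG_iff by (simp add: beta_def)
  have "av (g$3$1 * cj (g$1$3) + g$2$1 * cj (g$2$3)) < 1"
    using small[of 3 1] small[of 2 2] by (intro av_add_less) auto
  then have "av (- (g$3$1 * cj (g$1$3) + g$2$1 * cj (g$2$3)) + 1) = av (1::'e)"
    by (intro av_add_eq) (simp only: av_minus av_one)
  moreover have "g$1$1 * cj (g$3$3) = - (g$3$1 * cj (g$1$3) + g$2$1 * cj (g$2$3)) + 1"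
    unfolding eq[symmetric] by simp
  ultimately have "av (g$1$1 * cj (g$3$3)) = 1" by simp
  then have 1: "av (g$1$1) * av (g$3$3) = 1" by (simp add: av_mult)
  have le: "av (g$1$1) \<le> 1" "av (g$3$3) \<le> 1"
    using g(2)[of 1 1] g(2)[of 3 3] by (simp_all only: bbound_props)
  have "1 \<le> av (g$1$1)" using mult_left_le[OF le(2), of "av (g$1$1)"] 1 by simp
  then show ?thesis using le(1) by simp
qed

text \<open>For \<open>K_one\<close> only the corner bound differs and discreteness sharpens it. For
  \<open>K_zero\<close> unitarity propagates: the first column is isotropic, so \<open>g$2$1\<close>
  is small; its pairing with the third column makes \<open>g$1$1\<close> a unit; orthogonality to
  the second column makes \<open>g$3$2\<close> small.\<close>

lemma BB_if_31:
  assumes K: "g \<in> KK \<kappa>" and s: "av (g $ 3 $ 1) < kbound q \<kappa> 3 1"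
  shows "g \<in> BB \<kappa>"
proof (cases \<kappa>)
  case K_one
  have "av (g $ 3 $ 1) \<le> q * q" unfolding av_less_q_iff[symmetric] using s by (simp add: K_one)
  then show ?thesis using K by (simp add: bounded_by_def K_one forall_3)
next
  case K_zero
  have g: "g \<in> carrier GG" "\<And>a b. av (g $ a $ b) \<le> 1" using K by (auto simp: bounded_by_def K_zero)
  have c: "av (g $ 3 $ 1) < 1" using s by (simp add: K_zero)
  have prod: "av (x * cj y) < 1" if "av x < 1" "av y \<le> 1" for x y :: 'e
    using mult_left_le[of "av y" "av x"] that by (simp add: av_mult)
  have prod': "av (x * cj y) < 1" if "av x \<le> 1" "av y < 1" for x y :: 'e
    using mult_left_le[of "av x" "av y"] that by (simp add: av_mult mult.commute)
  have "g$3$1 * cj (g$1$1) + g$2$1 * cj (g$2$1) + g$1$1 * cj (g$3$1) = 0"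
    using g(1) unfolding GG_iff by (simp add: beta_def)
  then have "g$2$1 * cj (g$2$1) = - (g$3$1 * cj (g$1$1) + g$1$1 * cj (g$3$1))"
    by (simp add: eq_neg_iff_add_eq_0 algebra_simps)
  moreover have "av (- (g$3$1 * cj (g$1$1) + g$1$1 * cj (g$3$1))) < 1"
    unfolding av_minus by (rule av_add_less[OF prod[OF c g(2)] prod'[OF g(2) c]])
  ultimately have "av (g$2$1) * av (g$2$1) < 1" by (metis av_cj av_mult)
  then have b: "av (g$2$1) < 1" using g(2)[of 2 1] by (metis less_eq_real_def less_irrefl mult_1)
  have eq1: "g$3$1 * cj (g$1$3) + g$2$1 * cj (g$2$3) + g$1$1 * cj (g$3$3) = 1"
    and eq2: "g$3$1 * cj (g$1$2) + g$2$1 * cj (g$2$2) + g$1$1 * cj (g$3$2) = 0"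
    using g(1) unfolding GG_iff by (simp_all add: beta_def)
  have a: "av (g$1$1) = 1"
  proof (rule ccontr)
    assume "av (g$1$1) \<noteq> 1"
    then have "av (g$1$1) < 1" using g(2)[of 1 1] by simp
    then have "av (g$3$1 * cj (g$1$3) + g$2$1 * cj (g$2$3) + g$1$1 * cj (g$3$3)) < 1"
      using b c g(2) by (intro av_add_less prod) auto
    then show False by (simp add: eq1)
  qed
  have "g$1$1 * cj (g$3$2) = - (g$3$1 * cj (g$1$2) + g$2$1 * cj (g$2$2))"
    using eq2 by (simp add: eq_neg_iff_add_eq_0 algebra_simps)
  moreover have "av (- (g$3$1 * cj (g$1$2) + g$2$1 * cj (g$2$2))) < 1"
    unfolding av_minus by (rule av_add_less[OF prod[OF c g(2)] prod[OF b g(2)]])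
  ultimately have "av (g$1$1) * av (g$3$2) < 1" by (metis av_cj av_mult)
  then have "av (g$3$2) < 1" using a by simp
  then show ?thesis using b c K by (simp add: bounded_by_def K_zero forall_3 av_discrete)
qed

lemma red_upper_iff:
  assumes "g \<in> KK \<kappa>"
  shows "red_upper w \<kappa> g \<longleftrightarrow> g \<in> BB \<kappa>"
proof (cases \<kappa>)
  case K_zero
  then show ?thesis using assms by (auto simp: bounded_by_def forall_3 max_ideal_iff)
next
  case K_one
  have "inverse w * g $ 3 $ 1 \<in> max_ideal \<longleftrightarrow> av (g $ 3 $ 1) \<le> q * q"
  proof -
    have "inverse w * g $ 3 $ 1 = g $ 3 $ 1 / w" by (simp add: divide_inverse mult.commute)
    then show ?thesis unfolding av_less_q_iff[symmetric]
      by (simp only: max_ideal_def mem_Collect_eq av_divide pos_divide_less_eq[OF q_pos] mult_1)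
  qed
  then show ?thesis using assms K_one by (auto simp: bounded_by_def forall_3)
qed

lemma red_unipotent_iff:
  assumes "g \<in> KK \<kappa>"
  shows "red_unipotent w \<kappa> g \<longleftrightarrow> g \<in> UU \<kappa>"
  using red_upper_iff[OF assms] by (simp add: red_unipotent_def UU_def max_ideal_def)

text \<open>Modulo the maximal ideal the diagonal is multiplicative on \<open>BB\<close>, because
  products of opposite off-diagonal entries are small by \<open>bbound_offdiag\<close>.\<close>

lemma UU_subgroup: "subgroup (UU \<kappa>) GG"
proof (rule GG.subgroupI)
  show "UU \<kappa> \<noteq> {}"
    using subgroup.one_closed[OF BB_subgroup, of \<kappa>] by (auto simp: UU_def mat_def intro!: exI[of _ "mat 1"])
  fix g assume g: "g \<in> UU \<kappa>"
  then have gB: "g \<in> BB \<kappa>" and gG: "g \<in> carrier GG" by (auto simp: UU_def bounded_by_def)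
  have "adj cj g $ i $ i - 1 = cj (g $ rev3 i $ rev3 i - 1)" for i by (simp add: adj_def cj_diff)
  then show "inv\<^bsub>GG\<^esub> g \<in> UU \<kappa>"
    using subgroup.m_inv_closed[OF BB_subgroup gB] g by (simp add: UU_def adj_GG[OF gG])
  fix h assume h: "h \<in> UU \<kappa>"
  then have hB: "h \<in> BB \<kappa>" by (simp add: UU_def)
  have off: "av (g $ i $ k * h $ k $ i) < 1" if "i \<noteq> k" for i k
  proof -
    have "av (g $ i $ k * h $ k $ i) \<le> bbound q \<kappa> i k * bbound q \<kappa> k i"
      unfolding av_mult using gB hB bbound_props(2)[of \<kappa> i k] by (intro mult_mono) (auto simp: bounded_by_def)
    then show ?thesis using bbound_offdiag[OF that, of \<kappa>] by simp
  qed
  have on: "av (g $ i $ i * h $ i $ i - 1) < 1" for i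
  proof -
    have "av (h $ i $ i) \<le> bbound q \<kappa> i i" using hB by (simp add: bounded_by_def)
    then have "av (h $ i $ i) \<le> 1" by (simp only: bbound_props)
    then have "av ((g $ i $ i - 1) * h $ i $ i) < 1"
      using g mult_left_le[of "av (h $ i $ i)" "av (g $ i $ i - 1)"] by (auto simp: UU_def av_mult intro: le_less_trans)
    then have "av ((g $ i $ i - 1) * h $ i $ i + (h $ i $ i - 1)) < 1"
      using h by (intro av_add_less) (simp_all add: UU_def)
    then show ?thesis by (simp add: algebra_simps)
  qed
  have "av ((g ** h) $ i $ i - 1) < 1" for i
  proof -
    have e: "(g ** h) $ 1 $ 1 - 1 = (g$1$1 * h$1$1 - 1) + (g$1$2 * h$2$1 + g$1$3 * h$3$1)"
      "(g ** h) $ 2 $ 2 - 1 = (g$2$2 * h$2$2 - 1) + (g$2$1 * h$1$2 + g$2$3 * h$3$2)"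
      "(g ** h) $ 3 $ 3 - 1 = (g$3$3 * h$3$3 - 1) + (g$3$1 * h$1$3 + g$3$2 * h$2$3)"
      by (simp_all add: matrix_matrix_mult_def sum_3)
    have "av ((g ** h) $ 1 $ 1 - 1) < 1" "av ((g ** h) $ 2 $ 2 - 1) < 1" "av ((g ** h) $ 3 $ 3 - 1) < 1"
      unfolding e by (intro av_add_less off on; simp)+
    then show ?thesis using exhaust_3[of i] by auto
  qed
  then show "g \<otimes>\<^bsub>GG\<^esub> h \<in> UU \<kappa>"
    using subgroup.m_closed[OF BB_subgroup gB hB] by (simp add: UU_def)
qed (auto simp: UU_def bounded_by_def)

end

text \<open>
  For \<open>q = r\<^sup>4\<close> these weights give \<open>u - 1\<close> norm at most \<open>r < 1\<close> for all \<open>u\<close> in the pro-\<open>p\<close> Iwahori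
  subgroup, so that \<open>u ^ (p ^ i)\<close> tends to \<open>1\<close>.
\<close>

fun weight :: "real \<Rightarrow> max_compact \<Rightarrow> 3 \<Rightarrow> real" where
  "weight r K_zero a = (vector [1, r, r ^ 2] :: real^3) $ a"
| "weight r K_one a = (vector [1, r ^ 3, r ^ 6] :: real^3) $ a"

text \<open>Each case compares exponents of \<open>r\<close>. Equality occurs exactly next to the
  diagonal, above it for \<open>K_zero\<close> and below it for \<open>K_one\<close>.\<close>

lemma bbound_le_weight:
  fixes r :: real
  assumes r: "0 < r" "r < 1"
  shows "\<forall>a. 0 < weight r \<kappa> a" "\<forall>a b. a \<noteq> b \<longrightarrow> bbound (r ^ 4) \<kappa> a b \<le> r * (weight r \<kappa> a / weight r \<kappa> b)"
proof -
  have le: "r ^ m \<le> r ^ n" if "n \<le> m" for m n using r that by (simp add: power_decreasing)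
  have d: "r ^ m \<le> r * (r ^ k / r ^ n)" if "k + 1 \<le> m + n" for m n k
  proof -
    have "r ^ m * r ^ n \<le> r ^ (k + 1)" unfolding power_add[symmetric] by (rule le[OF that])
    then show ?thesis using r by (simp add: pos_le_divide_eq mult.commute)
  qed
  have d': "1 / r ^ m \<le> r * (r ^ k / r ^ n)" if "k + 1 + m \<le> n" for m n k
  proof -
    have "r ^ n \<le> r ^ (k + 1 + m)" by (rule le[OF that])
    then show ?thesis using r by (simp add: field_simps power_add)
  qed
  show "\<forall>a. 0 < weight r \<kappa> a" using r by (cases \<kappa>) (simp_all add: forall_3)
  show "\<forall>a b. a \<noteq> b \<longrightarrow> bbound (r ^ 4) \<kappa> a b \<le> r * (weight r \<kappa> a / weight r \<kappa> b)"
    using d[of 0 0 1] d[of 0 0 2] d[of 1 0 2] d[of 0 1 2] d[of 1 4 0] d[of 2 4 0] d[of 2 4 1]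
      d[of 0 0 3] d[of 3 0 6] d[of 3 4 0] d[of 6 8 0] d[of 6 4 3] d'[of 0 4 6] le[of 2 4] r
    by (cases \<kappa>) (simp_all add: forall_3 flip: power_add)
qed

context unramified_extension
begin

text \<open>Up to a quadratic error, \<open>g^p - 1\<close> is \<open>p (g - 1)\<close>. Each p-th
  power thus shrinks the weighted norm by a fixed factor below one. Weights are used because
  \<open>u - 1\<close> may have entries of size one or more above the diagonal.\<close>

lemma UU_powers:
  assumes p: "av (of_nat p :: 'e) < 1" and V: "open V" "mat 1 \<in> V" and u: "u \<in> UU \<kappa>"
  shows "\<exists>i::nat. u [^]\<^bsub>GG\<^esub> (p ^ i) \<in> V"
proof -
  define r where "r = root 4 q"
  have r: "0 < r" "r < 1" "r ^ 4 = q" using q_pos q_less by (auto simp: r_def)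
  define h where "h = weight r \<kappa>"
  have h: "0 < h a" for a using bbound_le_weight(1)[OF r(1,2)] by (simp add: h_def)
  \<comment> \<open>One rate for both terms: \<open>av (of_nat p)\<close> controls the linear term,
    and \<open>r\<close>, which bounds the current norm, the quadratic one.\<close>
  define \<rho> where "\<rho> = max (av (of_nat p :: 'e)) r"
  have \<rho>: "0 < \<rho>" "\<rho> < 1" "r \<le> \<rho>" "av (of_nat p :: 'e) \<le> \<rho>" using p r by (auto simp: \<rho>_def)
  have uG: "u \<in> carrier GG" using u by (simp add: UU_def bounded_by_def)
  have "wnorm_le h r (u - mat 1)"
    unfolding wnorm_le_def
  proof (intro allI)
    fix a b
    show "av ((u - mat 1) $ a $ b) \<le> r * (h a / h b)"
    proof (cases "a = b")
      case True
      have "av (u $ a $ a - 1) \<le> q" using u by (simp add: UU_def av_discrete[symmetric])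
      also have "q \<le> r" unfolding r(3)[symmetric] using power_decreasing[of 1 4 r] r by simp
      finally show ?thesis using True h[of a] by (simp add: mat_def)
    next
      case False
      have "av (u $ a $ b) \<le> bbound (r ^ 4) \<kappa> a b" using u by (simp add: UU_def bounded_by_def r(3))
      also have "\<dots> \<le> r * (h a / h b)" using bbound_le_weight(2)[OF r(1,2), of \<kappa>] False unfolding h_def by blast
      finally show ?thesis using False by (simp add: mat_def)
    qed
  qed
  then have pw: "wnorm_le h (\<rho> ^ i * r) (u [^]\<^bsub>GG\<^esub> (p ^ i) - mat 1)" for i
  proof (induction i)
    case 0
    then show ?case using uG GG.nat_pow_eone[of u] by simp
  next
    case (Suc i)
    let ?g = "u [^]\<^bsub>GG\<^esub> (p ^ i)" and ?c = "\<rho> ^ i * r"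
    have N: "wnorm_le h ?c (?g - mat 1)" using Suc by simp
    have c: "0 \<le> ?c" "?c \<le> r"
      using \<rho> r power_le_one[of \<rho> i] mult_left_le_one_le[of r "\<rho> ^ i"] by auto
    then have c1: "?c \<le> 1" using r by linarith
    have R: "wnorm_le h (?c * ?c) (?g [^]\<^bsub>GG\<^esub> p - mat 1 - of_nat p * (?g - mat 1))"
      by (rule wnorm_le_power(2)[OF h c(1) c1 N])
    have "wnorm_le h (\<rho> * ?c) (?g [^]\<^bsub>GG\<^esub> p - mat 1 - of_nat p * (?g - mat 1))"
      by (rule wnorm_le_mono[OF h _ R]) (rule mult_right_mono; use c \<rho> in linarith)
    moreover have "wnorm_le h (\<rho> * ?c) (of_nat p * (?g - mat 1))"
      unfolding wnorm_le_def
    proof (intro allI)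
      fix a b
      have "av ((of_nat p * (?g - mat 1)) $ a $ b) = av (of_nat p :: 'e) * av ((?g - mat 1) $ a $ b)"
        by (simp add: av_mult of_nat_index)
      also have "\<dots> \<le> \<rho> * (?c * (h a / h b))"
        using N \<rho> unfolding wnorm_le_def by (intro mult_mono) auto
      finally show "av ((of_nat p * (?g - mat 1)) $ a $ b) \<le> \<rho> * ?c * (h a / h b)" by (simp only: mult.assoc)
    qed
    ultimately have "wnorm_le h (\<rho> * ?c) (?g [^]\<^bsub>GG\<^esub> p - mat 1 - of_nat p * (?g - mat 1) + of_nat p * (?g - mat 1))"
      by (rule wnorm_le_add)
    moreover have "u [^]\<^bsub>GG\<^esub> (p ^ Suc i) = ?g [^]\<^bsub>GG\<^esub> p"
      using GG.nat_pow_pow[OF uG, of "p ^ i" p] by (simp only: power_Suc2)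
    ultimately show ?case by (simp add: mult.assoc)
  qed
  have "(\<lambda>i. u [^]\<^bsub>GG\<^esub> (p ^ i)) \<longlonglongrightarrow> mat 1"
  proof (intro vec_tendstoI)
    fix a b
    have "dist ((u [^]\<^bsub>GG\<^esub> (p ^ i)) $ a $ b) (mat 1 $ a $ b) \<le> \<rho> ^ i * (r * (h a / h b))" for i
      using pw[of i] unfolding wnorm_le_def
      by (simp add: dist_av[of "(u [^]\<^bsub>GG\<^esub> (p ^ i)) $ a $ b"] mult.assoc)
    moreover have "(\<lambda>i. \<rho> ^ i * (r * (h a / h b))) \<longlonglongrightarrow> 0"
      using \<rho> by (intro tendsto_mult_left_zero LIMSEQ_power_zero) simp
    ultimately show "(\<lambda>i. (u [^]\<^bsub>GG\<^esub> (p ^ i)) $ a $ b) \<longlonglongrightarrow> mat 1 $ a $ b" by (rule tendsto_dist_le)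
  qed
  then have "eventually (\<lambda>i. u [^]\<^bsub>GG\<^esub> (p ^ i) \<in> V) sequentially"
    using V by (rule topological_tendstoD)
  then show ?thesis unfolding eventually_sequentially by blast
qed

section \<open>Diagonal, Weyl and unipotent elements; the Bruhat decomposition\<close>

definition dg :: "(3 \<Rightarrow> 'e) \<Rightarrow> 'e mat3" where
  "dg d = (\<chi> i j. if i = j then d i else 0)"

definition al :: "3 \<Rightarrow> 'e" where
  "al i = (vector [inverse w, 1, w] :: 'e^3) $ i"

fun sv :: "max_compact \<Rightarrow> 3 \<Rightarrow> 'e" where
  "sv K_zero i = 1"
| "sv K_one i = al i"

text \<open>This is \<open>beta\<close> for \<open>K_zero\<close> and \<open>alpha w ** beta\<close>
  for \<open>K_one\<close>; the scaling puts the involution into the second maximal compact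
  subgroup.\<close>

definition smat :: "max_compact \<Rightarrow> 'e mat3" where
  "smat \<kappa> = (\<chi> i j. if j = rev3 i then sv \<kappa> i else 0)"

lemma dg_mult: "(dg d ** g) $ i $ j = d i * g $ i $ j" "(g ** dg d) $ i $ j = g $ i $ j * d j"
  by (simp_all add: dg_def matrix_matrix_mult_def if_distrib[where f = "\<lambda>x. x * _"]
      if_distrib[where f = "\<lambda>x. _ * x"] sum.delta sum.delta' cong: if_cong)

lemma smat_mult: "(smat \<kappa> ** g) $ i $ j = sv \<kappa> i * g $ rev3 i $ j"
  by (simp add: smat_def matrix_matrix_mult_def if_distrib[where f = "\<lambda>x. x * _"] cong: if_cong)

lemma mult_smat: "(g ** smat \<kappa>) $ i $ j = g $ i $ rev3 j * sv \<kappa> (rev3 j)"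
proof -
  have "j = rev3 k \<longleftrightarrow> k = rev3 j" for k by (metis rev3_rev3)
  then show ?thesis
    by (simp add: smat_def matrix_matrix_mult_def if_distrib[where f = "\<lambda>x. _ * x"] cong: if_cong)
qed

lemma al_rev3 [simp]: "al i * al (rev3 i) = 1" "al (rev3 i) * al i = 1"
  using exhaust_3[of i] w_nonzero by (auto simp: al_def)

lemma cj_al [simp]: "cj (al i) = al i"
  using exhaust_3[of i] by (auto simp: al_def cj_inverse)

lemma sv_rev3 [simp]: "sv \<kappa> i * sv \<kappa> (rev3 i) = 1" "sv \<kappa> (rev3 i) * sv \<kappa> i = 1"
  by (cases \<kappa>; simp)+

lemma alpha_eq: "alpha w = dg al"
  by (simp add: alpha_def dg_def al_def vec_eq_iff forall_3)

lemma alpha_GG: "alpha w \<in> carrier GG"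
  unfolding GG_iff by (simp add: forall_3 alpha_def beta_def cj_inverse w_nonzero)

lemma adj_alpha: "inv\<^bsub>GG\<^esub> (alpha w) = dg (\<lambda>i. al (rev3 i))"
proof -
  have "rev3 a = rev3 b \<longleftrightarrow> a = b" for a b by (metis rev3_rev3)
  then show ?thesis unfolding adj_GG[OF alpha_GG] by (auto simp: adj_def alpha_eq dg_def vec_eq_iff)
qed

lemma smat_square: "smat \<kappa> ** smat \<kappa> = mat 1"
  by (auto simp: vec_eq_iff smat_mult) (auto simp: smat_def mat_def)

lemma smat_GG: "smat \<kappa> \<in> carrier GG"
  unfolding GG_iff by (cases \<kappa>) (simp_all add: forall_3 smat_def beta_def al_def cj_inverse w_nonzero)

lemma smat_KK: "smat \<kappa> \<in> KK \<kappa>"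
  using smat_GG[of \<kappa>] by (cases \<kappa>) (simp_all add: bounded_by_def forall_3 smat_def al_def av_inverse divide_inverse)

lemma smat_alpha_smat: "smat \<kappa> ** alpha w ** smat \<kappa> = inv\<^bsub>GG\<^esub> (alpha w)"
proof -
  have rr: "rev3 i = rev3 j \<longleftrightarrow> i = j" for i j by (metis rev3_rev3)
  have "(smat \<kappa> ** alpha w ** smat \<kappa>) $ i $ j = dg (\<lambda>i. al (rev3 i)) $ i $ j" for i j
    unfolding mult_smat smat_mult alpha_eq
    by (auto simp: dg_def rr mult.assoc[of "sv \<kappa> j"] mult.commute[of "al (rev3 j)"])
  then show ?thesis by (simp only: adj_alpha vec_eq_iff) simp
qed

text \<open>A unipotent upper triangular unitary matrix is determined by its first row: the entry
  \<open>- cj y\<close> is forced by orthogonality of rows one and two.\<close>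

definition nmat :: "'e \<Rightarrow> 'e \<Rightarrow> 'e mat3" where
  "nmat y z = vector [vector [1, y, z], vector [0, 1, - cj y], vector [0, 0, 1]]"

lemma nmat_entries [simp]:
  "nmat y z $ 1 $ 1 = 1" "nmat y z $ 1 $ 2 = y" "nmat y z $ 1 $ 3 = z"
  "nmat y z $ 2 $ 1 = 0" "nmat y z $ 2 $ 2 = 1" "nmat y z $ 2 $ 3 = - cj y"
  "nmat y z $ 3 $ 1 = 0" "nmat y z $ 3 $ 2 = 0" "nmat y z $ 3 $ 3 = 1"
  by (simp_all add: nmat_def)

lemma nmat_GG: "z + cj z + y * cj y = 0 \<Longrightarrow> nmat y z \<in> carrier GG"
proof -
  assume "z + cj z + y * cj y = 0"
  then have "z + cj z = - (y * cj y)" by (simp add: eq_neg_iff_add_eq_0)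
  then show ?thesis unfolding GG_iff by (simp add: forall_3 beta_def algebra_simps)
qed

lemma nmat_UU:
  assumes "z + cj z + y * cj y = 0" "av y \<le> 1" "av z \<le> kbound q \<kappa> 1 3"
  shows "nmat y z \<in> UU \<kappa>"
  using assms nmat_GG[OF assms(1)]
  by (cases \<kappa>) (simp_all add: UU_def bounded_by_def forall_3)

text \<open>A trace zero element of maximal size is put into the upper right corner; conjugation
  moves it to the lower left, where its size attains the bound for \<open>KK\<close> and exceeds
  that for \<open>BB\<close>.\<close>

lemma smat_not_normalizes: "\<exists>u\<in>UU \<kappa>. smat \<kappa> ** u ** smat \<kappa> \<notin> BB \<kappa>"
proof -
  obtain z where z: "cj z = - z" "av z = 1" by (rule trace_zero_unit)
  define z' where "z' = (case \<kappa> of K_zero \<Rightarrow> z | K_one \<Rightarrow> inverse w * z)"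
  have "nmat 0 z' \<in> UU \<kappa>"
    by (rule nmat_UU) (use z in \<open>simp_all add: z'_def cj_mult cj_inverse av_mult av_inverse divide_inverse split: max_compact.split\<close>)
  moreover have "(smat \<kappa> ** nmat 0 z' ** smat \<kappa>) $ 3 $ 1 = sv \<kappa> 3 * z' * sv \<kappa> 3"
    by (simp add: mult_smat smat_mult)
  then have "av ((smat \<kappa> ** nmat 0 z' ** smat \<kappa>) $ 3 $ 1) = kbound q \<kappa> 3 1"
    using z q_pos by (cases \<kappa>) (simp_all add: z'_def av_mult av_inverse al_def)
  moreover have "bbound q \<kappa> 3 1 < kbound q \<kappa> 3 1"
    using q_less q_powers[OF q_pos q_less] by (cases \<kappa>) simp_all
  ultimately have "smat \<kappa> ** nmat 0 z' ** smat \<kappa> \<notin> BB \<kappa>"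
    unfolding bounded_by_def by (metis (mono_tags, lifting) mem_Collect_eq not_le)
  then show ?thesis using \<open>nmat 0 z' \<in> UU \<kappa>\<close> by blast
qed

text \<open>Column reduction: outside \<open>BB\<close> the entry \<open>g$3$1\<close> has maximal
  size, so it can clear the first column. After division by the unipotent factor and by
  \<open>s\<close> the lower left entry is zero, and \<open>BB_if_31\<close> applies.\<close>

lemma bruhat_KK:
  assumes g: "g \<in> KK \<kappa>" and nB: "g \<notin> BB \<kappa>"
  shows "\<exists>u\<in>UU \<kappa>. \<exists>b\<in>BB \<kappa>. g = u ** smat \<kappa> ** b"
proof -
  let ?a = "g$1$1" and ?b = "g$2$1" and ?c = "g$3$1"
  have gG: "g \<in> carrier GG" and bd: "\<And>a b. av (g $ a $ b) \<le> kbound q \<kappa> a b"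
    using g by (auto simp: bounded_by_def)
  have c: "av ?c = kbound q \<kappa> 3 1" using bd[of 3 1] BB_if_31[OF g] nB by fastforce
  then have c0: "?c \<noteq> 0" using kbound_props(2)[of \<kappa> 3 1] by auto
  \<comment> \<open>With these values the last column of \<open>nmat y z\<close> is the first column
    of \<open>g\<close> divided by its last entry; isotropy of that column is the unitarity
    condition \<open>cond\<close>.\<close>
  define y z where "y = - cj (?b / ?c)" and "z = ?a / ?c"
  have iso: "?c * cj ?a + ?b * cj ?b + ?a * cj ?c = 0"
    using gG unfolding GG_iff by (simp add: beta_def)
  have "z + cj z + y * cj y = (?c * cj ?a + ?b * cj ?b + ?a * cj ?c) / (?c * cj ?c)"
    using c0 by (simp add: y_def z_def cj_divide field_simps)
  then have cond: "z + cj z + y * cj y = 0" by (simp add: iso)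
  have "av ?b \<le> av ?c" using bd[of 2 1] c by (cases \<kappa>) simp_all
  then have avy: "av y \<le> 1" using c0 by (simp add: y_def av_divide)
  have avz: "av z \<le> kbound q \<kappa> 1 3"
    using bd[of 1 1] c q_pos by (cases \<kappa>) (simp_all add: z_def av_divide divide_right_mono)
  let ?n = "nmat y z"
  have n: "?n \<in> UU \<kappa>" using nmat_UU[OF cond avy avz] .
  then have nB: "?n \<in> BB \<kappa>" and nG: "?n \<in> carrier GG" by (auto simp: UU_def bounded_by_def)
  let ?h = "adj cj ?n ** g" and ?s = "smat \<kappa>"
  have hK: "?h \<in> KK \<kappa>"
    using subgroup.m_closed[OF KK_subgroup subgroup.m_inv_closed[OF KK_subgroup subsetD[OF BB_subset nB]] g]
    by (simp add: adj_GG[OF nG])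
  have "?h $ 1 $ 1 = ?a - y * ?b + cj z * ?c"
    by (simp add: matrix_matrix_mult_def sum_3 adj_def)
  also have "\<dots> = (?c * cj ?a + ?b * cj ?b + ?a * cj ?c) / cj ?c"
    using c0 by (simp add: y_def z_def cj_divide field_simps)
  finally have h11: "?h $ 1 $ 1 = 0" by (simp add: iso)
  have sK: "?s ** ?h \<in> KK \<kappa>"
    using subgroup.m_closed[OF KK_subgroup smat_KK hK] by simp
  have "(?s ** ?h) $ 3 $ 1 = 0" by (simp add: smat_mult h11)
  then have "?s ** ?h \<in> BB \<kappa>" using BB_if_31[OF sK] kbound_props(2)[of \<kappa> 3 1] by simp
  moreover have "g = ?n ** ?s ** (?s ** ?h)"
  proof -
    have "?n ** ?s ** (?s ** ?h) = ?n ** (?s ** ?s) ** adj cj ?n ** g" by (simp only: matrix_mul_assoc)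
    also have "\<dots> = g" using adj_mult(2)[of ?n] nG by (simp add: smat_square carrier_GG)
    finally show ?thesis by simp
  qed
  ultimately show ?thesis using n by blast
qed

section \<open>The Iwahori factorization and its behaviour under conjugation\<close>

definition upper_BB :: "max_compact \<Rightarrow> 'e mat3 set" where
  "upper_BB \<kappa> = {g \<in> BB \<kappa>. g$2$1 = 0 \<and> g$3$1 = 0 \<and> g$3$2 = 0}"

definition lower_BB :: "max_compact \<Rightarrow> 'e mat3 set" where
  "lower_BB \<kappa> = {g \<in> BB \<kappa>. g$1$2 = 0 \<and> g$1$3 = 0 \<and> g$2$3 = 0}"

lemma upper_BB_inv: "u \<in> upper_BB \<kappa> \<Longrightarrow> inv\<^bsub>GG\<^esub> u \<in> upper_BB \<kappa>"
  using subgroup.m_inv_closed[OF BB_subgroup, of u \<kappa>] adj_GG[of u]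
  by (auto simp: upper_BB_def bounded_by_def adj_def)

lemma lower_BB_inv: "u \<in> lower_BB \<kappa> \<Longrightarrow> inv\<^bsub>GG\<^esub> u \<in> lower_BB \<kappa>"
  using subgroup.m_inv_closed[OF BB_subgroup, of u \<kappa>] adj_GG[of u]
  by (auto simp: lower_BB_def bounded_by_def adj_def)

text \<open>The unipotent factor has first row \<open>(1, g\<^sub>1\<^sub>2 / g\<^sub>1\<^sub>1, g\<^sub>1\<^sub>3 / g\<^sub>1\<^sub>1)\<close>; unitarity forces the quotient to be
  lower triangular once its first row is.\<close>

lemma lower_upper_factorization:
  assumes g: "g \<in> BB \<kappa>"
  shows "\<exists>l\<in>lower_BB \<kappa>. \<exists>u\<in>upper_BB \<kappa>. g = l ** u"
proof -
  have gG: "g \<in> carrier GG" and bd: "\<And>a b. av (g $ a $ b) \<le> bbound q \<kappa> a b"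
    using g by (auto simp: bounded_by_def)
  have a1: "av (g$1$1) = 1" by (rule BB_diag[OF g])
  then have a0: "g$1$1 \<noteq> 0" by auto
  define y z where "y = g$1$2 / g$1$1" and "z = g$1$3 / g$1$1"
  have iso: "g$1$1 * cj (g$1$3) + g$1$2 * cj (g$1$2) + g$1$3 * cj (g$1$1) = 0"
    using GG_row[OF gG, of 1 1] by (simp add: beta_def)
  have "z + cj z + y * cj y =
      (g$1$1 * cj (g$1$3) + g$1$2 * cj (g$1$2) + g$1$3 * cj (g$1$1)) / (g$1$1 * cj (g$1$1))"
    using a0 by (simp add: y_def z_def cj_divide field_simps)
  then have cond: "z + cj z + y * cj y = 0" by (simp add: iso)
  have avy: "av y \<le> 1" using bd[of 1 2] a1 by (cases \<kappa>) (simp_all add: y_def av_divide)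
  have avz: "av z \<le> kbound q \<kappa> 1 3" using bd[of 1 3] a1 by (cases \<kappa>) (simp_all add: z_def av_divide)
  let ?n = "nmat y z"
  have nB: "?n \<in> BB \<kappa>" using nmat_UU[OF cond avy avz] by (simp add: UU_def)
  then have nG: "?n \<in> carrier GG" by (simp add: bounded_by_def)
  define l where "l = g ** adj cj ?n"
  have lB: "l \<in> BB \<kappa>"
    using subgroup.m_closed[OF BB_subgroup g subgroup.m_inv_closed[OF BB_subgroup nB]]
    by (simp add: adj_GG[OF nG] l_def)
  then have lG: "l \<in> carrier GG" by (simp add: bounded_by_def)
  have l11: "l$1$1 = g$1$1" by (simp add: l_def matrix_matrix_mult_def sum_3 adj_def)
  have l12: "l$1$2 = 0" using a0 by (simp add: l_def matrix_matrix_mult_def sum_3 adj_def y_def)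
  have "l$1$3 = g$1$1 * (z + cj z + y * cj y)"
    using a0 by (simp add: l_def matrix_matrix_mult_def sum_3 adj_def) (simp add: y_def z_def algebra_simps)
  then have l13: "l$1$3 = 0" by (simp add: cond)
  have "l$1$1 * cj (l$2$3) = 0" using GG_row[OF lG, of 1 2] l12 l13 by (simp add: beta_def)
  then have l23: "l$2$3 = 0" using a0 l11 by simp
  have "l ** ?n = g ** (adj cj ?n ** ?n)" by (simp only: l_def matrix_mul_assoc)
  then have "g = l ** ?n" using adj_mult(1)[of ?n] nG by (simp add: carrier_GG)
  moreover have "l \<in> lower_BB \<kappa>" using lB l12 l13 l23 by (simp add: lower_BB_def)
  moreover have "?n \<in> upper_BB \<kappa>" using nB by (simp add: upper_BB_def)
  ultimately show ?thesis by blast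
qed

lemma upper_lower_factorization:
  assumes g: "g \<in> BB \<kappa>"
  shows "\<exists>u\<in>upper_BB \<kappa>. \<exists>l\<in>lower_BB \<kappa>. g = u ** l"
proof -
  obtain l u where lu: "l \<in> lower_BB \<kappa>" "u \<in> upper_BB \<kappa>" "inv\<^bsub>GG\<^esub> g = l ** u"
    using lower_upper_factorization[OF subgroup.m_inv_closed[OF BB_subgroup g]] by blast
  have c: "g \<in> carrier GG" "l \<in> carrier GG" "u \<in> carrier GG"
    using g lu by (auto simp: bounded_by_def lower_BB_def upper_BB_def)
  have "g = inv\<^bsub>GG\<^esub> (l \<otimes>\<^bsub>GG\<^esub> u)" using GG.inv_inv[OF c(1)] lu(3) by simp
  also have "\<dots> = inv\<^bsub>GG\<^esub> u \<otimes>\<^bsub>GG\<^esub> inv\<^bsub>GG\<^esub> l" by (rule GG.inv_mult_group[OF c(2,3)])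
  finally show ?thesis using upper_BB_inv[OF lu(2)] lower_BB_inv[OF lu(1)] by auto
qed

lemma BB_if_le:
  assumes "g \<in> BB \<kappa>" "g' \<in> carrier GG" "\<And>a b. av (g' $ a $ b) \<le> av (g $ a $ b)"
  shows "g' \<in> BB \<kappa>"
  using assms order_trans unfolding bounded_by_def by blast

lemma conj_alpha_closed:
  assumes "g \<in> carrier GG"
  shows "inv\<^bsub>GG\<^esub> (alpha w) ** g ** alpha w \<in> carrier GG" "alpha w ** g ** inv\<^bsub>GG\<^esub> (alpha w) \<in> carrier GG"
    "smat \<kappa> ** g ** smat \<kappa> \<in> carrier GG"
proof -
  note m = GG.m_closed[unfolded GG_simps] and i = GG.inv_closed[OF alpha_GG]
  show "inv\<^bsub>GG\<^esub> (alpha w) ** g ** alpha w \<in> carrier GG" by (rule m[OF m[OF i assms] alpha_GG])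
  show "alpha w ** g ** inv\<^bsub>GG\<^esub> (alpha w) \<in> carrier GG" by (rule m[OF m[OF alpha_GG assms] i])
  show "smat \<kappa> ** g ** smat \<kappa> \<in> carrier GG" by (rule m[OF m[OF smat_GG assms] smat_GG])
qed

lemma q_mult_le: "q * x \<le> x" if "0 \<le> x" for x
  using q_pos q_less that by (simp add: mult_left_le_one_le)

lemma q2_mult_le: "q * (q * x) \<le> x" if "0 \<le> x" for x
proof -
  have "0 \<le> q * x" using that q_pos by simp
  then have "q * (q * x) \<le> q * x" by (rule q_mult_le)
  also have "\<dots> \<le> x" by (rule q_mult_le[OF that])
  finally show ?thesis .
qed

lemma w_cancel: "w * (inverse w * x) = x" "inverse w * (w * x) = x"
  "q * (inverse q * c) = c" "inverse q * (q * c) = c"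
  using w_nonzero by simp_all

text \<open>Conjugation multiplies the entries next to the diagonal by \<open>w\<close> and the
  corner by its square, so no entry grows.\<close>

lemma upper_BB_contract:
  assumes u: "u \<in> upper_BB \<kappa>"
  shows "inv\<^bsub>GG\<^esub> (alpha w) ** u ** alpha w \<in> upper_BB \<kappa>"
proof -
  let ?g = "inv\<^bsub>GG\<^esub> (alpha w) ** u ** alpha w"
  have uB: "u \<in> BB \<kappa>" and uG: "u \<in> carrier GG" and z: "u$2$1 = 0" "u$3$1 = 0" "u$3$2 = 0"
    using u by (auto simp: upper_BB_def bounded_by_def)
  have e: "?g $ i $ j = al (rev3 i) * u $ i $ j * al j" for i j
    unfolding adj_alpha unfolding alpha_eq by (simp add: dg_mult)
  have "\<forall>a b. av (?g $ a $ b) \<le> av (u $ a $ b)"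
    unfolding e forall_3 using z w_nonzero q_mult_le[of "av (u$1$2)"] q_mult_le[of "av (u$2$3)"]
      q_mult_le[of "av (u$1$3)"] q2_mult_le[of "av (u$1$3)"]
    by (simp add: al_def av_mult av_inverse mult.commute mult.left_commute w_cancel)
  then have "?g \<in> BB \<kappa>" using BB_if_le[OF uB conj_alpha_closed(1)[OF uG]] by blast
  then show ?thesis by (simp add: upper_BB_def e z)
qed

lemma lower_BB_contract:
  assumes l: "l \<in> lower_BB \<kappa>"
  shows "alpha w ** l ** inv\<^bsub>GG\<^esub> (alpha w) \<in> lower_BB \<kappa>"
proof -
  let ?g = "alpha w ** l ** inv\<^bsub>GG\<^esub> (alpha w)"
  have lB: "l \<in> BB \<kappa>" and lG: "l \<in> carrier GG" and z: "l$1$2 = 0" "l$1$3 = 0" "l$2$3 = 0"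
    using l by (auto simp: lower_BB_def bounded_by_def)
  have e: "?g $ i $ j = al i * l $ i $ j * al (rev3 j)" for i j
    unfolding adj_alpha unfolding alpha_eq by (simp add: dg_mult)
  have "\<forall>a b. av (?g $ a $ b) \<le> av (l $ a $ b)"
    unfolding e forall_3 using z w_nonzero q_mult_le[of "av (l$2$1)"] q_mult_le[of "av (l$3$2)"]
      q_mult_le[of "av (l$3$1)"] q2_mult_le[of "av (l$3$1)"]
    by (simp add: al_def av_mult av_inverse mult.commute mult.left_commute w_cancel)
  then have "?g \<in> BB \<kappa>" using BB_if_le[OF lB conj_alpha_closed(2)[OF lG]] by blast
  then show ?thesis by (simp add: lower_BB_def e z)
qed

lemma divide_q_le: "av x \<le> q * c \<Longrightarrow> av (inverse w * x) \<le> c" for x :: 'e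
proof -
  assume x: "av x \<le> q * c"
  have "inverse w * x = x / w" by (simp add: divide_inverse mult.commute)
  then show ?thesis using x by (simp only: av_divide pos_divide_le_eq[OF q_pos] mult.commute)
qed

lemma mult_w_le: "av x \<le> c \<Longrightarrow> av (w * x) \<le> q * c" for x :: 'e
  by (simp add: av_mult mult_left_mono)

lemma smat_lower_BB:
  assumes l: "l \<in> lower_BB \<kappa>"
  shows "smat \<kappa> ** l ** smat \<kappa> \<in> BB \<kappa>"
proof -
  let ?g = "smat \<kappa> ** l ** smat \<kappa>"
  have lB: "l \<in> BB \<kappa>" and lG: "l \<in> carrier GG" and z: "l$1$2 = 0" "l$1$3 = 0" "l$2$3 = 0"
    using l by (auto simp: lower_BB_def bounded_by_def)
  have bd: "\<forall>a b. av (l $ a $ b) \<le> bbound q \<kappa> a b" using lB by (simp add: bounded_by_def)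
  have e: "?g $ i $ j = sv \<kappa> i * (sv \<kappa> (rev3 j) * l $ rev3 i $ rev3 j)" for i j
    by (simp add: mult_smat smat_mult mult_ac)
  have "\<forall>a b. av (?g $ a $ b) \<le> bbound q \<kappa> a b"
  proof (cases \<kappa>)
    case K_zero
    then show ?thesis using bd z q_less q_pos unfolding e by (simp add: forall_3)
  next
    case K_one
    then have b: "av (l$1$1) \<le> 1" "av (l$2$2) \<le> 1" "av (l$3$3) \<le> 1" "av (l$2$1) \<le> q * 1"
      "av (l$3$2) \<le> q * 1" "av (l$3$1) \<le> q * (q * 1)" using bd by (simp_all add: forall_3)
    have "1 \<le> 1 / q" using q_pos q_less by simp
    then have "av (inverse w * (inverse w * l$3$1)) \<le> 1 / q"
      using divide_q_le[OF divide_q_le[OF b(6)]] by linarith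
    then show ?thesis using K_one z b(1-3) divide_q_le[OF b(4)] divide_q_le[OF b(5)] w_nonzero q_pos
      unfolding e by (simp add: forall_3 al_def w_cancel)
  qed
  then show ?thesis using conj_alpha_closed(3)[OF lG] by (simp add: bounded_by_def)
qed

text \<open>The upper corner arrives in the lower one with a factor \<open>w^2\<close> for
  \<open>K_zero\<close> and \<open>w^4\<close> for \<open>K_one\<close>; the entries next to the
  diagonal acquire half that exponent. These powers outweigh the bounds of \<open>BB\<close> below
  the diagonal.\<close>

lemma alpha_smat_upper_BB:
  assumes u: "u \<in> upper_BB \<kappa>"
  shows "alpha w ** (smat \<kappa> ** u ** smat \<kappa>) ** inv\<^bsub>GG\<^esub> (alpha w) \<in> BB \<kappa>"
proof -
  let ?g = "alpha w ** (smat \<kappa> ** u ** smat \<kappa>) ** inv\<^bsub>GG\<^esub> (alpha w)"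
  have uB: "u \<in> BB \<kappa>" and uG: "u \<in> carrier GG" and z: "u$2$1 = 0" "u$3$1 = 0" "u$3$2 = 0"
    using u by (auto simp: upper_BB_def bounded_by_def)
  have bd: "\<forall>a b. av (u $ a $ b) \<le> bbound q \<kappa> a b" using uB by (simp add: bounded_by_def)
  have e: "?g $ i $ j = al i * (al (rev3 j) * (sv \<kappa> i * (sv \<kappa> (rev3 j) * u $ rev3 i $ rev3 j)))" for i j
    unfolding adj_alpha unfolding alpha_eq by (simp add: dg_mult mult_smat smat_mult mult_ac)
  have qq: "q * q \<le> q" "q * (q * q) \<le> q * q" using q_mult_le[of q] q_mult_le[of "q * q"] by auto
  have "\<forall>a b. av (?g $ a $ b) \<le> bbound q \<kappa> a b"
  proof (cases \<kappa>)
    case K_zero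
    then have b: "av (u$1$1) \<le> 1" "av (u$2$2) \<le> 1" "av (u$3$3) \<le> 1" "av (u$1$2) \<le> 1"
      "av (u$2$3) \<le> 1" "av (u$1$3) \<le> 1" using bd by (simp_all add: forall_3)
    have "av (w * (w * u$1$3)) \<le> q" using mult_w_le[OF mult_w_le[OF b(6)]] qq by simp
    then show ?thesis using K_zero z b(1-3) mult_w_le[OF b(4)] mult_w_le[OF b(5)] w_nonzero q_pos
      unfolding e by (simp add: forall_3 al_def w_cancel)
  next
    case K_one
    then have b: "av (u$1$1) \<le> 1" "av (u$2$2) \<le> 1" "av (u$3$3) \<le> 1" "av (u$1$2) \<le> 1"
      "av (u$2$3) \<le> 1" "av (u$1$3) \<le> 1 / q" using bd by (simp_all add: forall_3)
    have "av (w * u$1$3) \<le> 1" using mult_w_le[OF b(6)] q_pos by simp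
    then have 31: "av (w * (w * (w * (w * u$1$3)))) \<le> q * q"
      using mult_w_le[OF mult_w_le[OF mult_w_le[of "w * u$1$3" 1]]] qq by simp
    have "av (w * (w * u$1$2)) \<le> q" "av (w * (w * u$2$3)) \<le> q"
      using mult_w_le[OF mult_w_le[OF b(4)]] mult_w_le[OF mult_w_le[OF b(5)]] qq by simp_all
    then show ?thesis using K_one z b(1-3) 31 w_nonzero q_pos
      unfolding e by (simp add: forall_3 al_def w_cancel)
  qed
  then show ?thesis using conj_alpha_closed(2)[OF conj_alpha_closed(3)[OF uG]] by (simp add: bounded_by_def)
qed

lemma iwahori_decomposition_GG:
  assumes p: "Factorial_Ring.prime p" "av (of_nat p :: 'e) < 1"
    and Kp: "maximal_normal_pro_p p (GG\<lparr>carrier := KK \<kappa>\<rparr>) Kp"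
  shows "iwahori_decomposition GG p (KK \<kappa>) (BB \<kappa>) (UU \<kappa>) Kp (smat \<kappa>) (alpha w)
    (upper_BB \<kappa>) (lower_BB \<kappa>)"
proof (intro iwahori_decomposition.intro maximal_compact.intro maximal_compact_axioms.intro
    iwahori_decomposition_axioms.intro)
  show "topological_matrix_group GG" by (rule GG.topological_matrix_group_axioms)
  show "Factorial_Ring.prime p" by fact
  show "subgroup (KK \<kappa>) GG" by (rule KK_subgroup)
  show "compact (KK \<kappa>)" by (rule bounded_by_compact) (rule kbound_props)
  show "GG.op (KK \<kappa>)" by (rule bounded_by_open) (rule kbound_props)
  show "subgroup (BB \<kappa>) GG" by (rule BB_subgroup)
  show "BB \<kappa> \<subseteq> KK \<kappa>" by (rule BB_subset)
  show "GG.op (BB \<kappa>)" by (rule bounded_by_open) (rule bbound_props)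
  show "subgroup (UU \<kappa>) GG" by (rule UU_subgroup)
  show "UU \<kappa> \<subseteq> BB \<kappa>" by (auto simp: UU_def)
  show "\<exists>i::nat. u [^]\<^bsub>GG\<^esub> (p ^ i) \<in> V" if "open V" "\<one>\<^bsub>GG\<^esub> \<in> V" "u \<in> UU \<kappa>" for V u
    using UU_powers[OF p(2) that(1) _ that(3)] that(2) by simp
  show "smat \<kappa> \<in> KK \<kappa>" by (rule smat_KK)
  show "smat \<kappa> \<otimes>\<^bsub>GG\<^esub> smat \<kappa> = \<one>\<^bsub>GG\<^esub>" by (simp add: smat_square)
  show "g \<in> BB \<kappa> \<or> (\<exists>u\<in>UU \<kappa>. \<exists>b\<in>BB \<kappa>. g = u \<otimes>\<^bsub>GG\<^esub> smat \<kappa> \<otimes>\<^bsub>GG\<^esub> b)" if "g \<in> KK \<kappa>" for g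
    using bruhat_KK[OF that] by auto
  show "\<exists>u\<in>UU \<kappa>. smat \<kappa> \<otimes>\<^bsub>GG\<^esub> u \<otimes>\<^bsub>GG\<^esub> smat \<kappa> \<notin> BB \<kappa>" using smat_not_normalizes by simp
  show "maximal_normal_pro_p p (GG\<lparr>carrier := KK \<kappa>\<rparr>) Kp" by fact
  show "alpha w \<in> carrier GG" by (rule alpha_GG)
  show "smat \<kappa> \<otimes>\<^bsub>GG\<^esub> alpha w \<otimes>\<^bsub>GG\<^esub> smat \<kappa> = inv\<^bsub>GG\<^esub> (alpha w)" by (simp add: smat_alpha_smat)
  show "upper_BB \<kappa> \<subseteq> BB \<kappa>" "lower_BB \<kappa> \<subseteq> BB \<kappa>" by (auto simp: upper_BB_def lower_BB_def)
qed (simp_all add: lower_upper_factorization upper_lower_factorization upper_BB_contract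
      lower_BB_contract smat_lower_BB alpha_smat_upper_BB)

end

section \<open>The Iwahori subgroups defined through \<open>Kp\<close> in explicit terms\<close>

context maximal_compact
begin

lemma Kp_coset: "Kp #>\<^bsub>G\<lparr>carrier := K\<rparr>\<^esub> g = (\<lambda>k. k \<otimes> g) ` Kp"
  by (auto simp: r_coset_def)

lemma Kp_coset_in: "g \<in> K \<Longrightarrow> Kp #>\<^bsub>G\<lparr>carrier := K\<rparr>\<^esub> g \<in> carrier (G\<lparr>carrier := K\<rparr> Mod Kp)"
  by (auto simp: carrier_FactGroup)

end

context unramified_extension
begin

text \<open>A coset counts as upper triangular as soon as one representative is. As
  \<open>Kp\<close> lies in \<open>BB\<close>, this forces \<open>g\<close> itself into
  \<open>BB\<close>.\<close>

lemma Iwahori_eq: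
  assumes "maximal_compact GG p (KK \<kappa>) (BB \<kappa>) (UU \<kappa>) Kp (smat \<kappa>)"
  shows "Iwahori cj w \<kappa> Kp = BB \<kappa>"
proof -
  interpret M: maximal_compact GG p "KK \<kappa>" "BB \<kappa>" "UU \<kappa>" Kp "smat \<kappa>" by fact
  have key: "(\<exists>k\<in>Kp. red_upper w \<kappa> (k \<otimes>\<^bsub>GG\<^esub> g)) \<longleftrightarrow> g \<in> BB \<kappa>" if g: "g \<in> KK \<kappa>" for g
  proof
    assume "\<exists>k\<in>Kp. red_upper w \<kappa> (k \<otimes>\<^bsub>GG\<^esub> g)"
    then obtain k where k: "k \<in> Kp" "red_upper w \<kappa> (k \<otimes>\<^bsub>GG\<^esub> g)" by blast
    have "k \<otimes>\<^bsub>GG\<^esub> g \<in> BB \<kappa>"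
      using k(2) red_upper_iff[OF M.K_closed(2)[OF M.Kp_K[OF k(1)] g]] by simp
    moreover have kB: "k \<in> BB \<kappa>" using M.Kp_subset_B k(1) by blast
    ultimately have "inv\<^bsub>GG\<^esub> k \<otimes>\<^bsub>GG\<^esub> (k \<otimes>\<^bsub>GG\<^esub> g) \<in> BB \<kappa>"
      by (metis M.B_closed(2) M.B_closed(3))
    then show "g \<in> BB \<kappa>"
      using GG.inv_cancel_assoc(1)[OF M.B_carrier[OF kB] M.K_carrier[OF g]] by simp
  next
    assume gB: "g \<in> BB \<kappa>"
    have "\<one>\<^bsub>GG\<^esub> \<in> Kp" by (rule subgroup.one_closed[OF M.Kp_subgroup])
    moreover have "red_upper w \<kappa> (\<one>\<^bsub>GG\<^esub> \<otimes>\<^bsub>GG\<^esub> g)" using red_upper_iff[OF g] gB by simp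
    ultimately show "\<exists>k\<in>Kp. red_upper w \<kappa> (k \<otimes>\<^bsub>GG\<^esub> g)" by blast
  qed
  have "g \<in> Iwahori cj w \<kappa> Kp \<longleftrightarrow> g \<in> KK \<kappa> \<and> (\<exists>k\<in>Kp. red_upper w \<kappa> (k \<otimes>\<^bsub>GG\<^esub> g))" for g
  proof -
    have "g \<in> KK \<kappa> \<Longrightarrow> (\<lambda>k. k \<otimes>\<^bsub>GG\<^esub> g) ` Kp \<in> carrier (GG\<lparr>carrier := KK \<kappa>\<rparr> Mod Kp)"
      using M.Kp_coset_in[of g] unfolding M.Kp_coset .
    then show ?thesis
      unfolding Iwahori_def Gamma_upper_def Kset_eq M.Kp_coset mem_Collect_eq bex_simps(7) by blast
  qed
  then show ?thesis using key M.B_K by (intro Set.set_eqI) metis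
qed

text \<open>This form turns a vector fixed by \<open>Kp\<close> and by \<open>UU\<close> into one
  fixed by the pro-p Iwahori subgroup.\<close>

lemma pro_p_IwahoriE:
  assumes "maximal_compact GG p (KK \<kappa>) (BB \<kappa>) (UU \<kappa>) Kp (smat \<kappa>)"
    and g: "g \<in> pro_p_Iwahori cj w \<kappa> Kp"
  obtains k u where "k \<in> Kp" "u \<in> UU \<kappa>" "g = inv\<^bsub>GG\<^esub> k \<otimes>\<^bsub>GG\<^esub> u"
proof -
  interpret M: maximal_compact GG p "KK \<kappa>" "BB \<kappa>" "UU \<kappa>" Kp "smat \<kappa>" by fact
  have gK: "g \<in> KK \<kappa>" using g by (simp add: pro_p_Iwahori_def Kset_eq)
  obtain k where k: "k \<in> Kp" "red_unipotent w \<kappa> (k \<otimes>\<^bsub>GG\<^esub> g)"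
    using g unfolding pro_p_Iwahori_def Gamma_unipotent_def Kset_eq M.Kp_coset mem_Collect_eq bex_simps(7)
    by blast
  have "k \<otimes>\<^bsub>GG\<^esub> g \<in> UU \<kappa>"
    using k(2) red_unipotent_iff[OF M.K_closed(2)[OF M.Kp_K[OF k(1)] gK]] by simp
  moreover have "g = inv\<^bsub>GG\<^esub> k \<otimes>\<^bsub>GG\<^esub> (k \<otimes>\<^bsub>GG\<^esub> g)"
    using GG.inv_cancel_assoc(1)[OF M.K_carrier[OF M.Kp_K[OF k(1)]] M.K_carrier[OF gK]] by simp
  ultimately show thesis using that k(1) by blast
qed

end

theorem proposition4p14:
  fixes F :: "'e::{field,metric_space} set"
    and cj :: "'e \<Rightarrow> 'e"
    and w :: 'e
    and \<kappa> :: max_compact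
    and Kp :: "'e mat3 set"
    and scl :: "'p::prime_card Fpbar \<Rightarrow> 'v::ab_group_add \<Rightarrow> 'v"
    and \<pi> :: "'e mat3 \<Rightarrow> 'v \<Rightarrow> 'v"
    and emb :: "'v set \<Rightarrow> ('e mat3 \<Rightarrow> 'v \<Rightarrow> 'v) \<Rightarrow> 'v \<Rightarrow> 'v"
    and \<iota> :: "'v set \<Rightarrow> ('e mat3 \<Rightarrow> 'v \<Rightarrow> 'v) \<Rightarrow> ('e mat3 \<Rightarrow> 'v) \<Rightarrow> 'v"
  defines "G \<equiv> unitary_group cj"
    and "K \<equiv> Kset cj \<kappa>"
    and "I \<equiv> Iwahori cj w \<kappa> Kp"
    and "I\<^sub>1 \<equiv> pro_p_Iwahori cj w \<kappa> Kp"
  assumes "unramified_quadratic F"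
    and "(of_nat CARD('p) :: 'e) \<in> max_ideal"
    and "odd CARD('p)"
    and "nontrivial_galois F cj"
    and "w \<in> F" and "is_uniformizer UNIV w"
    and "maximal_normal_pro_p CARD('p) (G\<lparr>carrier := K\<rparr>) Kp"
    and "irreducible_smooth_rep scl G UNIV \<pi>"
    and "\<And>W \<sigma>. weight_contained scl (G\<lparr>carrier := K\<rparr>) \<pi> W \<sigma> \<Longrightarrow>
           rep_embedding scl (G\<lparr>carrier := K\<rparr>) W \<sigma> \<pi> (emb W \<sigma>)"
    and "\<And>W \<sigma>. weight_contained scl (G\<lparr>carrier := K\<rparr>) \<pi> W \<sigma> \<Longrightarrow>
           frobenius_induced scl G K W \<sigma> \<pi> (emb W \<sigma>) (\<iota> W \<sigma>)"
    and "\<And>W \<sigma>. weight_contained scl (G\<lparr>carrier := K\<rparr>) \<pi> W \<sigma> \<Longrightarrow>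
           invariants \<pi> I\<^sub>1 \<subseteq>
             \<iota> W \<sigma> ` I_plus G K I (alpha w) W \<sigma> \<inter> \<iota> W \<sigma> ` I_minus G K I (alpha w) W \<sigma>"
    and "weight_contained scl (G\<lparr>carrier := K\<rparr>) \<pi> W \<sigma>"
    and "weight_contained scl (G\<lparr>carrier := K\<rparr>) \<pi> W' \<sigma>'"
  shows "\<iota> W \<sigma> ` I_plus G K I (alpha w) W \<sigma> \<inter> \<iota> W \<sigma> ` I_minus G K I (alpha w) W \<sigma> =
         \<iota> W' \<sigma>' ` I_plus G K I (alpha w) W' \<sigma>' \<inter> \<iota> W' \<sigma>' ` I_minus G K I (alpha w) W' \<sigma>'"
proof -
  interpret E: unramified_extension F cj w
    using assms(5,8-10) by unfold_locales
  have K: "K = E.KK \<kappa>" by (simp add: K_def E.Kset_eq)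
  have pp: "Factorial_Ring.prime CARD('p)" by (rule prime_card)
  have "maximal_normal_pro_p CARD('p) (E.GG\<lparr>carrier := E.KK \<kappa>\<rparr>) Kp"
    using assms(11) unfolding G_def K .
  moreover have "dist (of_nat CARD('p) :: 'e) 0 < 1" using assms(6) by (simp add: max_ideal_def)
  ultimately have iw: "iwahori_decomposition G CARD('p) K (E.BB \<kappa>) (E.UU \<kappa>) Kp (E.smat \<kappa>) (alpha w)
      (E.upper_BB \<kappa>) (E.lower_BB \<kappa>)"
    using E.iwahori_decomposition_GG[OF pp] unfolding G_def K by blast
  interpret D: iwahori_decomposition G "CARD('p)" K "E.BB \<kappa>" "E.UU \<kappa>" Kp "E.smat \<kappa>" "alpha w"
      "E.upper_BB \<kappa>" "E.lower_BB \<kappa>" by (rule iw)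
  have mc: "maximal_compact E.GG CARD('p) (E.KK \<kappa>) (E.BB \<kappa>) (E.UU \<kappa>) Kp (E.smat \<kappa>)"
    using D.maximal_compact_axioms unfolding G_def K .
  have I: "I = E.BB \<kappa>" unfolding I_def by (rule E.Iwahori_eq[OF mc])
  have rep: "smooth_rep scl G UNIV \<pi>" using assms(12) by (simp add: irreducible_smooth_rep_def)
  have char: "CHAR('p Fpbar) = CARD('p)" by simp
  have ind: "induced_map G CARD('p) K (E.BB \<kappa>) (E.UU \<kappa>) Kp (E.smat \<kappa>) (alpha w)
      (E.upper_BB \<kappa>) (E.lower_BB \<kappa>) scl \<pi> V \<tau> (emb V \<tau>) (\<iota> V \<tau>)"
    if wt: "weight_contained scl (G\<lparr>carrier := K\<rparr>) \<pi> V \<tau>" for V \<tau>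
    using iw rep assms(13)[OF wt] assms(14)[OF wt] wt
    by (simp add: induced_map_def induced_map_axioms_def weight_contained_def irreducible_smooth_rep_def)
  have le: "\<iota> V \<tau> ` I_plus G K I (alpha w) V \<tau> \<inter> \<iota> V \<tau> ` I_minus G K I (alpha w) V \<tau> \<subseteq>
      \<iota> V' \<tau>' ` I_plus G K I (alpha w) V' \<tau>' \<inter> \<iota> V' \<tau>' ` I_minus G K I (alpha w) V' \<tau>'"
    if wt: "weight_contained scl (G\<lparr>carrier := K\<rparr>) \<pi> V \<tau>"
      and wt': "weight_contained scl (G\<lparr>carrier := K\<rparr>) \<pi> V' \<tau>'" for V \<tau> V' \<tau>'
  proof -
    interpret A: induced_map G "CARD('p)" K "E.BB \<kappa>" "E.UU \<kappa>" Kp "E.smat \<kappa>" "alpha w"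
      "E.upper_BB \<kappa>" "E.lower_BB \<kappa>" scl \<pi> V \<tau> "emb V \<tau>" "\<iota> V \<tau>" by (rule ind[OF wt])
    have irr: "irreducible_smooth_rep scl (G\<lparr>carrier := K\<rparr>) V \<tau>"
      using wt by (simp add: weight_contained_def)
    then have "V \<noteq> {0}" by (simp add: irreducible_smooth_rep_def)
    then obtain x where x: "x \<in> V" "x \<noteq> 0" using A.W_zero by blast
    have jx: "emb V \<tau> x \<noteq> 0"
      using inj_onD[OF A.j_inj, of x 0] x A.W_zero A.j_zero by auto
    \<comment> \<open>The fixed vector is sought inside the image of \<open>V\<close>, so that
      irreducibility of \<open>\<tau>\<close> can spread its position to the whole image.\<close>
    obtain v where v: "v \<in> emb V \<tau> ` V" "v \<noteq> 0" "\<And>h. h \<in> Kp \<Longrightarrow> \<pi> h v = v"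
        "\<And>u. u \<in> E.UU \<kappa> \<Longrightarrow> \<pi> u v = v"
    proof (rule D.exists_fixed_vector[OF rep char, of "emb V \<tau> ` V" "emb V \<tau> x"])
      show "0 \<in> emb V \<tau> ` V" using imageI[OF A.W_zero, of "emb V \<tau>"] by (simp only: A.j_zero)
      show "y + z \<in> emb V \<tau> ` V" if yz: "y \<in> emb V \<tau> ` V" "z \<in> emb V \<tau> ` V" for y z
      proof -
        obtain y' z' where "y' \<in> V" "z' \<in> V" "y = emb V \<tau> y'" "z = emb V \<tau> z'" using yz by blast
        then show ?thesis using imageI[OF A.W_add, of y' z' "emb V \<tau>"] by (simp add: A.j_add)
      qed
      show "\<pi> k y \<in> emb V \<tau> ` V" if k: "k \<in> K" and y: "y \<in> emb V \<tau> ` V" for k y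
      proof -
        obtain y' where "y' \<in> V" "y = emb V \<tau> y'" using y by blast
        then show ?thesis using imageI[OF A.sigma_closed[OF k], of y' "emb V \<tau>"] by (simp add: A.j_sigma k)
      qed
      show "emb V \<tau> x \<in> emb V \<tau> ` V" using x by simp
      show "emb V \<tau> x \<noteq> 0" by (rule jx)
    qed (rule that)
    have "\<pi> g v = v" if g: "g \<in> I\<^sub>1" for g
    proof -
      obtain k u where ku: "k \<in> Kp" "u \<in> E.UU \<kappa>" "g = inv\<^bsub>G\<^esub> k \<otimes>\<^bsub>G\<^esub> u"
        using E.pro_p_IwahoriE[OF mc g[unfolded I\<^sub>1_def]] unfolding G_def by blast
      have k: "inv\<^bsub>G\<^esub> k \<in> Kp" using subgroup.m_inv_closed[OF D.Kp_subgroup ku(1)] .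
      have "\<pi> g v = \<pi> (inv\<^bsub>G\<^esub> k) (\<pi> u v)"
        unfolding ku(3) by (rule A.pi_mult[OF D.K_carrier[OF D.Kp_K[OF k]] D.U_carrier[OF ku(2)]])
      then show ?thesis using v(3)[OF k] v(4)[OF ku(2)] by simp
    qed
    then have "v \<in> invariants \<pi> I\<^sub>1" by (simp add: invariants_def)
    \<comment> \<open>The hypothesis on invariants is applied to the other weight, not to the one
      that contains \<open>v\<close>.\<close>
    then have "v \<in> \<iota> V' \<tau>' ` I_plus G K I (alpha w) V' \<tau>'" "v \<in> \<iota> V' \<tau>' ` I_minus G K I (alpha w) V' \<tau>'"
      using assms(15)[OF wt'] by auto
    then show ?thesis using span_le[OF ind[OF wt] ind[OF wt'] irr v(1,2)] unfolding I by blast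
  qed
  show ?thesis by (rule equalityI[OF le[OF assms(16,17)] le[OF assms(17,16)]])
qed

end
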